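(* Let $p,q$ be distinct odd primes. (i) Suppose $p\equiv1\pmod q$. All the braiding structures on $\mathscr{A}_0$ are given by $$\langle e_hg^i,e_kg^j\rangle=\delta_{h,b^j}\,\delta_{k,b^{-i}}\,\lambda^{ij},\qquad h,k\in\mathbb{Z}_p\rtimes\mathbb{Z}_q,\ 0\le i,j\le q-1,$$ where $\lambda\in\Bbbk$ is such that $\lambda^q=1$. (ii) Suppose $q\equiv1\pmod p$ and let $\lambda\in\{0\}\cup\{\lambda_j\mid 1\le j\le(p-1)/2\}$. All the quasitriangular structures on $\mathscr{B}_\lambda$ are given by $$R=\sum_{0\le i,j\le q-1,\ 0\le k,l\le q-1}w(a^ib^j,a^kb^l)\,e_{a^ib^j}\otimes e_{a^kb^l},$$ where $w$ is a bicharacter on $\mathbb{Z}_q\times\mathbb{Z}_q=\langle a,b\rangle$ determined by the conditions $$w(a,a)=w(a^m,a^m),\quad w(a,b)=w(a^m,b^{m^\lambda})\,\eta(a^m,b^{m^\lambda},g),$$ $$w(b,a)=w(b^{m^\lambda},a^m)\,\eta(b^{m^\lambda},a^m,g),\quad w(b,b)=w(b^{m^\lambda},b^{m^\lambda})$$ (that is, the quasitriangular structures are exactly the $R$ coming from bicharacters $w$ satisfying these conditions).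
   Context: $\Bbbk$ is an algebraically closed field of characteristic $0$. A quasitriangular structure on a Hopf algebra $H$ is an invertible $R\in H\otimes H$ with $(\Delta\otimes \mathrm{Id})(R)=R_{13}R_{23}$, $(\mathrm{Id}\otimes\Delta)(R)=R_{13}R_{12}$ and $\Delta^{op}(h)R=R\Delta(h)$ for all $h\in H$. A braiding structure on $H$ is a convolution-invertible linear map $\langle\,,\rangle:H\otimes H\to\Bbbk$ with $\langle xy,z\rangle=\langle x,z_{(1)}\rangle\langle y,z_{(2)}\rangle$, $\langle x,yz\rangle=\langle x_{(1)},z\rangle\langle x_{(2)},y\rangle$ and $\langle x_{(1)},y_{(1)}\rangle x_{(2)}y_{(2)}=\langle x_{(2)},y_{(2)}\rangle y_{(1)}x_{(1)}$ for all $x,y,z\in H$. Abelian extensions with trivial $\triangleright$. Let $G,F$ be finite groups, with $F$ acting on $G$ on the right by group automorphisms, $(g,f)\mapsto g\triangleleft f$ (and $G$ acting trivially on $F$). For suitable maps $\sigma:G\times F\times F\to\Bbbk^\times$, $\tau:G\times G\times F\to\Bbbk^\times$, the Hopf algebra $\Bbbk^G\#_{\sigma,\tau}\Bbbk F$ is $\Bbbk^G\otimes\Bbbk F$ as a vector space, with basis $e_g\# f$ ($g\in G,f\in F$; $\{e_g\}$ is the basis of $\Bbbk^G$ dual to $G$), product $(e_g\#f)(e_{g'}\#f')=\delta_{g\triangleleft f,g'}\,\sigma(g,f,f')\,e_g\#ff'$, coproduct $\Delta(e_g\#f)=\sum_{g'g''=g}\tau(g',g'',f)\,e_{g'}\#f\otimes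 e_{g''}\#f$, unit $\sum_{g}e_g\#1$ and counit $\epsilon(e_g\#f)=\delta_{g,1}$. One writes $e_hf$ for $e_h\#f$ and $e_h$ for $e_h\#1$. The Hopf algebra $\mathscr{A}_0$ ($p\equiv1\pmod q$): fix $t\in\mathbb{N}$ with $t^q\equiv1\pmod p$, $t\not\equiv1\pmod p$. Take $G=\mathbb{Z}_p\rtimes\mathbb{Z}_q=\langle a,b\mid a^p=b^q=1,\ bab^{-1}=a^t\rangle$, $F=\mathbb{Z}_q=\langle g\mid g^q=1\rangle$, $a\triangleleft g^i=a^{t^i}$, $b\triangleleft g^i=b$, and $\sigma\equiv1$, $\tau\equiv1$. The Hopf algebras $\mathscr{B}_\lambda$ ($q\equiv1\pmod p$, $0\le\lambda\le p-1$): fix a primitive $q$th root of unity $\zeta\in\Bbbk$ and $m\in\mathbb{N}$ with $m^p\equiv1\pmod q$, $m\not\equiv1\pmod q$. Take $G=\mathbb{Z}_q\times\mathbb{Z}_q=\langle a,b\mid a^q=b^q=1,ab=ba\rangle$, $F=\mathbb{Z}_p=\langle g\mid g^p=1\rangle$, $a\triangleleft g^{-i}=a^{m^i}$, $b\triangleleft g^{-i}=b^{m^{\lambda i}}$, $\sigma\equiv1$, and $\tau(a^ib^j,a^kb^l,g^n)=\zeta_n^{jk}$ for $0\le n\le p-1$, where $\zeta_n=\zeta^{c_n(m^{\lambda+1})}$ and $c_n(r)=1+r+\dots+r^{n-1}$ for $r\in\mathbb{Z}$. For $h,k\in\mathbb{Z}_q\times\mathbb{Z}_q$ put $\eta(h,k,g)=\tau(h,k,g)\tau(k,h,g)^{-1}$.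 $\{\lambda_j\mid 1\le j\le (p-1)/2\}$ is a fixed chosen subset (of $(p-1)/2$ distinct elements) of $\{1,2,\dots,p-2\}$ such that $\lambda_i\lambda_j\not\equiv1\pmod p$ whenever $i\ne j$. A bicharacter on an abelian group $A$ is a map $w:A\times A\to\Bbbk^\times$ multiplicative in each variable.
   Formalization: In the definition of B_λ, ζ_n is taken as ζ^{c_n(m^{-(λ+1)})} (inverse mod q) instead of ζ^{c_n(m^{λ+1})}: with the stated action the printed τ does not make the coproduct multiplicative at g^2, and (ii) fails; τ and η at g are unchanged. *)

theory Defs
  imports "HOL-Algebra.Elementary_Groups" "HOL-Number_Theory.Cong"
    "HOL-Computational_Algebra.Polynomial"
begin

section \<open>Finite-dimensional bialgebra data with a distinguished basis\<close>

text \<open>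
  A finite-dimensional Hopf algebra is given by a finite basis \<open>basis H\<close>, the product
  and the coproduct of basis vectors, the unit and the counit.  A vector is its coordinate
  function; coordinates vanish outside the basis.  The tensor product of the spaces with bases
  \<open>B\<close> and \<open>C\<close> is the space with basis \<open>B \<times> C\<close>.  The antipode plays no role in the definitions
  of quasitriangular and braiding structures and is not recorded.
\<close>

record ('b, 'k) hopf_data =
  basis :: "'b set"
  hmul :: "'b \<Rightarrow> 'b \<Rightarrow> 'b \<Rightarrow> 'k"
  hone :: "'b \<Rightarrow> 'k"
  hcomul :: "'b \<Rightarrow> 'b \<times> 'b \<Rightarrow> 'k"
  hcounit :: "'b \<Rightarrow> 'k"

definition vecs :: "'b set \<Rightarrow> ('b \<Rightarrow> 'k::zero) set" where
  "vecs B = {x. \<forall>b. b \<notin> B \<longrightarrow> x b = 0}"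

definition bvec :: "'b \<Rightarrow> 'b \<Rightarrow> 'k::zero_neq_one" where
  "bvec b = (\<lambda>c. if c = b then 1 else 0)"

definition tens :: "('b \<Rightarrow> 'k::times) \<Rightarrow> ('c \<Rightarrow> 'k) \<Rightarrow> 'b \<times> 'c \<Rightarrow> 'k"  (infixr "\<otimes>\<^sub>v" 75) where
  "x \<otimes>\<^sub>v y = (\<lambda>(b, c). x b * y c)"

definition linear_form :: "'b set \<Rightarrow> (('b \<Rightarrow> 'k::field) \<Rightarrow> 'k) \<Rightarrow> bool" where
  "linear_form B \<phi> \<longleftrightarrow>
     (\<forall>x\<in>vecs B. \<forall>y\<in>vecs B. \<phi> (\<lambda>b. x b + y b) = \<phi> x + \<phi> y) \<and>
     (\<forall>c. \<forall>x\<in>vecs B. \<phi> (\<lambda>b. c * x b) = c * \<phi> x)"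

definition hprod :: "('b, 'k::field) hopf_data \<Rightarrow> ('b \<Rightarrow> 'k) \<Rightarrow> ('b \<Rightarrow> 'k) \<Rightarrow> 'b \<Rightarrow> 'k" where
  "hprod H x y = (\<lambda>c. \<Sum>a\<in>basis H. \<Sum>b\<in>basis H. x a * y b * hmul H a b c)"

definition hcoprod :: "('b, 'k::field) hopf_data \<Rightarrow> ('b \<Rightarrow> 'k) \<Rightarrow> 'b \<times> 'b \<Rightarrow> 'k" where
  "hcoprod H x = (\<lambda>uv. \<Sum>b\<in>basis H. x b * hcomul H b uv)"

definition heps :: "('b, 'k::field) hopf_data \<Rightarrow> ('b \<Rightarrow> 'k) \<Rightarrow> 'k" where
  "heps H x = (\<Sum>b\<in>basis H. x b * hcounit H b)"

definition hopf_tensor ::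
  "('b, 'k::field) hopf_data \<Rightarrow> ('c, 'k) hopf_data \<Rightarrow> ('b \<times> 'c, 'k) hopf_data"
  (infixr "\<otimes>\<^sub>H" 75) where
  "H \<otimes>\<^sub>H K = \<lparr>
     basis = basis H \<times> basis K,
     hmul = (\<lambda>(b, c) (b', c'). hmul H b b' \<otimes>\<^sub>v hmul K c c'),
     hone = hone H \<otimes>\<^sub>v hone K,
     hcomul = (\<lambda>(b, c) ((u, u'), (v, v')). hcomul H b (u, v) * hcomul K c (u', v')),
     hcounit = (\<lambda>(b, c). hcounit H b * hcounit K c)\<rparr>"


section \<open>Quasitriangular and braiding structures\<close>

definition R12 :: "('b, 'k::field) hopf_data \<Rightarrow> ('b \<times> 'b \<Rightarrow> 'k) \<Rightarrow> 'b \<times> 'b \<times> 'b \<Rightarrow> 'k" where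
  "R12 H R = (\<lambda>(x, y, z). R (x, y) * hone H z)"

definition R13 :: "('b, 'k::field) hopf_data \<Rightarrow> ('b \<times> 'b \<Rightarrow> 'k) \<Rightarrow> 'b \<times> 'b \<times> 'b \<Rightarrow> 'k" where
  "R13 H R = (\<lambda>(x, y, z). R (x, z) * hone H y)"

definition R23 :: "('b, 'k::field) hopf_data \<Rightarrow> ('b \<times> 'b \<Rightarrow> 'k) \<Rightarrow> 'b \<times> 'b \<times> 'b \<Rightarrow> 'k" where
  "R23 H R = (\<lambda>(x, y, z). R (y, z) * hone H x)"

definition comul_left ::
  "('b, 'k::field) hopf_data \<Rightarrow> ('b \<times> 'b \<Rightarrow> 'k) \<Rightarrow> 'b \<times> 'b \<times> 'b \<Rightarrow> 'k" where
  "comul_left H R = (\<lambda>(x, y, z). \<Sum>b\<in>basis H. R (b, z) * hcomul H b (x, y))"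

definition comul_right ::
  "('b, 'k::field) hopf_data \<Rightarrow> ('b \<times> 'b \<Rightarrow> 'k) \<Rightarrow> 'b \<times> 'b \<times> 'b \<Rightarrow> 'k" where
  "comul_right H R = (\<lambda>(x, y, z). \<Sum>b\<in>basis H. R (x, b) * hcomul H b (y, z))"

definition hinvertible :: "('b, 'k::field) hopf_data \<Rightarrow> ('b \<Rightarrow> 'k) \<Rightarrow> bool" where
  "hinvertible A x \<longleftrightarrow> (\<exists>y\<in>vecs (basis A). hprod A x y = hone A \<and> hprod A y x = hone A)"

definition quasitriangular :: "('b, 'k::field) hopf_data \<Rightarrow> ('b \<times> 'b \<Rightarrow> 'k) \<Rightarrow> bool" where
  "quasitriangular H R \<longleftrightarrow>
     R \<in> vecs (basis (H \<otimes>\<^sub>H H)) \<and>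
     hinvertible (H \<otimes>\<^sub>H H) R \<and>
     comul_left H R = hprod (H \<otimes>\<^sub>H H \<otimes>\<^sub>H H) (R13 H R) (R23 H R) \<and>
     comul_right H R = hprod (H \<otimes>\<^sub>H H \<otimes>\<^sub>H H) (R13 H R) (R12 H R) \<and>
     (\<forall>h\<in>vecs (basis H).
        hprod (H \<otimes>\<^sub>H H) (\<lambda>(u, v). hcoprod H h (v, u)) R = hprod (H \<otimes>\<^sub>H H) R (hcoprod H h))"

definition conv ::
  "('b, 'k::field) hopf_data \<Rightarrow> (('b \<Rightarrow> 'k) \<Rightarrow> 'k) \<Rightarrow> (('b \<Rightarrow> 'k) \<Rightarrow> 'k) \<Rightarrow> ('b \<Rightarrow> 'k) \<Rightarrow> 'k" where
  "conv C \<phi> \<psi> x = (\<Sum>(u, v)\<in>basis C \<times> basis C. hcoprod C x (u, v) * \<phi> (bvec u) * \<psi> (bvec v))"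

definition conv_invertible :: "('b, 'k::field) hopf_data \<Rightarrow> (('b \<Rightarrow> 'k) \<Rightarrow> 'k) \<Rightarrow> bool" where
  "conv_invertible C \<phi> \<longleftrightarrow>
     (\<exists>\<psi>. linear_form (basis C) \<psi> \<and>
       (\<forall>x\<in>vecs (basis C). conv C \<phi> \<psi> x = heps C x \<and> conv C \<psi> \<phi> x = heps C x))"

text \<open>
  A form \<open>\<langle>x, y\<rangle>\<close> is \<open>\<beta> (x \<otimes>\<^sub>v y)\<close> for \<open>\<beta>\<close> defined on \<open>H \<otimes> H\<close>.  In the Sweedler sums
  \<open>u\<close> and \<open>v\<close> run through the first and second tensor factors of a coproduct.
\<close>

definition braiding_structure ::
  "('b, 'k::field) hopf_data \<Rightarrow> (('b \<times> 'b \<Rightarrow> 'k) \<Rightarrow> 'k) \<Rightarrow> bool" where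
  "braiding_structure H \<beta> \<longleftrightarrow>
     linear_form (basis (H \<otimes>\<^sub>H H)) \<beta> \<and>
     conv_invertible (H \<otimes>\<^sub>H H) \<beta> \<and>
     (\<forall>x\<in>vecs (basis H). \<forall>y\<in>vecs (basis H). \<forall>z\<in>vecs (basis H).
        \<beta> (hprod H x y \<otimes>\<^sub>v z) =
          (\<Sum>(u, v)\<in>basis H \<times> basis H.
             hcoprod H z (u, v) * \<beta> (x \<otimes>\<^sub>v bvec u) * \<beta> (y \<otimes>\<^sub>v bvec v))) \<and>
     (\<forall>x\<in>vecs (basis H). \<forall>y\<in>vecs (basis H). \<forall>z\<in>vecs (basis H).
        \<beta> (x \<otimes>\<^sub>v hprod H y z) =
          (\<Sum>(u, v)\<in>basis H \<times> basis H.
             hcoprod H x (u, v) * \<beta> (bvec u \<otimes>\<^sub>v z) * \<beta> (bvec v \<otimes>\<^sub>v y))) \<and>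
     (\<forall>x\<in>vecs (basis H). \<forall>y\<in>vecs (basis H). \<forall>c.
        (\<Sum>(u, v)\<in>basis H \<times> basis H. \<Sum>(u', v')\<in>basis H \<times> basis H.
           hcoprod H x (u, v) * hcoprod H y (u', v') * \<beta> (bvec u \<otimes>\<^sub>v bvec u') * hmul H v v' c) =
        (\<Sum>(u, v)\<in>basis H \<times> basis H. \<Sum>(u', v')\<in>basis H \<times> basis H.
           hcoprod H x (u, v) * hcoprod H y (u', v') * \<beta> (bvec v \<otimes>\<^sub>v bvec v') * hmul H u' u c))"


section \<open>Abelian extensions with trivial action on \<open>F\<close>\<close>

text \<open>The basis vector \<open>e\<^sub>g # f\<close> is \<open>bvec (g, f)\<close>, and \<open>act g f\<close> is \<open>g \<triangleleft> f\<close>.\<close>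

definition ab_ext ::
  "'g monoid \<Rightarrow> 'f monoid \<Rightarrow> ('g \<Rightarrow> 'f \<Rightarrow> 'g) \<Rightarrow> ('g \<Rightarrow> 'f \<Rightarrow> 'f \<Rightarrow> 'k) \<Rightarrow> ('g \<Rightarrow> 'g \<Rightarrow> 'f \<Rightarrow> 'k)
   \<Rightarrow> ('g \<times> 'f, 'k::field) hopf_data" where
  "ab_ext G F act \<sigma> \<tau> = \<lparr>
     basis = carrier G \<times> carrier F,
     hmul = (\<lambda>(g, f) (g', f') c.
        if act g f = g' then \<sigma> g f f' * bvec (g, f \<otimes>\<^bsub>F\<^esub> f') c else 0),
     hone = (\<lambda>c. \<Sum>g\<in>carrier G. bvec (g, \<one>\<^bsub>F\<^esub>) c),
     hcomul = (\<lambda>(g, f) c.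
        \<Sum>(g', g'')\<in>{(g', g''). g' \<in> carrier G \<and> g'' \<in> carrier G \<and> g' \<otimes>\<^bsub>G\<^esub> g'' = g}.
          \<tau> g' g'' f * (bvec (g', f) \<otimes>\<^sub>v bvec (g'', f)) c),
     hcounit = (\<lambda>(g, f). if g = \<one>\<^bsub>G\<^esub> then 1 else 0)\<rparr>"

definition bicharacter :: "('g, 'm) monoid_scheme \<Rightarrow> ('g \<Rightarrow> 'g \<Rightarrow> 'k::field) \<Rightarrow> bool" where
  "bicharacter A w \<longleftrightarrow>
     (\<forall>x\<in>carrier A. \<forall>y\<in>carrier A. w x y \<noteq> 0) \<and>
     (\<forall>x\<in>carrier A. \<forall>y\<in>carrier A. \<forall>z\<in>carrier A.
        w (x \<otimes>\<^bsub>A\<^esub> y) z = w x z * w y z \<and> w x (y \<otimes>\<^bsub>A\<^esub> z) = w x y * w x z)"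

text \<open>
  In the groups of rank two below, \<open>a = (1, 0)\<close> and \<open>b = (0, 1)\<close>, and the pair \<open>(i, j)\<close> is the
  element \<open>a\<^sup>i b\<^sup>j\<close>.  The generator of a cyclic group is \<open>1\<close>.
\<close>

abbreviation gen_a :: "int \<times> int" where "gen_a \<equiv> (1, 0)"
abbreviation gen_b :: "int \<times> int" where "gen_b \<equiv> (0, 1)"
abbreviation gen_g :: int where "gen_g \<equiv> 1"

definition semidirect ::
  "'n monoid \<Rightarrow> 'h monoid \<Rightarrow> ('h \<Rightarrow> 'n \<Rightarrow> 'n) \<Rightarrow> ('n \<times> 'h) monoid" where
  "semidirect N K \<theta> = \<lparr>
     carrier = carrier N \<times> carrier K,
     monoid.mult = (\<lambda>(x, y) (x', y'). (x \<otimes>\<^bsub>N\<^esub> \<theta> y x', y \<otimes>\<^bsub>K\<^esub> y')),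
     monoid.one = (\<one>\<^bsub>N\<^esub>, \<one>\<^bsub>K\<^esub>)\<rparr>"

text \<open>The presentation \<open>a\<^sup>p = b\<^sup>q = 1\<close>, \<open>b a b\<^sup>-\<^sup>1 = a\<^sup>t\<close>.\<close>

definition Zp_sd_Zq :: "nat \<Rightarrow> nat \<Rightarrow> nat \<Rightarrow> (int \<times> int) monoid" where
  "Zp_sd_Zq p q t = semidirect (integer_mod_group p) (integer_mod_group q)
     (\<lambda>y x. (int t ^ nat y * x) mod int p)"

definition A0 :: "nat \<Rightarrow> nat \<Rightarrow> nat \<Rightarrow> ((int \<times> int) \<times> int, 'k::field) hopf_data" where
  "A0 p q t = ab_ext (Zp_sd_Zq p q t) (integer_mod_group q)
     (\<lambda>(x, y) n. ((int t ^ nat n * x) mod int p, y))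
     (\<lambda>_ _ _. 1) (\<lambda>_ _ _. 1)"

definition Zq_Zq :: "nat \<Rightarrow> (int \<times> int) monoid" where
  "Zq_Zq q = integer_mod_group q \<times>\<times> integer_mod_group q"

text \<open>
  The action satisfies \<open>a \<triangleleft> g\<^sup>-\<^sup>i = a^(m^i)\<close> and \<open>b \<triangleleft> g\<^sup>-\<^sup>i = b^(m^(lam i))\<close>; for \<open>g\<^sup>n\<close> the exponent \<open>i\<close> is
  \<open>-n\<close> modulo \<open>p\<close>.
\<close>

definition B_act :: "nat \<Rightarrow> nat \<Rightarrow> nat \<Rightarrow> nat \<Rightarrow> int \<times> int \<Rightarrow> int \<Rightarrow> int \<times> int" where
  "B_act p q m lam = (\<lambda>(x, y) n. let i = nat (- n mod int p) in
     ((int m ^ i * x) mod int q, (int m ^ (lam * i) * y) mod int q))"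

definition geom :: "nat \<Rightarrow> nat \<Rightarrow> nat" where
  "geom n r = (\<Sum>i<n. r ^ i)"

text \<open>
  \<open>\<tau>(a\<^sup>i b\<^sup>j, a\<^sup>k b\<^sup>l, g\<^sup>n) = \<zeta>^(geom n r * j * k)\<close> with \<open>r\<close> a representative of \<open>m^(-(lam+1))\<close> modulo \<open>q\<close>
  (note \<open>m^(p-1)\<close> is inverse to \<open>m\<close>).  The inverse is forced by the direction of the action:
  multiplicativity of the coproduct is
  \<open>\<tau>(h, k, f f') = \<tau>(h, k, f) \<tau>(h \<triangleleft> f, k \<triangleleft> f, f')\<close>, where \<open>a\<^sup>k \<triangleleft> g = a^(k/m)\<close> and
  \<open>b\<^sup>j \<triangleleft> g = b^(j/m^lam)\<close>.  Hence \<open>\<tau>(a\<^sup>i b\<^sup>j, a\<^sup>k b\<^sup>l, g) = \<zeta>^(j k)\<close> determines the values at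
  \<open>g\<^sup>n\<close>, with the exponent \<open>(1 + r + \<dots> + r^(n-1)) j k\<close>.  The source writes \<open>m^(lam+1)\<close> for \<open>r\<close>, which
  gives the same \<open>\<tau>\<close> at \<open>g\<close> but is not compatible with this action at \<open>g\<^sup>2\<close>.
\<close>

definition B_tau :: "nat \<Rightarrow> nat \<Rightarrow> 'k::field \<Rightarrow> nat \<Rightarrow> int \<times> int \<Rightarrow> int \<times> int \<Rightarrow> int \<Rightarrow> 'k" where
  "B_tau p m \<zeta> lam = (\<lambda>(i, j) (k, l) n.
     (\<zeta> ^ geom (nat n) ((m ^ (p - 1)) ^ (lam + 1))) ^ (nat j * nat k))"

definition B_alg ::
  "nat \<Rightarrow> nat \<Rightarrow> nat \<Rightarrow> 'k::field \<Rightarrow> nat \<Rightarrow> ((int \<times> int) \<times> int, 'k) hopf_data" where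
  "B_alg p q m \<zeta> lam = ab_ext (Zq_Zq q) (integer_mod_group p) (B_act p q m lam)
     (\<lambda>_ _ _. 1) (B_tau p m \<zeta> lam)"

definition B_eta :: "nat \<Rightarrow> nat \<Rightarrow> 'k::field \<Rightarrow> nat \<Rightarrow> int \<times> int \<Rightarrow> int \<times> int \<Rightarrow> int \<Rightarrow> 'k" where
  "B_eta p m \<zeta> lam h k f = B_tau p m \<zeta> lam h k f * inverse (B_tau p m \<zeta> lam k h f)"

definition primitive_root_of_unity :: "nat \<Rightarrow> 'k::field \<Rightarrow> bool" where
  "primitive_root_of_unity n \<zeta> \<longleftrightarrow> \<zeta> ^ n = 1 \<and> (\<forall>i. 0 < i \<and> i < n \<longrightarrow> \<zeta> ^ i \<noteq> 1)"

end

theory Submission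
  imports Defs "HOL-Number_Theory.Pocklington"
begin

text \<open>
  Evaluated on basis vectors, a braiding structure is a function \<open>B(g,i;h,j)\<close> and a quasitriangular
  structure a function \<open>R(g,i;h,j)\<close> on \<open>G \<times> F \<times> G \<times> F\<close> subject to three families of identities each.

  (i) The elements \<open>\<Sum>h. B(g,1;h,1) h\<close> of the group algebra are orthogonal idempotents.  Hence the
  \<open>h\<close> in the support of \<open>B(\<cdot>,1;\<cdot>,1)\<close> commute with each other, and the third axiom makes the
  support closed under conjugation, so it lies in \<open>\<langle>a\<rangle>\<close>, and likewise for \<open>g\<close>.
  Fourier transform on \<open>\<int>/p\<close> turns the pairing into an endomorphism \<open>\<phi>\<close> of \<open>\<int>/p\<close>;
  invariance under conjugation by \<open>b\<close> gives \<open>\<phi> = t\<^sup>2 \<phi>\<close>, and \<open>t\<^sup>2 \<noteq> 1\<close> as \<open>q\<close> is odd.  So the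
  pairing is trivial on \<open>k\<^sup>G\<close>.  Then \<open>B(\<cdot>,i;\<cdot>,j)\<close> lives at a single pair \<open>(g\<^sub>j, h\<^sub>i)\<close>, where
  conjugation by \<open>g\<^sub>j\<close>, and by the inverse of \<open>h\<^sub>j\<close>, is the action of \<open>j\<close>.  Since the centre of
  \<open>G\<close> is trivial, \<open>g\<^sub>j = b\<^sup>j\<close> and \<open>h\<^sub>i = b\<^sup>-\<^sup>i\<close>; the values form a bicharacter of \<open>F\<close>.

  (ii) For fixed \<open>j \<noteq> 1\<close> the elements \<open>\<Sum>g i. R(g,i;h,j) e\<^sub>g i\<close>, acting on the \<open>p\<close>-dimensional modules
  induced from points of \<open>G\<close>, represent the twisted group algebra of \<open>\<int>/q \<times> \<int>/q\<close> with cocycle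
  \<open>\<tau>(\<cdot>,\<cdot>,j)\<close>, a quantum torus at a primitive \<open>q\<close>-th root of unity.  As \<open>p < q\<close> they vanish.  So \<open>R\<close> is
  supported on \<open>k\<^sup>G \<otimes> k\<^sup>G\<close>, where it is a bicharacter, and the remaining axiom only has to be
  tested on generators.
\<close>


section \<open>Linear forms and bases\<close>

text \<open>In (i) the action of F is conjugation by powers of b. This makes the third braiding
  axiom solvable: it becomes a commutation relation in G, and the trivial centre leaves one
  candidate for each support point. The other two axioms alone would admit the zero form.
  Convolution invertibility excludes it because an idempotent with a right inverse is 1, which fixes
  all pairings with the unit. The square of t arises because \<phi> sends characters to points: the
  change of variable that moves points by t can be undone only by moving characters too, so
  equivariance reads \<phi>(c) = t \<phi>(t c). In (ii) the obstacle is that the operator attached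
  to the unit of G is only known to be idempotent, so there is no honest representation to which a
  dimension count applies directly. The proof starts instead from one nonzero matrix entry and
  produces from it q independent vectors in a space of dimension p.\<close>

lemma linear_formI:
  assumes "\<And>x y. x \<in> vecs B \<Longrightarrow> y \<in> vecs B \<Longrightarrow> \<phi> (\<lambda>b. x b + y b) = \<phi> x + \<phi> y"
    and "\<And>c x. x \<in> vecs B \<Longrightarrow> \<phi> (\<lambda>b. c * x b) = c * \<phi> x"
  shows "linear_form B \<phi>"
  using assms unfolding linear_form_def by blast

lemma linear_form_add:
  "linear_form B \<phi> \<Longrightarrow> x \<in> vecs B \<Longrightarrow> y \<in> vecs B \<Longrightarrow> \<phi> (\<lambda>b. x b + y b) = \<phi> x + \<phi> y"
  and linear_form_scale: "linear_form B \<phi> \<Longrightarrow> x \<in> vecs B \<Longrightarrow> \<phi> (\<lambda>b. c * x b) = c * \<phi> x"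
  unfolding linear_form_def by blast+

lemma vecs_add [intro]:
  fixes x y :: "'b \<Rightarrow> 'k::field"
  shows "x \<in> vecs B \<Longrightarrow> y \<in> vecs B \<Longrightarrow> (\<lambda>b. x b + y b) \<in> vecs B"
  by (simp add: vecs_def)

lemma vecs_scale [intro]:
  fixes x :: "'b \<Rightarrow> 'k::field"
  shows "x \<in> vecs B \<Longrightarrow> (\<lambda>b. c * x b) \<in> vecs B"
  by (simp add: vecs_def)

lemma vecs_bvec [intro, simp]: "b \<in> B \<Longrightarrow> bvec b \<in> vecs B"
  by (auto simp: vecs_def bvec_def)

lemma vecs_tens [intro]:
  fixes x :: "'b \<Rightarrow> 'k::field"
  shows "x \<in> vecs B \<Longrightarrow> y \<in> vecs C \<Longrightarrow> x \<otimes>\<^sub>v y \<in> vecs (B \<times> C)"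
  by (auto simp: vecs_def tens_def)

lemma vecs_expand:
  fixes x :: "'b \<Rightarrow> 'k::field"
  assumes "finite B" "x \<in> vecs B"
  shows "x = (\<lambda>c. \<Sum>b\<in>B. x b * bvec b c)"
proof
  fix c
  have "(\<Sum>b\<in>B. x b * bvec b c) = (\<Sum>b\<in>B. if c = b then x b else 0)"
    by (rule sum.cong) (auto simp: bvec_def)
  thus "x c = (\<Sum>b\<in>B. x b * bvec b c)"
    using assms by (auto simp: vecs_def)
qed

lemma linear_form_expand:
  fixes x :: "'b \<Rightarrow> 'k::field"
  assumes B: "finite B" and \<phi>: "linear_form B \<phi>" and x: "x \<in> vecs B"
  shows "\<phi> x = (\<Sum>b\<in>B. x b * \<phi> (bvec b))"
proof -
  \<comment> \<open>\<open>\<phi>\<close> is linear only on \<open>vecs B\<close>, so the induction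
    below runs over subsets \<open>A\<close> of \<open>B\<close> and needs every partial sum to stay
    in \<open>vecs B\<close>.\<close>
  have v: "(\<lambda>c. \<Sum>b\<in>A. x b * bvec b c) \<in> vecs B" if "A \<subseteq> B" for A
    using that by (auto simp: vecs_def bvec_def intro!: sum.neutral)
  have "\<phi> (\<lambda>c. \<Sum>b\<in>A. x b * bvec b c) = (\<Sum>b\<in>A. x b * \<phi> (bvec b))" if "finite A" "A \<subseteq> B" for A
    using that
  proof (induction A)
    case empty
    have "(\<lambda>_. 0::'k) \<in> vecs B" by (simp add: vecs_def)
    from linear_form_scale[OF \<phi> this, of 0] show ?case by simp
  next
    case (insert a A)
    then have "a \<in> B" "A \<subseteq> B" by auto
    with insert show ?case
      using linear_form_add[OF \<phi> vecs_scale[OF vecs_bvec[OF \<open>a \<in> B\<close>]] v[OF \<open>A \<subseteq> B\<close>], of "x a"]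
        linear_form_scale[OF \<phi> vecs_bvec[OF \<open>a \<in> B\<close>], of "x a"]
      by simp
  qed
  from this[OF B order_refl] show ?thesis
    using vecs_expand[OF B x] by simp
qed

lemma linear_form_eqI:
  fixes x :: "'b \<Rightarrow> 'k::field"
  assumes "finite B" "linear_form B \<phi>" "linear_form B \<psi>" "x \<in> vecs B"
    and "\<And>b. b \<in> B \<Longrightarrow> \<phi> (bvec b) = \<psi> (bvec b)"
  shows "\<phi> x = \<psi> x"
  using linear_form_expand[OF assms(1,2,4)] linear_form_expand[OF assms(1,3,4)] assms(5) by simp

lemma linear_form_sum [intro]:
  "(\<And>i. i \<in> I \<Longrightarrow> linear_form B (F i)) \<Longrightarrow> linear_form B (\<lambda>x. \<Sum>i\<in>I. F i x)"
  unfolding linear_form_def by (simp add: sum.distrib sum_distrib_left)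

lemma linear_form_mult_left [intro]: "linear_form B F \<Longrightarrow> linear_form B (\<lambda>x. c * F x)"
  by (rule linear_formI) (simp_all add: linear_form_add linear_form_scale algebra_simps)

lemma linear_form_mult_right [intro]: "linear_form B F \<Longrightarrow> linear_form B (\<lambda>x. F x * c)"
  by (rule linear_formI) (simp_all add: linear_form_add linear_form_scale algebra_simps)

lemma linear_form_coord [intro]: "linear_form B (\<lambda>x. x b)"
  by (rule linear_formI) simp_all

lemma linear_form_hcoprod [intro]: "linear_form (basis H) (\<lambda>x. hcoprod H x uv)"
  unfolding hcoprod_def by (intro linear_form_sum linear_form_mult_right linear_form_coord)

lemma tens_linear:
  fixes x y :: "'b \<Rightarrow> 'k::field" and z w :: "'c \<Rightarrow> 'k"
  shows "(\<lambda>b. x b + y b) \<otimes>\<^sub>v z = (\<lambda>c. (x \<otimes>\<^sub>v z) c + (y \<otimes>\<^sub>v z) c)"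
    "(\<lambda>b. k * x b) \<otimes>\<^sub>v z = (\<lambda>c. k * (x \<otimes>\<^sub>v z) c)"
    "x \<otimes>\<^sub>v (\<lambda>b. z b + w b) = (\<lambda>c. (x \<otimes>\<^sub>v z) c + (x \<otimes>\<^sub>v w) c)"
    "x \<otimes>\<^sub>v (\<lambda>b. k * z b) = (\<lambda>c. k * (x \<otimes>\<^sub>v z) c)"
  by (auto simp: tens_def algebra_simps)

lemma linear_form_tens_left:
  assumes \<beta>: "linear_form (B \<times> C) \<beta>" and y: "y \<in> vecs C"
  shows "linear_form B (\<lambda>x. \<beta> (x \<otimes>\<^sub>v y))"
  using y by (intro linear_formI)
    (simp_all add: tens_linear linear_form_add[OF \<beta>] linear_form_scale[OF \<beta>] vecs_tens)

lemma linear_form_tens_right: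
  assumes \<beta>: "linear_form (B \<times> C) \<beta>" and x: "x \<in> vecs B"
  shows "linear_form C (\<lambda>y. \<beta> (x \<otimes>\<^sub>v y))"
  using x by (intro linear_formI)
    (simp_all add: tens_linear linear_form_add[OF \<beta>] linear_form_scale[OF \<beta>] vecs_tens)

text \<open>Closure of the basis products keeps \<open>hprod\<close> inside
  \<open>vecs (basis H)\<close>, the only place where \<open>\<phi>\<close> is linear. This makes
  the sides of the braiding axioms that contain a product linear in each factor.\<close>

lemma linear_form_hprod_comp:
  assumes \<phi>: "linear_form (basis H) \<phi>"
    and cl: "\<And>a b. a \<in> basis H \<Longrightarrow> b \<in> basis H \<Longrightarrow> hmul H a b \<in> vecs (basis H)"
  shows "linear_form (basis H) (\<lambda>x. \<phi> (hprod H x y))" "linear_form (basis H) (\<lambda>y. \<phi> (hprod H x y))"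
proof -
  have v: "hprod H x y \<in> vecs (basis H)" for x y
    using cl by (auto simp: hprod_def vecs_def intro!: sum.neutral)
  have "hprod H (\<lambda>b. x b + x' b) y = (\<lambda>c. hprod H x y c + hprod H x' y c)" for x x' y
    by (auto simp: hprod_def algebra_simps sum.distrib)
  moreover have "hprod H (\<lambda>b. c * x b) y = (\<lambda>d. c * hprod H x y d)" for x y c
    by (auto simp: hprod_def algebra_simps sum_distrib_left)
  moreover have "hprod H x (\<lambda>b. y b + y' b) = (\<lambda>c. hprod H x y c + hprod H x y' c)" for x y y'
    by (auto simp: hprod_def algebra_simps sum.distrib)
  moreover have "hprod H x (\<lambda>b. c * y b) = (\<lambda>d. c * hprod H x y d)" for x y c
    by (auto simp: hprod_def algebra_simps sum_distrib_left)
  ultimately show "linear_form (basis H) (\<lambda>x. \<phi> (hprod H x y))"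
    "linear_form (basis H) (\<lambda>y. \<phi> (hprod H x y))"
    by (auto intro!: linear_formI simp: linear_form_add[OF \<phi>] linear_form_scale[OF \<phi>] v)
qed

lemma sum_bvec_left:
  fixes f :: "'b \<Rightarrow> 'k::field"
  shows "finite B \<Longrightarrow> a \<in> B \<Longrightarrow> (\<Sum>b\<in>B. bvec a b * f b) = f a"
proof -
  assume "finite B" "a \<in> B"
  have "(\<Sum>b\<in>B. bvec a b * f b) = (\<Sum>b\<in>B. if b = a then f b else 0)"
    by (rule sum.cong) (auto simp: bvec_def)
  thus ?thesis using \<open>finite B\<close> \<open>a \<in> B\<close> by simp
qed

lemma hprod_bvec:
  assumes "finite (basis H)" "a \<in> basis H" "b \<in> basis H"
  shows "hprod H (bvec a) (bvec b) = hmul H a b"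
proof
  fix c
  have "hprod H (bvec a) (bvec b) c
    = (\<Sum>a'\<in>basis H. bvec a a' * (\<Sum>b'\<in>basis H. bvec b b' * hmul H a' b' c))"
    by (simp add: hprod_def sum_distrib_left mult.assoc)
  thus "hprod H (bvec a) (bvec b) c = hmul H a b c"
    using assms by (simp add: sum_bvec_left)
qed

lemma hcoprod_bvec:
  "finite (basis H) \<Longrightarrow> b \<in> basis H \<Longrightarrow> hcoprod H (bvec b) = hcomul H b"
  by (rule ext) (simp add: hcoprod_def sum_bvec_left)

lemma bvec_tens: "bvec a \<otimes>\<^sub>v bvec b = (bvec (a, b) :: _ \<Rightarrow> 'k::field)"
  by (auto simp: bvec_def tens_def)

lemma basis_tensor [simp]: "basis (H \<otimes>\<^sub>H K) = basis H \<times> basis K"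
  by (simp add: hopf_tensor_def)

text \<open>Arguments are freed one at a time, from basis vectors to arbitrary vectors. This turns
  axioms quantified over all vectors into identities between structure constants.\<close>

lemma trilinear_eqI:
  fixes x y z :: "'b \<Rightarrow> 'k::field"
  assumes fin: "finite B" and x: "x \<in> vecs B" and y: "y \<in> vecs B" and z: "z \<in> vecs B"
    and \<phi>: "\<And>y z. y \<in> vecs B \<Longrightarrow> z \<in> vecs B \<Longrightarrow> linear_form B (\<lambda>x. \<phi> x y z)"
      "\<And>x z. x \<in> vecs B \<Longrightarrow> z \<in> vecs B \<Longrightarrow> linear_form B (\<lambda>y. \<phi> x y z)"
      "\<And>x y. x \<in> vecs B \<Longrightarrow> y \<in> vecs B \<Longrightarrow> linear_form B (\<lambda>z. \<phi> x y z)"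
    and \<psi>: "\<And>y z. y \<in> vecs B \<Longrightarrow> z \<in> vecs B \<Longrightarrow> linear_form B (\<lambda>x. \<psi> x y z)"
      "\<And>x z. x \<in> vecs B \<Longrightarrow> z \<in> vecs B \<Longrightarrow> linear_form B (\<lambda>y. \<psi> x y z)"
      "\<And>x y. x \<in> vecs B \<Longrightarrow> y \<in> vecs B \<Longrightarrow> linear_form B (\<lambda>z. \<psi> x y z)"
    and eq: "\<And>a b d. a \<in> B \<Longrightarrow> b \<in> B \<Longrightarrow> d \<in> B \<Longrightarrow>
      \<phi> (bvec a) (bvec b) (bvec d) = \<psi> (bvec a) (bvec b) (bvec d)"
  shows "\<phi> x y z = \<psi> x y z"
proof -
  have "\<phi> (bvec a) (bvec b) z = \<psi> (bvec a) (bvec b) z" if "a \<in> B" "b \<in> B" for a b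
    by (rule linear_form_eqI[OF fin \<phi>(3) \<psi>(3) z]) (use that eq in auto)
  hence "\<phi> (bvec a) y z = \<psi> (bvec a) y z" if "a \<in> B" for a
    by (intro linear_form_eqI[OF fin \<phi>(2) \<psi>(2) y]) (use that z in auto)
  thus ?thesis
    by (intro linear_form_eqI[OF fin \<phi>(1) \<psi>(1) x]) (use y z in auto)
qed

lemma braiding_structure_iff:
  fixes H :: "('b, 'k::field) hopf_data"
  defines "B \<equiv> basis H"
  assumes fin: "finite B"
    and cl: "\<And>a b. a \<in> B \<Longrightarrow> b \<in> B \<Longrightarrow> hmul H a b \<in> vecs B"
    and \<beta>: "linear_form (B \<times> B) \<beta>"
  shows "braiding_structure H \<beta> \<longleftrightarrow> conv_invertible (H \<otimes>\<^sub>H H) \<beta> \<and>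
    (\<forall>a\<in>B. \<forall>b\<in>B. \<forall>d\<in>B. (\<Sum>c\<in>B. hmul H a b c * \<beta> (bvec (c, d))) =
       (\<Sum>(u, v)\<in>B \<times> B. hcomul H d (u, v) * \<beta> (bvec (a, u)) * \<beta> (bvec (b, v)))) \<and>
    (\<forall>a\<in>B. \<forall>b\<in>B. \<forall>d\<in>B. (\<Sum>c\<in>B. hmul H b d c * \<beta> (bvec (a, c))) =
       (\<Sum>(u, v)\<in>B \<times> B. hcomul H a (u, v) * \<beta> (bvec (u, d)) * \<beta> (bvec (v, b)))) \<and>
    (\<forall>a\<in>B. \<forall>b\<in>B. \<forall>c.
       (\<Sum>(u, v)\<in>B \<times> B. \<Sum>(u', v')\<in>B \<times> B.
          hcomul H a (u, v) * hcomul H b (u', v') * \<beta> (bvec (u, u')) * hmul H v v' c) =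
       (\<Sum>(u, v)\<in>B \<times> B. \<Sum>(u', v')\<in>B \<times> B.
          hcomul H a (u, v) * hcomul H b (u', v') * \<beta> (bvec (v, v')) * hmul H u' u c))"
    (is "_ \<longleftrightarrow> _ \<and> ?B1 \<and> ?B2 \<and> ?B3")
proof -
  note B_def [simp]
  have [simp]: "finite B" by (rule fin)
  have exp_l: "\<beta> (x \<otimes>\<^sub>v bvec d) = (\<Sum>c\<in>B. x c * \<beta> (bvec (c, d)))" if "x \<in> vecs B" "d \<in> B" for x d
    using linear_form_expand[OF fin linear_form_tens_left[OF \<beta> vecs_bvec[OF that(2)]] that(1)]
    by (simp add: bvec_tens)
  have exp_r: "\<beta> (bvec d \<otimes>\<^sub>v x) = (\<Sum>c\<in>B. x c * \<beta> (bvec (d, c)))" if "x \<in> vecs B" "d \<in> B" for x d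
    using linear_form_expand[OF fin linear_form_tens_right[OF \<beta> vecs_bvec[OF that(2)]] that(1)]
    by (simp add: bvec_tens)
  have hp: "hprod H x y \<in> vecs B" for x y
    using cl by (auto simp: hprod_def vecs_def intro!: sum.neutral)
  let ?A1 = "\<forall>x\<in>vecs B. \<forall>y\<in>vecs B. \<forall>z\<in>vecs B. \<beta> (hprod H x y \<otimes>\<^sub>v z) =
    (\<Sum>(u, v)\<in>B \<times> B. hcoprod H z (u, v) * \<beta> (x \<otimes>\<^sub>v bvec u) * \<beta> (y \<otimes>\<^sub>v bvec v))"
  let ?A2 = "\<forall>x\<in>vecs B. \<forall>y\<in>vecs B. \<forall>z\<in>vecs B. \<beta> (x \<otimes>\<^sub>v hprod H y z) =
    (\<Sum>(u, v)\<in>B \<times> B. hcoprod H x (u, v) * \<beta> (bvec u \<otimes>\<^sub>v z) * \<beta> (bvec v \<otimes>\<^sub>v y))"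
  let ?A3 = "\<forall>x\<in>vecs B. \<forall>y\<in>vecs B. \<forall>c.
    (\<Sum>(u, v)\<in>B \<times> B. \<Sum>(u', v')\<in>B \<times> B.
       hcoprod H x (u, v) * hcoprod H y (u', v') * \<beta> (bvec u \<otimes>\<^sub>v bvec u') * hmul H v v' c) =
    (\<Sum>(u, v)\<in>B \<times> B. \<Sum>(u', v')\<in>B \<times> B.
       hcoprod H x (u, v) * hcoprod H y (u', v') * \<beta> (bvec v \<otimes>\<^sub>v bvec v') * hmul H u' u c)"
  have 1: "?A1 \<longleftrightarrow> ?B1"
  proof
    assume A: ?A1
    show ?B1
    proof (intro ballI)
      fix a b d assume "a \<in> B" "b \<in> B" "d \<in> B"
      with A[rule_format, of "bvec a" "bvec b" "bvec d"] 
      show "(\<Sum>c\<in>B. hmul H a b c * \<beta> (bvec (c, d))) =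
       (\<Sum>(u, v)\<in>B \<times> B. hcomul H d (u, v) * \<beta> (bvec (a, u)) * \<beta> (bvec (b, v)))"
        using fin cl by (simp add: hprod_bvec hcoprod_bvec exp_l bvec_tens del: B_def, simp add: hprod_bvec hcoprod_bvec exp_l bvec_tens)
    qed
  next
    assume A: ?B1
    show ?A1
    proof (intro ballI)
      fix x y z :: "'b \<Rightarrow> 'k" assume x: "x \<in> vecs B" and y: "y \<in> vecs B" and z: "z \<in> vecs B"
      show "\<beta> (hprod H x y \<otimes>\<^sub>v z) =
        (\<Sum>(u, v)\<in>B \<times> B. hcoprod H z (u, v) * \<beta> (x \<otimes>\<^sub>v bvec u) * \<beta> (y \<otimes>\<^sub>v bvec v))"
      proof (rule trilinear_eqI[OF fin x y z], goal_cases)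
        case (7 a b d)
        with A fin exp_l[OF cl 7(3)] show ?case by (simp add: hprod_bvec hcoprod_bvec bvec_tens)
      qed (auto simp: case_prod_unfold
        intro!: linear_form_hprod_comp[of H "\<lambda>w. \<beta> (w \<otimes>\<^sub>v _)"] linear_form_tens_left[OF \<beta>[unfolded B_def]]
          linear_form_tens_right[OF \<beta>[unfolded B_def]] cl[unfolded B_def] hp[unfolded B_def]
          linear_form_sum linear_form_mult_right linear_form_mult_left linear_form_hcoprod)
    qed
  qed
  have 2: "?A2 \<longleftrightarrow> ?B2"
  proof
    assume A: ?A2
    show ?B2
    proof (intro ballI)
      fix a b d assume "a \<in> B" "b \<in> B" "d \<in> B"
      with A[rule_format, of "bvec a" "bvec b" "bvec d"] 
      show "(\<Sum>c\<in>B. hmul H b d c * \<beta> (bvec (a, c))) =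
       (\<Sum>(u, v)\<in>B \<times> B. hcomul H a (u, v) * \<beta> (bvec (u, d)) * \<beta> (bvec (v, b)))"
        using fin cl by (simp add: hprod_bvec hcoprod_bvec exp_r bvec_tens del: B_def, simp add: hprod_bvec hcoprod_bvec exp_r bvec_tens)
    qed
  next
    assume A: ?B2
    show ?A2
    proof (intro ballI)
      fix x y z :: "'b \<Rightarrow> 'k" assume x: "x \<in> vecs B" and y: "y \<in> vecs B" and z: "z \<in> vecs B"
      show "\<beta> (x \<otimes>\<^sub>v hprod H y z) =
        (\<Sum>(u, v)\<in>B \<times> B. hcoprod H x (u, v) * \<beta> (bvec u \<otimes>\<^sub>v z) * \<beta> (bvec v \<otimes>\<^sub>v y))"
      proof (rule trilinear_eqI[OF fin x y z], goal_cases)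
        case (7 a b d)
        with A fin exp_r[OF cl 7(1)] show ?case by (simp add: hprod_bvec hcoprod_bvec bvec_tens)
      qed (auto simp: case_prod_unfold
        intro!: linear_form_hprod_comp[of H "\<lambda>w. \<beta> (_ \<otimes>\<^sub>v w)"] linear_form_tens_left[OF \<beta>[unfolded B_def]]
          linear_form_tens_right[OF \<beta>[unfolded B_def]] cl[unfolded B_def] hp[unfolded B_def]
          linear_form_sum linear_form_mult_right linear_form_mult_left linear_form_hcoprod)
    qed
  qed
  have 3: "?A3 \<longleftrightarrow> ?B3"
  proof
    assume A: ?A3
    show ?B3
    proof (intro ballI allI)
      fix a b c assume "a \<in> B" "b \<in> B"
      with A[rule_format, of "bvec a" "bvec b" c] 
      show "(\<Sum>(u, v)\<in>B \<times> B. \<Sum>(u', v')\<in>B \<times> B.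
          hcomul H a (u, v) * hcomul H b (u', v') * \<beta> (bvec (u, u')) * hmul H v v' c) =
       (\<Sum>(u, v)\<in>B \<times> B. \<Sum>(u', v')\<in>B \<times> B.
          hcomul H a (u, v) * hcomul H b (u', v') * \<beta> (bvec (v, v')) * hmul H u' u c)"
        using fin by (simp add: hcoprod_bvec bvec_tens)
    qed
  next
    assume A: ?B3
    show ?A3
    proof (intro ballI allI)
      fix x y :: "'b \<Rightarrow> 'k" and c assume x: "x \<in> vecs B" and y: "y \<in> vecs B"
      \<comment> \<open>The third axiom is bilinear only; \<open>y\<close> is freed here while
        \<open>x\<close> is still a basis vector.\<close>
      have b: "(\<Sum>(u, v)\<in>B \<times> B. \<Sum>(u', v')\<in>B \<times> B.
       hcoprod H (bvec a) (u, v) * hcoprod H y (u', v') * \<beta> (bvec u \<otimes>\<^sub>v bvec u') * hmul H v v' c) =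
    (\<Sum>(u, v)\<in>B \<times> B. \<Sum>(u', v')\<in>B \<times> B.
       hcoprod H (bvec a) (u, v) * hcoprod H y (u', v') * \<beta> (bvec v \<otimes>\<^sub>v bvec v') * hmul H u' u c)"
        if "a \<in> B" for a
      proof (rule linear_form_eqI[OF fin _ _ y], goal_cases)
        case 1 show ?case unfolding B_def case_prod_unfold
          by (intro linear_form_sum linear_form_mult_right linear_form_mult_left linear_form_hcoprod)
        case 2 show ?case unfolding B_def case_prod_unfold
          by (intro linear_form_sum linear_form_mult_right linear_form_mult_left linear_form_hcoprod)
        case (3 b) thus ?case using A that fin by (simp add: hcoprod_bvec bvec_tens)
      qed
      show "(\<Sum>(u, v)\<in>B \<times> B. \<Sum>(u', v')\<in>B \<times> B.
       hcoprod H x (u, v) * hcoprod H y (u', v') * \<beta> (bvec u \<otimes>\<^sub>v bvec u') * hmul H v v' c) =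
    (\<Sum>(u, v)\<in>B \<times> B. \<Sum>(u', v')\<in>B \<times> B.
       hcoprod H x (u, v) * hcoprod H y (u', v') * \<beta> (bvec v \<otimes>\<^sub>v bvec v') * hmul H u' u c)"
      proof (rule linear_form_eqI[OF fin _ _ x], goal_cases)
        case 1 show ?case unfolding B_def case_prod_unfold
          by (intro linear_form_sum linear_form_mult_right linear_form_mult_left linear_form_hcoprod)
        case 2 show ?case unfolding B_def case_prod_unfold
          by (intro linear_form_sum linear_form_mult_right linear_form_mult_left linear_form_hcoprod)
        case 3 thus ?case using b by simp
      qed
    qed
  qed
  show ?thesis
    unfolding 1[symmetric] 2[symmetric] 3[symmetric]
    using \<beta> by (simp add: braiding_structure_def)
qed

section \<open>Convolution\<close>

lemma linear_form_conv: "linear_form (basis C) (conv C \<phi> \<psi>)"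
  unfolding conv_def case_prod_unfold
  by (intro linear_form_sum linear_form_mult_right linear_form_hcoprod)

lemma linear_form_heps: "linear_form (basis C) (heps C)"
  unfolding heps_def by (intro linear_form_sum linear_form_mult_right linear_form_coord)

lemma heps_bvec: "finite (basis C) \<Longrightarrow> b \<in> basis C \<Longrightarrow> heps C (bvec b) = hcounit C b"
  by (simp add: heps_def sum_bvec_left)

text \<open>Any function on the basis extends linearly, so the existence of an inverse form is a
  question about coordinates alone.\<close>

lemma conv_invertible_iff:
  assumes fin: "finite (basis C)"
  shows "conv_invertible C \<phi> \<longleftrightarrow> (\<exists>\<Psi>. \<forall>b\<in>basis C.
    (\<Sum>(u, v)\<in>basis C \<times> basis C. hcomul C b (u, v) * \<phi> (bvec u) * \<Psi> v) = hcounit C b \<and>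
    (\<Sum>(u, v)\<in>basis C \<times> basis C. hcomul C b (u, v) * \<Psi> u * \<phi> (bvec v)) = hcounit C b)"
    (is "_ \<longleftrightarrow> (\<exists>\<Psi>. ?P \<Psi>)")
proof
  assume "conv_invertible C \<phi>"
  then obtain \<psi> where "\<And>b. b \<in> basis C \<Longrightarrow> conv C \<phi> \<psi> (bvec b) = heps C (bvec b) \<and>
      conv C \<psi> \<phi> (bvec b) = heps C (bvec b)"
    unfolding conv_invertible_def by blast
  thus "\<exists>\<Psi>. ?P \<Psi>"
    using fin by (intro exI[of _ "\<lambda>v. \<psi> (bvec v)"]) (simp add: conv_def hcoprod_bvec heps_bvec)
next
  assume "\<exists>\<Psi>. ?P \<Psi>"
  then obtain \<Psi> where \<Psi>: "?P \<Psi>" by blast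
  define \<psi> where "\<psi> = (\<lambda>x. \<Sum>b\<in>basis C. x b * \<Psi> b)"
  have \<psi>: "linear_form (basis C) \<psi>"
    unfolding \<psi>_def by (intro linear_form_sum linear_form_mult_right linear_form_coord)
  have "\<psi> (bvec v) = \<Psi> v" if "v \<in> basis C" for v
    using fin that by (simp add: \<psi>_def sum_bvec_left)
  hence *: "conv C \<phi> \<psi> (bvec b) = (\<Sum>(u, v)\<in>basis C \<times> basis C. hcomul C b (u, v) * \<phi> (bvec u) * \<Psi> v)"
    "conv C \<psi> \<phi> (bvec b) = (\<Sum>(u, v)\<in>basis C \<times> basis C. hcomul C b (u, v) * \<Psi> u * \<phi> (bvec v))"
    if "b \<in> basis C" for b
    unfolding conv_def using that fin by (auto simp: hcoprod_bvec intro!: sum.cong)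
  have "conv C \<phi> \<psi> x = heps C x \<and> conv C \<psi> \<phi> x = heps C x" if "x \<in> vecs (basis C)" for x
    using linear_form_eqI[OF fin linear_form_conv linear_form_heps that] \<Psi> *
    by (simp add: heps_bvec fin)
  thus "conv_invertible C \<phi>"
    unfolding conv_invertible_def using \<psi> by blast
qed

text \<open>The product of the group algebra, with \<open>u\<close> standing for the sum of all u(h)
  h. The untwisted coproduct of e_g sums over the factorisations of g, so pairing with it yields
  this product.\<close>

definition (in group) gconv :: "('a \<Rightarrow> 'k) \<Rightarrow> ('a \<Rightarrow> 'k) \<Rightarrow> 'a \<Rightarrow> 'k::field" where
  "gconv u v = (\<lambda>g. \<Sum>h\<in>carrier G. u h * v (inv h \<otimes> g))"

context group begin

lemma sum_left_translate:
  fixes f :: "'a \<Rightarrow> 'k::comm_monoid_add"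
  assumes "h \<in> carrier G"
  shows "(\<Sum>g\<in>carrier G. f (h \<otimes> g)) = (\<Sum>g\<in>carrier G. f g)"
  by (rule sum.reindex_bij_witness[where i = "\<lambda>g. inv h \<otimes> g" and j = "\<lambda>g. h \<otimes> g"])
    (use assms in \<open>auto simp: m_assoc[symmetric]\<close>)

lemma gconv_assoc:
  assumes "x \<in> carrier G"
  shows "gconv (gconv u v) w x = gconv u (gconv v w) x"
proof -
  have "gconv (gconv u v) w x
    = (\<Sum>a\<in>carrier G. u a * (\<Sum>h\<in>carrier G. v (inv a \<otimes> h) * w (inv h \<otimes> x)))"
    unfolding gconv_def
    by (simp add: sum_distrib_right sum_distrib_left mult.assoc, subst sum.swap, simp)
  also have "\<dots> = (\<Sum>a\<in>carrier G. u a * (\<Sum>h\<in>carrier G. v h * w (inv h \<otimes> (inv a \<otimes> x))))"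
  proof (rule sum.cong[OF refl], rule arg_cong[where f = "\<lambda>z. u _ * z"])
    fix a assume a: "a \<in> carrier G"
    show "(\<Sum>h\<in>carrier G. v (inv a \<otimes> h) * w (inv h \<otimes> x))
      = (\<Sum>h\<in>carrier G. v h * w (inv h \<otimes> (inv a \<otimes> x)))"
    proof (rule trans[OF _ sum_left_translate[of "inv a"]], rule sum.cong)
      fix h assume h: "h \<in> carrier G"
      have "a \<otimes> (inv a \<otimes> x) = x"
        using a assms by (simp add: m_assoc[symmetric])
      thus "v (inv a \<otimes> h) * w (inv h \<otimes> x)
        = v (inv a \<otimes> h) * w (inv (inv a \<otimes> h) \<otimes> (inv a \<otimes> x))"
        using a h assms by (simp add: inv_mult_group m_assoc)
    qed (use a in auto)
  qed
  finally show ?thesis by (simp add: gconv_def)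
qed

lemma gconv_cong: "(\<And>g. g \<in> carrier G \<Longrightarrow> u g = u' g) \<Longrightarrow> (\<And>g. g \<in> carrier G \<Longrightarrow> v g = v' g)
    \<Longrightarrow> x \<in> carrier G \<Longrightarrow> gconv u v x = gconv u' v' x"
  by (auto simp: gconv_def intro!: sum.cong)

lemma gconv_unit_right:
  assumes "finite (carrier G)" "x \<in> carrier G"
  shows "gconv u (\<lambda>g. if g = \<one> then 1 else 0) x = u x"
proof -
  have "inv h \<otimes> x = \<one> \<longleftrightarrow> h = x" if "h \<in> carrier G" for h
    using that assms(2) by (metis inv_closed inv_equality inv_inv l_inv)
  hence "gconv u (\<lambda>g. if g = \<one> then 1 else 0) x = (\<Sum>h\<in>carrier G. if h = x then u h else 0)"
    unfolding gconv_def by (intro sum.cong) auto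
  thus ?thesis using assms by simp
qed

text \<open>v = v (v s) = (v v) s = v s. The multiplicativity axioms produce only idempotents; this
  cancellation is how invertibility of the braiding pins them to the unit.\<close>

lemma gconv_idempotent_unit:
  assumes fin: "finite (carrier G)"
    and idem: "\<And>x. x \<in> carrier G \<Longrightarrow> gconv v v x = v x"
    and inv: "\<And>x. x \<in> carrier G \<Longrightarrow> gconv v s x = (if x = \<one> then 1 else 0)"
    and x: "x \<in> carrier G"
  shows "v x = (if x = \<one> then 1 else 0)"
proof -
  have "v x = gconv v (\<lambda>g. if g = \<one> then 1 else 0) x"
    by (simp add: gconv_unit_right fin x)
  also have "\<dots> = gconv v (gconv v s) x"
    by (rule gconv_cong) (use inv x in auto)
  also have "\<dots> = gconv (gconv v v) s x"
    by (rule gconv_assoc[symmetric, OF x])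
  also have "\<dots> = gconv v s x"
    by (rule gconv_cong) (use idem x in auto)
  finally show ?thesis using inv x by simp
qed

lemma sum_gconv:
  assumes "finite I"
  shows "(\<Sum>i\<in>I. \<Sum>j\<in>J. gconv (u i) (v j) x) = gconv (\<lambda>g. \<Sum>i\<in>I. u i g) (\<lambda>g. \<Sum>j\<in>J. v j g) x"
proof -
  have "gconv (\<lambda>g. \<Sum>i\<in>I. u i g) (\<lambda>g. \<Sum>j\<in>J. v j g) x
     = (\<Sum>h\<in>carrier G. \<Sum>i\<in>I. \<Sum>j\<in>J. u i h * v j (inv h \<otimes> x))"
    by (simp add: gconv_def sum_product)
  also have "\<dots> = (\<Sum>i\<in>I. \<Sum>h\<in>carrier G. \<Sum>j\<in>J. u i h * v j (inv h \<otimes> x))"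
    by (rule sum.swap)
  also have "\<dots> = (\<Sum>i\<in>I. \<Sum>j\<in>J. \<Sum>h\<in>carrier G. u i h * v j (inv h \<otimes> x))"
    by (rule sum.cong[OF refl]) (rule sum.swap)
  finally show ?thesis by (simp add: gconv_def)
qed

end

section \<open>Structure constants of an abelian extension with trivial \<sigma>\<close>

locale ab_ext_data = G: group G + F: group F
  for G :: "'g monoid" (structure) and F :: "'f monoid" +
  fixes act :: "'g \<Rightarrow> 'f \<Rightarrow> 'g" and \<tau> :: "'g \<Rightarrow> 'g \<Rightarrow> 'f \<Rightarrow> 'k::field"
  assumes fin_G [simp]: "finite (carrier G)" and fin_F [simp]: "finite (carrier F)"
    and act_closed [simp]: "g \<in> carrier G \<Longrightarrow> f \<in> carrier F \<Longrightarrow> act g f \<in> carrier G"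
    and act_one [simp]: "g \<in> carrier G \<Longrightarrow> act g \<one>\<^bsub>F\<^esub> = g"
    and act_act: "g \<in> carrier G \<Longrightarrow> f \<in> carrier F \<Longrightarrow> f' \<in> carrier F \<Longrightarrow>
      act (act g f) f' = act g (f \<otimes>\<^bsub>F\<^esub> f')"
begin

definition H :: "('g \<times> 'f, 'k) hopf_data" where
  "H = ab_ext G F act (\<lambda>_ _ _. 1) \<tau>"

lemma basis_H [simp]: "basis H = carrier G \<times> carrier F"
  by (simp add: H_def ab_ext_def)

lemma hmul_H: "hmul H (g, f) (g', f') = (\<lambda>c. if act g f = g' then bvec (g, f \<otimes>\<^bsub>F\<^esub> f') c else 0)"
  by (auto simp: H_def ab_ext_def fun_eq_iff)

lemma hmul_H_closed: "a \<in> basis H \<Longrightarrow> b \<in> basis H \<Longrightarrow> hmul H a b \<in> vecs (basis H)"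
  by (cases a; cases b) (auto simp: hmul_H vecs_def bvec_def)

lemma sum_hmul:
  assumes "g \<in> carrier G" "f \<in> carrier F" "g' \<in> carrier G" "f' \<in> carrier F"
  shows "(\<Sum>c\<in>carrier G \<times> carrier F. hmul H (g, f) (g', f') c * \<Phi> c)
    = (if act g f = g' then \<Phi> (g, f \<otimes>\<^bsub>F\<^esub> f') else 0)"
  using assms by (simp add: hmul_H sum_bvec_left)

lemma hcomul_H:
  assumes "g \<in> carrier G"
  shows "hcomul H (g, f) c = (\<Sum>g'\<in>carrier G. \<tau> g' (inv g' \<otimes> g) f *
    bvec ((g', f), (inv g' \<otimes> g, f)) c)"
proof -
  have "{(g', g''). g' \<in> carrier G \<and> g'' \<in> carrier G \<and> g' \<otimes> g'' = g} =
      (\<lambda>g'. (g', inv g' \<otimes> g)) ` carrier G"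
    using assms by (auto simp: image_iff G.m_assoc[symmetric])
  moreover have "inj_on (\<lambda>g'. (g', inv g' \<otimes> g)) (carrier G)"
    by (rule inj_onI) auto
  ultimately show ?thesis
    by (simp add: H_def ab_ext_def sum.reindex bvec_tens)
qed

lemma hcomul_H_coord:
  assumes "g \<in> carrier G"
  shows "hcomul H (g, f) ((g', i), (g'', i')) =
    (if g' \<in> carrier G \<and> g'' \<in> carrier G \<and> g' \<otimes> g'' = g \<and> i = f \<and> i' = f then \<tau> g' g'' f else 0)"
proof -
  have "hcomul H (g, f) ((g', i), (g'', i')) = (\<Sum>x\<in>carrier G.
     if x = g' then (if g'' = inv g' \<otimes> g \<and> i = f \<and> i' = f then \<tau> g' g'' f else 0) else 0)"
    unfolding hcomul_H[OF assms] by (rule sum.cong) (auto simp: bvec_def)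
  also have "\<dots> = (if g' \<in> carrier G \<and> g'' = inv g' \<otimes> g \<and> i = f \<and> i' = f then \<tau> g' g'' f else 0)"
    by simp
  also have "g' \<in> carrier G \<and> g'' = inv g' \<otimes> g \<longleftrightarrow>
    g' \<in> carrier G \<and> g'' \<in> carrier G \<and> g' \<otimes> g'' = g"
    using assms by (auto simp: G.m_assoc[symmetric])
  ultimately show ?thesis by (auto split: if_splits)
qed

text \<open>The first Sweedler factor determines the second, so a sum over pairs of basis vectors
  collapses to one over \<open>G\<close>. The braiding axioms are evaluated through this
  form.\<close>

lemma sum_hcomul:
  assumes "g \<in> carrier G" "f \<in> carrier F"
  shows "(\<Sum>(u, v)\<in>(carrier G \<times> carrier F) \<times> (carrier G \<times> carrier F). hcomul H (g, f) (u, v) * \<Phi> u v)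
    = (\<Sum>g'\<in>carrier G. \<tau> g' (inv g' \<otimes> g) f * \<Phi> (g', f) (inv g' \<otimes> g, f))"
proof -
  let ?B = "(carrier G \<times> carrier F) \<times> (carrier G \<times> carrier F)"
  have "(\<Sum>c\<in>?B. hcomul H (g, f) c * \<Phi> (fst c) (snd c))
    = (\<Sum>g'\<in>carrier G. \<Sum>c\<in>?B. \<tau> g' (inv g' \<otimes> g) f * (bvec ((g', f), (inv g' \<otimes> g, f)) c * \<Phi> (fst c) (snd c)))"
    unfolding hcomul_H[OF assms(1)] sum_distrib_right by (subst sum.swap) (simp add: mult.assoc)
  also have "\<dots> = (\<Sum>g'\<in>carrier G. \<tau> g' (inv g' \<otimes> g) f * \<Phi> (g', f) (inv g' \<otimes> g, f))"
    using assms by (intro sum.cong) (simp_all add: sum_distrib_left[symmetric] sum_bvec_left)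
  finally show ?thesis by (simp add: case_prod_unfold)
qed

end

section \<open>Braiding structures in coordinates\<close>

lemma sum_hcomul_tensor:
  "(\<Sum>(u, v)\<in>(basis H \<times> basis H) \<times> (basis H \<times> basis H). hcomul (H \<otimes>\<^sub>H H) (a, b) (u, v) * \<Phi> u v) =
   (\<Sum>(u, v)\<in>basis H \<times> basis H. hcomul H a (u, v) *
     (\<Sum>(u', v')\<in>basis H \<times> basis H. hcomul H b (u', v') * \<Phi> (u, u') (v, v')))"
proof -
  have "(\<Sum>(u, v)\<in>basis H \<times> basis H. hcomul H a (u, v) *
     (\<Sum>(u', v')\<in>basis H \<times> basis H. hcomul H b (u', v') * \<Phi> (u, u') (v, v')))
    = (\<Sum>((u, v), (u', v'))\<in>(basis H \<times> basis H) \<times> (basis H \<times> basis H).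
         hcomul H a (u, v) * hcomul H b (u', v') * \<Phi> (u, u') (v, v'))"
    by (subst sum.cartesian_product[symmetric]) (simp add: case_prod_unfold sum_distrib_left mult.assoc)
  also have "\<dots> = (\<Sum>(u, v)\<in>(basis H \<times> basis H) \<times> (basis H \<times> basis H).
      hcomul (H \<otimes>\<^sub>H H) (a, b) (u, v) * \<Phi> u v)"
    by (rule sum.reindex_bij_witness[where i = "\<lambda>((u, u'), (v, v')). ((u, v), (u', v'))"
          and j = "\<lambda>((u, v), (u', v')). ((u, u'), (v, v'))"])
      (auto simp: hopf_tensor_def)
  finally show ?thesis by simp
qed

lemma sum_sum_delta:
  fixes f :: "'a \<Rightarrow> 'b \<Rightarrow> 'k::field"
  assumes "finite A" "finite A'" "a \<in> A" "b \<in> A'"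
  shows "(\<Sum>x\<in>A. \<Sum>y\<in>A'. (if x = a \<and> y = b then c else 0) * f x y) = c * f a b"
proof -
  have "(\<Sum>x\<in>A. \<Sum>y\<in>A'. (if x = a \<and> y = b then c else 0) * f x y)
    = (\<Sum>x\<in>A. if x = a then (\<Sum>y\<in>A'. if y = b then c * f x y else 0) else 0)"
    by (intro sum.cong refl) (auto intro!: sum.cong)
  thus ?thesis using assms by simp
qed

lemma ball_Times: "(\<forall>a\<in>A \<times> C. P a) \<longleftrightarrow> (\<forall>x\<in>A. \<forall>y\<in>C. P (x, y))"
  by blast

text \<open>The parameter \<open>k_itself\<close> fixes the coefficient field, which no assumption mentions.\<close>

locale ab_ext_untwisted = ab_ext_data G F act "\<lambda>_ _ _. 1 :: 'k" + F: comm_group F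
  for G :: "'g monoid" (structure) and F :: "'f monoid" and act :: "'g \<Rightarrow> 'f \<Rightarrow> 'g"
    and k_itself :: "'k::field itself"
begin

text \<open>The braiding axioms on the basis vectors e_g # i and e_h # j. In the second clause the
  factors are exchanged because <x, yz> pairs the first Sweedler factor of x with z. The third
  clause compares coefficients of e_u # ij.\<close>

definition is_braiding :: "('g \<Rightarrow> 'f \<Rightarrow> 'g \<Rightarrow> 'f \<Rightarrow> 'k) \<Rightarrow> bool" where
  "is_braiding B \<longleftrightarrow>
    (\<forall>g\<in>carrier G. \<forall>i\<in>carrier F. \<forall>g'\<in>carrier G. \<forall>i'\<in>carrier F. \<forall>h\<in>carrier G. \<forall>j\<in>carrier F.
       (if act g i = g' then B g (i \<otimes>\<^bsub>F\<^esub> i') h j else 0) =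
         G.gconv (\<lambda>h. B g i h j) (\<lambda>h. B g' i' h j) h) \<and>
    (\<forall>g\<in>carrier G. \<forall>i\<in>carrier F. \<forall>h\<in>carrier G. \<forall>j\<in>carrier F. \<forall>h'\<in>carrier G. \<forall>j'\<in>carrier F.
       (if act h j = h' then B g i h (j \<otimes>\<^bsub>F\<^esub> j') else 0) =
         G.gconv (\<lambda>g. B g i h' j') (\<lambda>g. B g i h j) g) \<and>
    (\<forall>g\<in>carrier G. \<forall>i\<in>carrier F. \<forall>h\<in>carrier G. \<forall>j\<in>carrier F. \<forall>u\<in>carrier G.
       B (g \<otimes> inv u) i (h \<otimes> inv (act u i)) j =
       B (inv (act u j) \<otimes> g) i (inv u \<otimes> h) j)"

text \<open>For each fixed (i, j) this says that B(.,i;.,j) times \<Psi>(.,i;.,j) is 1 in the group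
  algebra of G \<times> G. Using it in both orders expresses two-sided convolution
  invertibility.\<close>

definition conv_inverse where
  "conv_inverse B \<Psi> \<longleftrightarrow>
    (\<forall>g\<in>carrier G. \<forall>i\<in>carrier F. \<forall>h\<in>carrier G. \<forall>j\<in>carrier F.
      (\<Sum>g'\<in>carrier G. \<Sum>h'\<in>carrier G.
         B g' i h' j * \<Psi> (inv g' \<otimes> g) i (inv h' \<otimes> h) j) =
      (if g = \<one> \<and> h = \<one> then 1 else (0 :: 'k)))"

lemma sum_hcomul_H2:
  assumes "g \<in> carrier G" "h \<in> carrier G" "i \<in> carrier F" "j \<in> carrier F"
  shows "(\<Sum>(u, v)\<in>(basis H \<times> basis H) \<times> (basis H \<times> basis H).
      hcomul (H \<otimes>\<^sub>H H) ((g, i), (h, j)) (u, v) * \<Phi> u v) =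
    (\<Sum>g'\<in>carrier G. \<Sum>h'\<in>carrier G.
      \<Phi> ((g', i), (h', j)) ((inv g' \<otimes> g, i), (inv h' \<otimes> h, j)))"
  by (subst sum_hcomul_tensor)
    (simp add: sum_hcomul[OF assms(1,3)] sum_hcomul[OF assms(2,4)])

lemma conv_invertible_H_iff:
  "conv_invertible (H \<otimes>\<^sub>H H) \<beta> \<longleftrightarrow> (\<exists>\<Psi>.
     conv_inverse (\<lambda>g i h j. \<beta> (bvec ((g, i), (h, j)))) \<Psi> \<and>
     conv_inverse \<Psi> (\<lambda>g i h j. \<beta> (bvec ((g, i), (h, j)))))"
    (is "_ \<longleftrightarrow> (\<exists>\<Psi>. ?P \<Psi>)")
proof -
  have fin: "finite (basis (H \<otimes>\<^sub>H H))" by simp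
  have "(\<forall>b\<in>basis (H \<otimes>\<^sub>H H).
      (\<Sum>(u, v)\<in>basis (H \<otimes>\<^sub>H H) \<times> basis (H \<otimes>\<^sub>H H). hcomul (H \<otimes>\<^sub>H H) b (u, v) * \<beta> (bvec u) * \<Psi> v) = hcounit (H \<otimes>\<^sub>H H) b \<and>
      (\<Sum>(u, v)\<in>basis (H \<otimes>\<^sub>H H) \<times> basis (H \<otimes>\<^sub>H H). hcomul (H \<otimes>\<^sub>H H) b (u, v) * \<Psi> u * \<beta> (bvec v)) = hcounit (H \<otimes>\<^sub>H H) b)
    \<longleftrightarrow> ?P (\<lambda>g i h j. \<Psi> ((g, i), (h, j)))" (is "(\<forall>b\<in>_. ?L b) \<longleftrightarrow> _") for \<Psi>
  proof -
    have "?L ((g, i), (h, j)) \<longleftrightarrow>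
      (\<Sum>g'\<in>carrier G. \<Sum>h'\<in>carrier G. \<beta> (bvec ((g', i), (h', j))) *
         \<Psi> ((inv g' \<otimes> g, i), (inv h' \<otimes> h, j))) =
        (if g = \<one> \<and> h = \<one> then 1 else 0) \<and>
      (\<Sum>g'\<in>carrier G. \<Sum>h'\<in>carrier G. \<Psi> ((g', i), (h', j)) *
         \<beta> (bvec ((inv g' \<otimes> g, i), (inv h' \<otimes> h, j)))) =
        (if g = \<one> \<and> h = \<one> then 1 else 0)"
      if "g \<in> carrier G" "h \<in> carrier G" "i \<in> carrier F" "j \<in> carrier F" for g i h j
    proof -
      have c: "hcounit (H \<otimes>\<^sub>H H) ((g, i), (h, j)) = (if g = \<one> \<and> h = \<one> then 1 else 0)"
        by (simp add: hopf_tensor_def H_def ab_ext_def)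
      show ?thesis
        unfolding c basis_tensor mult.assoc sum_hcomul_H2[OF that] ..
    qed
    note * = this
    show ?thesis
      unfolding conv_inverse_def basis_tensor basis_H ball_Times ball_conj_distrib[symmetric]
      by (intro ball_cong refl) (rule *[unfolded basis_tensor basis_H])
  qed
  hence "conv_invertible (H \<otimes>\<^sub>H H) \<beta> \<longleftrightarrow> (\<exists>\<Psi>. ?P (\<lambda>g i h j. \<Psi> ((g, i), (h, j))))"
    unfolding conv_invertible_iff[OF fin] by simp
  also have "\<dots> \<longleftrightarrow> (\<exists>\<Psi>. ?P \<Psi>)"
    by (auto intro: exI[of _ "\<lambda>((g, i), (h, j)). \<Psi> g i h j" for \<Psi>])
  finally show ?thesis .
qed

text \<open>A product x_2 y_2 proportional to e_w # f forces x_2 = e_w # i and y_2 = e_(act w i) #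
  j. So one term of the double Sweedler sum survives, and its first factors are the arguments of
  \<open>b\<close>.\<close>

lemma sum_hcomul_hmul_left:
  assumes "g \<in> carrier G" "h \<in> carrier G" "i \<in> carrier F" "j \<in> carrier F"
  shows "(\<Sum>(u, v)\<in>basis H \<times> basis H. \<Sum>(u', v')\<in>basis H \<times> basis H.
      hcomul H (g, i) (u, v) * hcomul H (h, j) (u', v') * b u u' * hmul H v v' (w, f)) =
    (if w \<in> carrier G \<and> f = i \<otimes>\<^bsub>F\<^esub> j then
      b (g \<otimes> inv w, i) (h \<otimes> inv (act w i), j) else 0)"
proof -
  have "(\<Sum>(u, v)\<in>basis H \<times> basis H. \<Sum>(u', v')\<in>basis H \<times> basis H.
      hcomul H (g, i) (u, v) * hcomul H (h, j) (u', v') * b u u' * hmul H v v' (w, f))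
    = (\<Sum>(u, v)\<in>basis H \<times> basis H. hcomul H (g, i) (u, v) *
       (\<Sum>(u', v')\<in>basis H \<times> basis H. hcomul H (h, j) (u', v') * (b u u' * hmul H v v' (w, f))))"
    by (simp only: sum_distrib_left case_prod_unfold mult.assoc)
  also have "\<dots> = (\<Sum>g'\<in>carrier G. \<Sum>h'\<in>carrier G. b (g', i) (h', j) *
       hmul H (inv g' \<otimes> g, i) (inv h' \<otimes> h, j) (w, f))"
    unfolding basis_H sum_hcomul[OF assms(1,3)] sum_hcomul[OF assms(2,4)] by simp
  also have "\<dots> = (if w \<in> carrier G \<and> f = i \<otimes>\<^bsub>F\<^esub> j then
      b (g \<otimes> inv w, i) (h \<otimes> inv (act w i), j) else 0)"
  proof (cases "w \<in> carrier G")
    case w: True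
    have "g' = g \<otimes> inv w \<longleftrightarrow> inv g' \<otimes> g = w" "h' = h \<otimes> inv (act w i) \<longleftrightarrow> act w i = inv h' \<otimes> h"
      if "g' \<in> carrier G" "h' \<in> carrier G" for g' h'
      using that w assms by (metis G.inv_closed G.inv_solve_left G.inv_solve_right act_closed)+
    hence "(\<Sum>g'\<in>carrier G. \<Sum>h'\<in>carrier G. b (g', i) (h', j) * hmul H (inv g' \<otimes> g, i) (inv h' \<otimes> h, j) (w, f))
      = (\<Sum>g'\<in>carrier G. \<Sum>h'\<in>carrier G.
          (if g' = g \<otimes> inv w \<and> h' = h \<otimes> inv (act w i) then (if f = i \<otimes>\<^bsub>F\<^esub> j then 1 else 0) else 0) *
          b (g', i) (h', j))"
      by (intro sum.cong refl) (auto simp: hmul_H bvec_def)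
    also have "\<dots> = (if f = i \<otimes>\<^bsub>F\<^esub> j then 1 else 0) * b (g \<otimes> inv w, i) (h \<otimes> inv (act w i), j)"
      using w assms by (intro sum_sum_delta) simp_all
    finally show ?thesis using w by simp
  next
    case False
    hence "inv g' \<otimes> g \<noteq> w" if "g' \<in> carrier G" for g' using that assms by auto
    moreover have "inv g' \<otimes> g \<in> carrier G" if "g' \<in> carrier G" for g' using that assms by simp
    ultimately show ?thesis using False by (auto simp: hmul_H bvec_def intro!: sum.neutral)
  qed
  finally show ?thesis .
qed

text \<open>Here the product is y_1 x_1, so y_1 = e_w # j and x_1 = e_(act w j) # i. Its F-component
  is ji, which commutativity of \<open>F\<close> identifies with ij.\<close>

lemma sum_hcomul_hmul_right:
  assumes "g \<in> carrier G" "h \<in> carrier G" "i \<in> carrier F" "j \<in> carrier F"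
  shows "(\<Sum>(u, v)\<in>basis H \<times> basis H. \<Sum>(u', v')\<in>basis H \<times> basis H.
      hcomul H (g, i) (u, v) * hcomul H (h, j) (u', v') * b v v' * hmul H u' u (w, f)) =
    (if w \<in> carrier G \<and> f = i \<otimes>\<^bsub>F\<^esub> j then
      b (inv (act w j) \<otimes> g, i) (inv w \<otimes> h, j) else 0)"
proof -
  have "(\<Sum>(u, v)\<in>basis H \<times> basis H. \<Sum>(u', v')\<in>basis H \<times> basis H.
      hcomul H (g, i) (u, v) * hcomul H (h, j) (u', v') * b v v' * hmul H u' u (w, f))
    = (\<Sum>(u, v)\<in>basis H \<times> basis H. hcomul H (g, i) (u, v) *
       (\<Sum>(u', v')\<in>basis H \<times> basis H. hcomul H (h, j) (u', v') * (b v v' * hmul H u' u (w, f))))"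
    by (simp only: sum_distrib_left case_prod_unfold mult.assoc)
  also have "\<dots> = (\<Sum>g'\<in>carrier G. \<Sum>h'\<in>carrier G.
       b (inv g' \<otimes> g, i) (inv h' \<otimes> h, j) * hmul H (h', j) (g', i) (w, f))"
    unfolding basis_H sum_hcomul[OF assms(1,3)] sum_hcomul[OF assms(2,4)] by simp
  also have "\<dots> = (if w \<in> carrier G \<and> f = i \<otimes>\<^bsub>F\<^esub> j then
      b (inv (act w j) \<otimes> g, i) (inv w \<otimes> h, j) else 0)"
  proof (cases "w \<in> carrier G")
    case w: True
    have "(\<Sum>g'\<in>carrier G. \<Sum>h'\<in>carrier G. b (inv g' \<otimes> g, i) (inv h' \<otimes> h, j) * hmul H (h', j) (g', i) (w, f))
      = (\<Sum>g'\<in>carrier G. \<Sum>h'\<in>carrier G.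
          (if g' = act w j \<and> h' = w then (if f = i \<otimes>\<^bsub>F\<^esub> j then 1 else 0) else 0) *
          b (inv g' \<otimes> g, i) (inv h' \<otimes> h, j))"
      using assms by (intro sum.cong refl) (auto simp: hmul_H bvec_def F.m_comm)
    also have "\<dots> = (if f = i \<otimes>\<^bsub>F\<^esub> j then 1 else 0) * b (inv (act w j) \<otimes> g, i) (inv w \<otimes> h, j)"
      using w assms by (intro sum_sum_delta) simp_all
    finally show ?thesis using w by simp
  qed (auto simp: hmul_H bvec_def intro!: sum.neutral)
  finally show ?thesis .
qed

lemma braiding_structure_H_iff:
  assumes \<beta>: "linear_form (basis H \<times> basis H) \<beta>"
  defines "B \<equiv> \<lambda>g i h j. \<beta> (bvec ((g, i), (h, j)))"
  shows "braiding_structure H \<beta> \<longleftrightarrow>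
    (\<exists>\<Psi>. conv_inverse B \<Psi> \<and> conv_inverse \<Psi> B) \<and> is_braiding B"
proof -
  have fin: "finite (basis H)" by simp
  have 1: "(\<forall>a\<in>basis H. \<forall>b\<in>basis H. \<forall>d\<in>basis H.
        (\<Sum>c\<in>basis H. hmul H a b c * \<beta> (bvec (c, d))) =
       (\<Sum>(u, v)\<in>basis H \<times> basis H. hcomul H d (u, v) * \<beta> (bvec (a, u)) * \<beta> (bvec (b, v)))) \<longleftrightarrow>
    (\<forall>g\<in>carrier G. \<forall>i\<in>carrier F. \<forall>g'\<in>carrier G. \<forall>i'\<in>carrier F. \<forall>h\<in>carrier G. \<forall>j\<in>carrier F.
       (if act g i = g' then B g (i \<otimes>\<^bsub>F\<^esub> i') h j else 0) =
         G.gconv (\<lambda>h. B g i h j) (\<lambda>h. B g' i' h j) h)"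
    unfolding basis_H ball_Times
    by (intro ball_cong refl) (simp only: B_def G.gconv_def sum_hmul sum_hcomul mult.assoc mult_1_left)
  have 2: "(\<forall>a\<in>basis H. \<forall>b\<in>basis H. \<forall>d\<in>basis H.
        (\<Sum>c\<in>basis H. hmul H b d c * \<beta> (bvec (a, c))) =
       (\<Sum>(u, v)\<in>basis H \<times> basis H. hcomul H a (u, v) * \<beta> (bvec (u, d)) * \<beta> (bvec (v, b)))) \<longleftrightarrow>
    (\<forall>g\<in>carrier G. \<forall>i\<in>carrier F. \<forall>h\<in>carrier G. \<forall>j\<in>carrier F. \<forall>h'\<in>carrier G. \<forall>j'\<in>carrier F.
       (if act h j = h' then B g i h (j \<otimes>\<^bsub>F\<^esub> j') else 0) =
         G.gconv (\<lambda>g. B g i h' j') (\<lambda>g. B g i h j) g)"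
    unfolding basis_H ball_Times
    by (intro ball_cong refl) (simp only: B_def G.gconv_def sum_hmul sum_hcomul mult.assoc mult_1_left)
  have 3: "(\<forall>a\<in>basis H. \<forall>b\<in>basis H. \<forall>c.
       (\<Sum>(u, v)\<in>basis H \<times> basis H. \<Sum>(u', v')\<in>basis H \<times> basis H.
          hcomul H a (u, v) * hcomul H b (u', v') * \<beta> (bvec (u, u')) * hmul H v v' c) =
       (\<Sum>(u, v)\<in>basis H \<times> basis H. \<Sum>(u', v')\<in>basis H \<times> basis H.
          hcomul H a (u, v) * hcomul H b (u', v') * \<beta> (bvec (v, v')) * hmul H u' u c)) \<longleftrightarrow>
    (\<forall>g\<in>carrier G. \<forall>i\<in>carrier F. \<forall>h\<in>carrier G. \<forall>j\<in>carrier F. \<forall>u\<in>carrier G.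
       B (g \<otimes> inv u) i (h \<otimes> inv (act u i)) j =
       B (inv (act u j) \<otimes> g) i (inv u \<otimes> h) j)" (is "?L \<longleftrightarrow> ?R")
  proof -
    \<comment> \<open>Both coordinate functions vanish away from the same f and away from
      \<open>G\<close>, so only the coefficients with w in \<open>G\<close> carry
      information.\<close>
    have "(\<forall>c. (if fst c \<in> carrier G \<and> snd c = f then x (fst c) else 0) =
        (if fst c \<in> carrier G \<and> snd c = f then y (fst c) else 0)) \<longleftrightarrow> (\<forall>w\<in>carrier G. x w = y w)"
      for f :: 'f and x y :: "'g \<Rightarrow> 'k"
      by auto
    note * = this[unfolded split_paired_All fst_conv snd_conv]
    show ?thesis
      unfolding basis_H ball_Times B_def split_paired_All
      by (intro ball_cong refl) (simp only: sum_hcomul_hmul_left[where b = "\<lambda>u u'. \<beta> (bvec (u, u'))", unfolded basis_H]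
         sum_hcomul_hmul_right[where b = "\<lambda>u u'. \<beta> (bvec (u, u'))", unfolded basis_H] *)
  qed
  show ?thesis
    using braiding_structure_iff[OF fin hmul_H_closed \<beta>]
    unfolding 1 2 3 conv_invertible_H_iff is_braiding_def B_def by blast
qed

end

text \<open>An algebra homomorphism from the functions on a finite set to the field is evaluation at
  a point: a nonzero e(a) equals its square, hence is 1, and orthogonality kills the other
  values.\<close>

lemma orthogonal_idempotents_field:
  fixes e :: "'a \<Rightarrow> 'k::field"
  assumes fin: "finite A" and orth: "\<And>x y. x \<in> A \<Longrightarrow> y \<in> A \<Longrightarrow> e x * e y = (if x = y then e x else 0)"
    and one: "sum e A = 1"
  shows "\<exists>a\<in>A. \<forall>x\<in>A. e x = (if x = a then 1 else 0)"
proof -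
  have "\<exists>a\<in>A. e a \<noteq> 0"
    using one by (metis sum.neutral zero_neq_one)
  then obtain a where a: "a \<in> A" "e a \<noteq> 0" by blast
  have "e x = (if x = a then 1 else 0)" if "x \<in> A" for x
    using orth[OF a(1) that] orth[OF a(1) a(1)] a(2) by (auto split: if_splits)
  with a show ?thesis by blast
qed

text \<open>Summing the coefficients is the augmentation of the group algebra, a ring
  homomorphism.\<close>

lemma (in group) sum_gconv_total:
  assumes "finite (carrier G)"
  shows "(\<Sum>x\<in>carrier G. gconv u v x) = sum u (carrier G) * sum v (carrier G)"
proof -
  have "(\<Sum>x\<in>carrier G. gconv u v x) = (\<Sum>h\<in>carrier G. u h * (\<Sum>x\<in>carrier G. v (inv h \<otimes> x)))"
    unfolding gconv_def sum_distrib_left by (rule sum.swap)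
  also have "\<dots> = (\<Sum>h\<in>carrier G. u h * sum v (carrier G))"
    by (intro sum.cong refl) (simp add: sum_left_translate)
  finally show ?thesis by (simp add: sum_distrib_right)
qed

lemma (in group) gconv_delta_left:
  assumes "finite (carrier G)" "a \<in> carrier G"
  shows "gconv (\<lambda>h. if h = a then c else 0) v x = c * v (inv a \<otimes> x)"
proof -
  have "gconv (\<lambda>h. if h = a then c else 0) v x
    = (\<Sum>h\<in>carrier G. if h = a then c * v (inv h \<otimes> x) else 0)"
    unfolding gconv_def by (intro sum.cong) auto
  thus ?thesis using assms by simp
qed

text \<open>The features of the first family behind the shape of its braidings: F acts by
  conjugation through a homomorphism \<open>s\<close> into a centreless group. There s(g^f) will be
  b^f.\<close>

locale ab_ext_inner = ab_ext_untwisted G F act k_itself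
  for G :: "'g monoid" (structure) and F :: "'f monoid" and act :: "'g \<Rightarrow> 'f \<Rightarrow> 'g"
    and k_itself :: "'k::field itself" +
  fixes s :: "'f \<Rightarrow> 'g"
  assumes s_closed [simp]: "f \<in> carrier F \<Longrightarrow> s f \<in> carrier G"
    and s_mult: "f \<in> carrier F \<Longrightarrow> f' \<in> carrier F \<Longrightarrow> s (f \<otimes>\<^bsub>F\<^esub> f') = s f \<otimes> s f'"
    and act_inner: "g \<in> carrier G \<Longrightarrow> f \<in> carrier F \<Longrightarrow>
      act g f = s f \<otimes> g \<otimes> inv (s f)"
    and trivial_center: "z \<in> carrier G \<Longrightarrow>
      (\<And>u. u \<in> carrier G \<Longrightarrow> z \<otimes> u = u \<otimes> z) \<Longrightarrow> z = \<one>"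
begin

lemma s_one [simp]: "s \<one>\<^bsub>F\<^esub> = \<one>"
  using s_mult[of "\<one>\<^bsub>F\<^esub>" "\<one>\<^bsub>F\<^esub>"] by (simp add: G.l_cancel_one')

lemma s_commute: "f \<in> carrier F \<Longrightarrow> f' \<in> carrier F \<Longrightarrow> s f \<otimes> s f' = s f' \<otimes> s f"
  by (metis F.m_comm s_mult)

lemma act_s [simp]: "f \<in> carrier F \<Longrightarrow> f' \<in> carrier F \<Longrightarrow> act (s f) f' = s f"
  by (simp add: act_inner s_commute[of f' f] G.m_assoc)

lemma act_inv_s [simp]:
  assumes "f \<in> carrier F" "f' \<in> carrier F"
  shows "act (inv (s f)) f' = inv (s f)"
proof -
  have "act (inv (s f)) f' = inv (act (s f) f')"
    using assms by (simp only: act_inner s_closed G.inv_closed G.inv_mult_group G.m_closed G.inv_inv G.m_assoc)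
  thus ?thesis using assms by simp
qed

lemma act_inj: "g \<in> carrier G \<Longrightarrow> g' \<in> carrier G \<Longrightarrow> f \<in> carrier F \<Longrightarrow> act g f = act g' f \<Longrightarrow> g = g'"
  by (simp add: act_inner)

text \<open>\<open>inv (s f) \<otimes> z\<close> is central. This identifies support points from the
  commutation relation that the third axiom imposes on them.\<close>

lemma inner_unique:
  assumes "z \<in> carrier G" "f \<in> carrier F"
    and "\<And>u. u \<in> carrier G \<Longrightarrow> z \<otimes> u = act u f \<otimes> z"
  shows "z = s f"
proof -
  have "inv (s f) \<otimes> z = \<one>"
  proof (rule trivial_center)
    fix u assume u: "u \<in> carrier G"
    have "inv (s f) \<otimes> z \<otimes> u = inv (s f) \<otimes> (act u f \<otimes> z)"
      using assms u by (simp add: G.m_assoc)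
    also have "\<dots> = u \<otimes> (inv (s f) \<otimes> z)"
      using assms(1,2) u by (simp add: act_inner G.m_assoc[symmetric])
    finally show "inv (s f) \<otimes> z \<otimes> u = u \<otimes> (inv (s f) \<otimes> z)" .
  qed (use assms in auto)
  thus ?thesis
    using assms by (metis G.inv_closed G.inv_equality G.inv_inv s_closed)
qed

end

section \<open>The braiding axioms and the pairings with the unit\<close>

context ab_ext_untwisted begin

context
  fixes B :: "'g \<Rightarrow> 'f \<Rightarrow> 'g \<Rightarrow> 'f \<Rightarrow> 'k"
  assumes B: "is_braiding B"
begin

lemma braiding_mult_left:
  "g \<in> carrier G \<Longrightarrow> i \<in> carrier F \<Longrightarrow> g' \<in> carrier G \<Longrightarrow> i' \<in> carrier F \<Longrightarrow> h \<in> carrier G \<Longrightarrow>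
    j \<in> carrier F \<Longrightarrow>
   G.gconv (\<lambda>h. B g i h j) (\<lambda>h. B g' i' h j) h = (if act g i = g' then B g (i \<otimes>\<^bsub>F\<^esub> i') h j else 0)"
  by (rule B[unfolded is_braiding_def, THEN conjunct1, rule_format, symmetric])

lemma braiding_mult_right:
  "g \<in> carrier G \<Longrightarrow> i \<in> carrier F \<Longrightarrow> h \<in> carrier G \<Longrightarrow> j \<in> carrier F \<Longrightarrow> h' \<in> carrier G \<Longrightarrow>
    j' \<in> carrier F \<Longrightarrow>
   G.gconv (\<lambda>g. B g i h' j') (\<lambda>g. B g i h j) g = (if act h j = h' then B g i h (j \<otimes>\<^bsub>F\<^esub> j') else 0)"
  by (rule B[unfolded is_braiding_def, THEN conjunct2, THEN conjunct1, rule_format, symmetric])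

lemma braiding_commute:
  "g \<in> carrier G \<Longrightarrow> i \<in> carrier F \<Longrightarrow> h \<in> carrier G \<Longrightarrow> j \<in> carrier F \<Longrightarrow> u \<in> carrier G \<Longrightarrow>
   B (g \<otimes> inv u) i (h \<otimes> inv (act u i)) j =
   B (inv (act u j) \<otimes> g) i (inv u \<otimes> h) j"
  by (rule B[unfolded is_braiding_def, THEN conjunct2, THEN conjunct2, rule_format])

text \<open>The sum of the e_g # 1 is the unit of the algebra, so this is <1, y> = \<epsilon>(y).
  Multiplicativity in the first variable gives an idempotent of the group algebra, and invertibility
  of the form makes it 1.\<close>

lemma braiding_unit_left:
  assumes inv: "conv_inverse B \<Psi>" and h: "h \<in> carrier G" and j: "j \<in> carrier F"
  shows "(\<Sum>g\<in>carrier G. B g \<one>\<^bsub>F\<^esub> h j) = (if h = \<one> then 1 else 0)"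
proof (rule G.gconv_idempotent_unit[OF fin_G _ _ h])
  fix x assume x: "x \<in> carrier G"
  show "G.gconv (\<lambda>h. \<Sum>g\<in>carrier G. B g \<one>\<^bsub>F\<^esub> h j) (\<lambda>h. \<Sum>g\<in>carrier G. B g \<one>\<^bsub>F\<^esub> h j) x
    = (\<Sum>g\<in>carrier G. B g \<one>\<^bsub>F\<^esub> x j)"
    unfolding G.sum_gconv[OF fin_G, symmetric]
    using x j by (simp add: braiding_mult_left)
  \<comment> \<open>Summing the inverse equation over g and translating that index separates g from
    g'. What remains says that the summed \<Psi> is a right inverse of the idempotent.\<close>
  have "(\<Sum>g\<in>carrier G. \<Sum>g'\<in>carrier G. \<Sum>h'\<in>carrier G.
      B g' \<one>\<^bsub>F\<^esub> h' j * \<Psi> (inv g' \<otimes> g) \<one>\<^bsub>F\<^esub> (inv h' \<otimes> x) j)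
    = (\<Sum>g\<in>carrier G. if g = \<one> \<and> x = \<one> then 1 else 0)"
    using inv x j unfolding conv_inverse_def by (intro sum.cong) auto
  also have "\<dots> = (if x = \<one> then 1 else 0)" by simp
  also have "(\<Sum>g\<in>carrier G. \<Sum>g'\<in>carrier G. \<Sum>h'\<in>carrier G.
      B g' \<one>\<^bsub>F\<^esub> h' j * \<Psi> (inv g' \<otimes> g) \<one>\<^bsub>F\<^esub> (inv h' \<otimes> x) j)
    = (\<Sum>g'\<in>carrier G. \<Sum>g\<in>carrier G. \<Sum>h'\<in>carrier G.
      B g' \<one>\<^bsub>F\<^esub> h' j * \<Psi> (inv g' \<otimes> g) \<one>\<^bsub>F\<^esub> (inv h' \<otimes> x) j)"
    by (rule sum.swap)
  also have "\<dots> = (\<Sum>g'\<in>carrier G. \<Sum>g\<in>carrier G. G.gconv (\<lambda>h. B g' \<one>\<^bsub>F\<^esub> h j) (\<lambda>h. \<Psi> g \<one>\<^bsub>F\<^esub> h j) x)"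
    unfolding G.gconv_def
  proof (rule sum.cong[OF refl])
    fix g' assume "g' \<in> carrier G"
    thus "(\<Sum>g\<in>carrier G. \<Sum>h'\<in>carrier G.
        B g' \<one>\<^bsub>F\<^esub> h' j * \<Psi> (inv g' \<otimes> g) \<one>\<^bsub>F\<^esub> (inv h' \<otimes> x) j)
      = (\<Sum>g\<in>carrier G. \<Sum>h'\<in>carrier G.
        B g' \<one>\<^bsub>F\<^esub> h' j * \<Psi> g \<one>\<^bsub>F\<^esub> (inv h' \<otimes> x) j)"
      using G.sum_left_translate[of "inv g'" "\<lambda>g. \<Sum>h'\<in>carrier G.
        B g' \<one>\<^bsub>F\<^esub> h' j * \<Psi> g \<one>\<^bsub>F\<^esub> (inv h' \<otimes> x) j"] by simp
  qed
  finally show "G.gconv (\<lambda>h. \<Sum>g\<in>carrier G. B g \<one>\<^bsub>F\<^esub> h j) (\<lambda>h. \<Sum>g\<in>carrier G. \<Psi> g \<one>\<^bsub>F\<^esub> h j) x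
    = (if x = \<one> then 1 else 0)"
    unfolding G.sum_gconv[OF fin_G] .
qed

lemma braiding_unit_right:
  assumes inv: "conv_inverse B \<Psi>" and g: "g \<in> carrier G" and i: "i \<in> carrier F"
  shows "(\<Sum>h\<in>carrier G. B g i h \<one>\<^bsub>F\<^esub>) = (if g = \<one> then 1 else 0)"
proof (rule G.gconv_idempotent_unit[OF fin_G _ _ g])
  fix x assume x: "x \<in> carrier G"
  have "(\<Sum>h\<in>carrier G. \<Sum>h'\<in>carrier G. G.gconv (\<lambda>g. B g i h \<one>\<^bsub>F\<^esub>) (\<lambda>g. B g i h' \<one>\<^bsub>F\<^esub>) x)
    = (\<Sum>h\<in>carrier G. B x i h \<one>\<^bsub>F\<^esub>)"
    using x i by (simp add: braiding_mult_right)
  thus "G.gconv (\<lambda>g. \<Sum>h\<in>carrier G. B g i h \<one>\<^bsub>F\<^esub>) (\<lambda>g. \<Sum>h\<in>carrier G. B g i h \<one>\<^bsub>F\<^esub>) x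
    = (\<Sum>h\<in>carrier G. B x i h \<one>\<^bsub>F\<^esub>)"
    unfolding G.sum_gconv[OF fin_G, symmetric] .
  have "(\<Sum>h\<in>carrier G. \<Sum>g'\<in>carrier G. \<Sum>h'\<in>carrier G.
      B g' i h' \<one>\<^bsub>F\<^esub> * \<Psi> (inv g' \<otimes> x) i (inv h' \<otimes> h) \<one>\<^bsub>F\<^esub>)
    = (\<Sum>h\<in>carrier G. if h = \<one> then (if x = \<one> then 1 else 0) else 0)"
    using inv x i unfolding conv_inverse_def by (intro sum.cong) auto
  also have "\<dots> = (if x = \<one> then 1 else 0)" by simp
  also have "(\<Sum>h\<in>carrier G. \<Sum>g'\<in>carrier G. \<Sum>h'\<in>carrier G.
      B g' i h' \<one>\<^bsub>F\<^esub> * \<Psi> (inv g' \<otimes> x) i (inv h' \<otimes> h) \<one>\<^bsub>F\<^esub>)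
    = (\<Sum>h\<in>carrier G. \<Sum>h'\<in>carrier G. \<Sum>g'\<in>carrier G.
      B g' i h' \<one>\<^bsub>F\<^esub> * \<Psi> (inv g' \<otimes> x) i (inv h' \<otimes> h) \<one>\<^bsub>F\<^esub>)"
    by (rule sum.cong[OF refl]) (rule sum.swap)
  also have "\<dots> = (\<Sum>h'\<in>carrier G. \<Sum>h\<in>carrier G. \<Sum>g'\<in>carrier G.
      B g' i h' \<one>\<^bsub>F\<^esub> * \<Psi> (inv g' \<otimes> x) i (inv h' \<otimes> h) \<one>\<^bsub>F\<^esub>)"
    by (rule sum.swap)
  also have "\<dots> = (\<Sum>h'\<in>carrier G. \<Sum>h\<in>carrier G. G.gconv (\<lambda>g. B g i h' \<one>\<^bsub>F\<^esub>) (\<lambda>g. \<Psi> g i h \<one>\<^bsub>F\<^esub>) x)"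
    unfolding G.gconv_def
  proof (rule sum.cong[OF refl])
    fix h' assume "h' \<in> carrier G"
    thus "(\<Sum>h\<in>carrier G. \<Sum>g'\<in>carrier G.
        B g' i h' \<one>\<^bsub>F\<^esub> * \<Psi> (inv g' \<otimes> x) i (inv h' \<otimes> h) \<one>\<^bsub>F\<^esub>)
      = (\<Sum>h\<in>carrier G. \<Sum>g'\<in>carrier G.
        B g' i h' \<one>\<^bsub>F\<^esub> * \<Psi> (inv g' \<otimes> x) i h \<one>\<^bsub>F\<^esub>)"
      using G.sum_left_translate[of "inv h'" "\<lambda>h. \<Sum>g'\<in>carrier G.
        B g' i h' \<one>\<^bsub>F\<^esub> * \<Psi> (inv g' \<otimes> x) i h \<one>\<^bsub>F\<^esub>"] by simp
  qed
  finally show "G.gconv (\<lambda>g. \<Sum>h\<in>carrier G. B g i h \<one>\<^bsub>F\<^esub>) (\<lambda>g. \<Sum>h\<in>carrier G. \<Psi> g i h \<one>\<^bsub>F\<^esub>) x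
    = (if x = \<one> then 1 else 0)"
    unfolding G.sum_gconv[OF fin_G] .
qed

end

end

section \<open>Support and values of a braiding for an inner action\<close>

context ab_ext_inner begin

text \<open>The four steps treat i = 1, then the first support point for all i, then j = 1, then the
  second support point for all j. Each passes from the trivial component to a general one by
  factoring e_g # i or e_h # j through an element whose pairing is already known.\<close>

lemma braiding_form:
  assumes B: "is_braiding B" and inv: "conv_inverse B \<Psi>"
    and B0: "\<And>g h. g \<in> carrier G \<Longrightarrow> h \<in> carrier G \<Longrightarrow>
      B g \<one>\<^bsub>F\<^esub> h \<one>\<^bsub>F\<^esub> = (if g = \<one> \<and> h = \<one> then 1 else 0)"
  obtains \<chi> where
    "\<And>g i h j. g \<in> carrier G \<Longrightarrow> i \<in> carrier F \<Longrightarrow> h \<in> carrier G \<Longrightarrow> j \<in> carrier F \<Longrightarrow>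
      B g i h j = (if g = s j \<and> h = inv (s i) then \<chi> i j else 0)"
    "\<And>i i' j. i \<in> carrier F \<Longrightarrow> i' \<in> carrier F \<Longrightarrow> j \<in> carrier F \<Longrightarrow>
      \<chi> (i \<otimes>\<^bsub>F\<^esub> i') j = \<chi> i j * \<chi> i' j"
    "\<And>i j j'. i \<in> carrier F \<Longrightarrow> j \<in> carrier F \<Longrightarrow> j' \<in> carrier F \<Longrightarrow>
      \<chi> i (j \<otimes>\<^bsub>F\<^esub> j') = \<chi> i j * \<chi> i j'"
    "\<And>j. j \<in> carrier F \<Longrightarrow> \<chi> \<one>\<^bsub>F\<^esub> j = 1"
    "\<And>i. i \<in> carrier F \<Longrightarrow> \<chi> i \<one>\<^bsub>F\<^esub> = 1"
proof -
  have 1: "B g \<one>\<^bsub>F\<^esub> h j = (if g = s j \<and> h = \<one> then 1 else 0)"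
    if gh: "g \<in> carrier G" "h \<in> carrier G" and j: "j \<in> carrier F" for g h j
  proof -
    \<comment> \<open>The sum of the e_h # j over h is the element j of the group algebra of F. It
      is group-like because \<tau> = 1, so pairing the e_g with it is a character of the functions
      on G, that is, a point \<open>a\<close>.\<close>
    define e where "e g = (\<Sum>h\<in>carrier G. B g \<one>\<^bsub>F\<^esub> h j)" for g
    have orth: "e g * e g' = (if g = g' then e g else 0)" if "g \<in> carrier G" "g' \<in> carrier G" for g g'
    proof -
      have "e g * e g' = (\<Sum>h\<in>carrier G. if g = g' then B g \<one>\<^bsub>F\<^esub> h j else 0)"
        unfolding e_def G.sum_gconv_total[OF fin_G, symmetric]
        using that j by (intro sum.cong) (simp_all add: braiding_mult_left[OF B])
      thus ?thesis by (simp add: e_def)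
    qed
    have one: "sum e (carrier G) = 1"
      unfolding e_def by (subst sum.swap) (simp add: braiding_unit_left[OF B inv] j)
    obtain a where a: "a \<in> carrier G" "\<And>g. g \<in> carrier G \<Longrightarrow> e g = (if g = a then 1 else 0)"
      using orthogonal_idempotents_field[OF fin_G orth one] by blast
    have B1: "B g \<one>\<^bsub>F\<^esub> h j = (if g = a \<and> h = \<one> then 1 else 0)"
      if "g \<in> carrier G" "h \<in> carrier G" for g h
    proof -
      \<comment> \<open>Since e_h # j is the product of e_h # 1 and the sum of all e_h' # j, its
        pairing is the convolution of the character \<open>e\<close> with the trivial pairing
        \<open>B0\<close>.\<close>
      have "B g \<one>\<^bsub>F\<^esub> h j
        = (\<Sum>h'\<in>carrier G. G.gconv (\<lambda>g. B g \<one>\<^bsub>F\<^esub> h' j) (\<lambda>g. B g \<one>\<^bsub>F\<^esub> h \<one>\<^bsub>F\<^esub>) g)"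
        using that j by (simp add: braiding_mult_right[OF B])
      also have "\<dots> = G.gconv e (\<lambda>g. B g \<one>\<^bsub>F\<^esub> h \<one>\<^bsub>F\<^esub>) g"
        unfolding e_def G.gconv_def sum_distrib_right by (rule sum.swap)
      also have "\<dots> = G.gconv (\<lambda>g. if g = a then 1 else 0) (\<lambda>g. B g \<one>\<^bsub>F\<^esub> h \<one>\<^bsub>F\<^esub>) g"
        by (rule G.gconv_cong) (use a that in auto)
      also have "\<dots> = B (inv a \<otimes> g) \<one>\<^bsub>F\<^esub> h \<one>\<^bsub>F\<^esub>"
        by (simp add: G.gconv_delta_left a)
      also have "\<dots> = (if g = a \<and> h = \<one> then 1 else 0)"
      proof -
        have "inv a \<otimes> g = \<one> \<longleftrightarrow> g = a"
          using that(1) a(1) by (metis G.inv_closed G.inv_equality G.inv_inv G.l_inv)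
        thus ?thesis using that a(1) by (simp add: B0)
      qed
      finally show ?thesis .
    qed
    have "a = s j"
    proof (rule inner_unique[OF a(1) j])
      fix u assume u: "u \<in> carrier G"
      \<comment> \<open>The third axiom at (a u, u), chosen so that its left side is B at the
        support point (a, 1). The right side is then nonzero too, which forces a u = (act u j)
        a.\<close>
      have "B (a \<otimes> u \<otimes> inv u) \<one>\<^bsub>F\<^esub> (u \<otimes> inv (act u \<one>\<^bsub>F\<^esub>)) j = 1"
        using u a(1) by (simp add: G.m_assoc B1)
      hence "B (inv (act u j) \<otimes> (a \<otimes> u)) \<one>\<^bsub>F\<^esub> (inv u \<otimes> u) j = 1"
        using u a(1) j by (subst (asm) braiding_commute[OF B]) auto
      hence "inv (act u j) \<otimes> (a \<otimes> u) = a"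
        using u a(1) j B1 by (auto split: if_splits)
      thus "a \<otimes> u = act u j \<otimes> a"
        using u a(1) j by (metis G.inv_solve_left G.m_closed act_closed)
    qed
    with B1 gh show ?thesis by simp
  qed
  have 2: "g = s j" if "B g i h j \<noteq> 0" "g \<in> carrier G" "i \<in> carrier F" "h \<in> carrier G" "j \<in> carrier F"
    for g i h j
  proof -
    \<comment> \<open>e_g # i is e_g # 1 times the sum of all e_g' # i, so the support in
      \<open>g\<close> is inherited from the case i = 1.\<close>
    have "B g i h j = (\<Sum>g'\<in>carrier G. G.gconv (\<lambda>h. B g \<one>\<^bsub>F\<^esub> h j) (\<lambda>h. B g' i h j) h)"
      using that by (simp add: braiding_mult_left[OF B])
    also have "\<dots> = 0" if "g \<noteq> s j"
    proof (rule sum.neutral, rule ballI)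
      fix g' assume "g' \<in> carrier G"
      have "G.gconv (\<lambda>h. B g \<one>\<^bsub>F\<^esub> h j) (\<lambda>h. B g' i h j) h = G.gconv (\<lambda>h. 0) (\<lambda>h. B g' i h j) h"
        using 1 that \<open>g \<in> carrier G\<close> \<open>j \<in> carrier F\<close> \<open>h \<in> carrier G\<close> by (intro G.gconv_cong) auto
      thus "G.gconv (\<lambda>h. B g \<one>\<^bsub>F\<^esub> h j) (\<lambda>h. B g' i h j) h = 0" by (simp add: G.gconv_def)
    qed
    finally show ?thesis using that(1) by blast
  qed
  have 3: "B g i h \<one>\<^bsub>F\<^esub> = (if g = \<one> \<and> h = inv (s i) then 1 else 0)"
    if gh: "g \<in> carrier G" "h \<in> carrier G" and i: "i \<in> carrier F" for g h i
  proof -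
    define e where "e h = (\<Sum>g\<in>carrier G. B g i h \<one>\<^bsub>F\<^esub>)" for h
    have "e h' * e h = (if h = h' then e h else 0)" if "h \<in> carrier G" "h' \<in> carrier G" for h h'
    proof -
      have "e h' * e h = (\<Sum>g\<in>carrier G. if h = h' then B g i h \<one>\<^bsub>F\<^esub> else 0)"
        unfolding e_def G.sum_gconv_total[OF fin_G, symmetric]
        using that i by (intro sum.cong) (simp_all add: braiding_mult_right[OF B])
      thus ?thesis by (simp add: e_def)
    qed
    hence orth: "e h * e h' = (if h = h' then e h else 0)" if "h \<in> carrier G" "h' \<in> carrier G" for h h'
      using that by metis
    have one: "sum e (carrier G) = 1"
      unfolding e_def by (subst sum.swap) (simp add: braiding_unit_right[OF B inv] i)
    obtain a where a: "a \<in> carrier G" "\<And>g. g \<in> carrier G \<Longrightarrow> e g = (if g = a then 1 else 0)"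
      using orthogonal_idempotents_field[OF fin_G orth one] by blast
    have B1: "B g i h \<one>\<^bsub>F\<^esub> = (if g = \<one> \<and> h = a then 1 else 0)"
      if "g \<in> carrier G" "h \<in> carrier G" for g h
    proof -
      \<comment> \<open>Step \<open>2\<close> at j = 1 already gives g = s 1 = 1, so B agrees with
        its sum \<open>e\<close> over \<open>g\<close> and one character settles both
        variables.\<close>
      have z: "B g i h \<one>\<^bsub>F\<^esub> = 0" if "g \<noteq> \<one>" "g \<in> carrier G" for g
        using 2[of g i h "\<one>\<^bsub>F\<^esub>"] that i \<open>h \<in> carrier G\<close> by auto
      have "e h = (\<Sum>g\<in>carrier G. if g = \<one> then B g i h \<one>\<^bsub>F\<^esub> else 0)"
        unfolding e_def using z by (intro sum.cong) auto
      hence "B \<one> i h \<one>\<^bsub>F\<^esub> = e h" by simp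
      with a that z show ?thesis by (cases "g = \<one>") auto
    qed
    have "inv a = s i"
    proof (rule inner_unique)
      fix u assume u: "u \<in> carrier G"
      \<comment> \<open>The third axiom at (u, a (act u i)), again with B at the support point (1,
        a) on its left side.\<close>
      have "B (u \<otimes> inv u) i (a \<otimes> act u i \<otimes> inv (act u i)) \<one>\<^bsub>F\<^esub> = 1"
        using u a(1) i by (simp add: G.m_assoc B1)
      hence "B (inv (act u \<one>\<^bsub>F\<^esub>) \<otimes> u) i (inv u \<otimes> (a \<otimes> act u i)) \<one>\<^bsub>F\<^esub> = 1"
        using u a(1) i by (subst (asm) braiding_commute[OF B]) auto
      hence *: "inv u \<otimes> (a \<otimes> act u i) = a"
        using u a(1) i B1 by (auto split: if_splits)
      hence "a \<otimes> act u i = u \<otimes> a"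
        using u a(1) i by (metis G.inv_solve_left G.m_closed act_closed)
      thus "inv a \<otimes> u = act u i \<otimes> inv a"
        using u a(1) i by (metis G.inv_closed G.inv_solve_left G.inv_solve_right G.m_assoc G.m_closed act_closed)
    qed (use a i in auto)
    hence "a = inv (s i)" using a(1) by (metis G.inv_inv)
    with B1 gh show ?thesis by simp
  qed
  have 4: "h = inv (s i)" if "B g i h j \<noteq> 0" "g \<in> carrier G" "i \<in> carrier F" "h \<in> carrier G" "j \<in> carrier F"
    for g i h j
  proof (rule ccontr)
    assume h: "h \<noteq> inv (s i)"
    \<comment> \<open>Acting by \<open>j\<close> is injective and fixes \<open>inv (s i)\<close>.
      Hence the idempotent e_(act h j), which reproduces e_h # j when multiplied on its right, pairs
      to zero by step \<open>3\<close>.\<close>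
    have "act h j \<noteq> inv (s i)"
      using h act_inj[of h "inv (s i)" j] that by auto
    hence "G.gconv (\<lambda>g. B g i (act h j) \<one>\<^bsub>F\<^esub>) (\<lambda>g. B g i h j) g = G.gconv (\<lambda>g. 0) (\<lambda>g. B g i h j) g"
      using that by (intro G.gconv_cong) (auto simp: 3)
    moreover have "G.gconv (\<lambda>g. B g i (act h j) \<one>\<^bsub>F\<^esub>) (\<lambda>g. B g i h j) g = B g i h j"
      using that by (simp add: braiding_mult_right[OF B])
    ultimately show False using that(1) by (simp add: G.gconv_def)
  qed
  define \<chi> where "\<chi> i j = B (s j) i (inv (s i)) j" for i j
  have form: "B g i h j = (if g = s j \<and> h = inv (s i) then \<chi> i j else 0)"
    if "g \<in> carrier G" "i \<in> carrier F" "h \<in> carrier G" "j \<in> carrier F" for g i h j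
  proof (cases "g = s j \<and> h = inv (s i)")
    case True
    thus ?thesis by (simp add: \<chi>_def)
  next
    case False
    hence "B g i h j = 0" using 2[OF _ that] 4[OF _ that] by blast
    thus ?thesis unfolding if_not_P[OF False] .
  qed
  show thesis
  proof (rule that[OF form])
    fix i i' j assume ij: "i \<in> carrier F" "i' \<in> carrier F" "j \<in> carrier F"
    let ?h = "inv (s i) \<otimes> inv (s i')"
    have h: "?h = inv (s (i \<otimes>\<^bsub>F\<^esub> i'))"
      using ij by (simp add: F.m_comm[of i i'] s_mult G.inv_mult_group)
    have "\<chi> (i \<otimes>\<^bsub>F\<^esub> i') j = G.gconv (\<lambda>h. B (s j) i h j) (\<lambda>h. B (s j) i' h j) ?h"
      using ij by (simp add: braiding_mult_left[OF B] h \<chi>_def)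
    also have "\<dots> = G.gconv (\<lambda>h. if h = inv (s i) then \<chi> i j else 0) (\<lambda>h. B (s j) i' h j) ?h"
      using ij by (intro G.gconv_cong) (auto simp: form)
    also have "\<dots> = \<chi> i j * B (s j) i' (inv (inv (s i)) \<otimes> ?h) j"
      using ij by (simp add: G.gconv_delta_left)
    also have "inv (inv (s i)) \<otimes> ?h = inv (s i')"
      using ij by (simp add: G.m_assoc[symmetric])
    finally show "\<chi> (i \<otimes>\<^bsub>F\<^esub> i') j = \<chi> i j * \<chi> i' j" by (simp add: \<chi>_def)
  next
    fix i j j' assume ij: "i \<in> carrier F" "j \<in> carrier F" "j' \<in> carrier F"
    let ?h = "inv (s i)"
    have "\<chi> i (j \<otimes>\<^bsub>F\<^esub> j') = G.gconv (\<lambda>g. B g i ?h j') (\<lambda>g. B g i ?h j) (s (j \<otimes>\<^bsub>F\<^esub> j'))"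
      using ij by (simp add: braiding_mult_right[OF B] \<chi>_def)
    also have "\<dots> = G.gconv (\<lambda>g. if g = s j' then \<chi> i j' else 0) (\<lambda>g. B g i ?h j) (s (j \<otimes>\<^bsub>F\<^esub> j'))"
      using ij by (intro G.gconv_cong) (auto simp: form)
    also have "\<dots> = \<chi> i j' * B (inv (s j') \<otimes> s (j \<otimes>\<^bsub>F\<^esub> j')) i ?h j"
      using ij by (simp add: G.gconv_delta_left)
    also have "inv (s j') \<otimes> s (j \<otimes>\<^bsub>F\<^esub> j') = s j"
      using ij by (simp add: F.m_comm[of j j'] s_mult G.m_assoc[symmetric])
    finally show "\<chi> i (j \<otimes>\<^bsub>F\<^esub> j') = \<chi> i j * \<chi> i j'" by (simp add: \<chi>_def)
  next
    show "\<chi> \<one>\<^bsub>F\<^esub> j = 1" if "j \<in> carrier F" for j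
      using that by (simp add: \<chi>_def 1)
    show "\<chi> i \<one>\<^bsub>F\<^esub> = 1" if "i \<in> carrier F" for i
      using that by (simp add: \<chi>_def 3)
  qed
qed

end

section \<open>From a bicharacter of F back to a braiding structure\<close>

context ab_ext_inner begin

context
  fixes \<chi> :: "'f \<Rightarrow> 'f \<Rightarrow> 'k" and B
  assumes mult_left: "\<And>i i' j. i \<in> carrier F \<Longrightarrow> i' \<in> carrier F \<Longrightarrow> j \<in> carrier F \<Longrightarrow>
      \<chi> (i \<otimes>\<^bsub>F\<^esub> i') j = \<chi> i j * \<chi> i' j"
    and mult_right: "\<And>i j j'. i \<in> carrier F \<Longrightarrow> j \<in> carrier F \<Longrightarrow> j' \<in> carrier F \<Longrightarrow>
      \<chi> i (j \<otimes>\<^bsub>F\<^esub> j') = \<chi> i j * \<chi> i j'"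
    and nonzero: "\<And>i j. i \<in> carrier F \<Longrightarrow> j \<in> carrier F \<Longrightarrow> \<chi> i j \<noteq> 0"
    and form: "\<And>g i h j. g \<in> carrier G \<Longrightarrow> i \<in> carrier F \<Longrightarrow> h \<in> carrier G \<Longrightarrow> j \<in> carrier F \<Longrightarrow>
      B g i h j = (if g = s j \<and> h = inv (s i) then \<chi> i j else 0)"
begin

text \<open>Every convolution here has a multiple of a group element as its left factor, so each
  axiom splits into an equality of support conditions and an identity for \<chi>. In the third axiom
  the supports agree because s(j) u = (act u j) s(j), and likewise for the inverse of s(i).\<close>

lemma is_braiding_form: "is_braiding B"
  unfolding is_braiding_def
proof (intro conjI ballI)
  fix g i g' i' h j
  assume c: "g \<in> carrier G" "i \<in> carrier F" "g' \<in> carrier G" "i' \<in> carrier F" "h \<in> carrier G" "j \<in> carrier F"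
  have "G.gconv (\<lambda>h. B g i h j) (\<lambda>h. B g' i' h j) h
    = G.gconv (\<lambda>h. if h = inv (s i) then (if g = s j then \<chi> i j else 0) else 0) (\<lambda>h. B g' i' h j) h"
    using c by (intro G.gconv_cong) (auto simp: form)
  also have "\<dots> = (if g = s j then \<chi> i j else 0) * B g' i' (s i \<otimes> h) j"
    using c by (simp add: G.gconv_delta_left)
  also have "\<dots> = (if act g i = g' then B g (i \<otimes>\<^bsub>F\<^esub> i') h j else 0)"
  proof -
    have "s i \<otimes> h = inv (s i') \<longleftrightarrow> h = inv (s (i \<otimes>\<^bsub>F\<^esub> i'))"
      using c by (simp add: F.m_comm[of i i'] s_mult G.inv_mult_group) (metis G.inv_closed G.inv_solve_left s_closed)
    thus ?thesis using c by (auto simp: form mult_left)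
  qed
  finally show "(if act g i = g' then B g (i \<otimes>\<^bsub>F\<^esub> i') h j else 0)
    = G.gconv (\<lambda>h. B g i h j) (\<lambda>h. B g' i' h j) h" ..
next
  fix g i h j h' j'
  assume c: "g \<in> carrier G" "i \<in> carrier F" "h \<in> carrier G" "j \<in> carrier F" "h' \<in> carrier G" "j' \<in> carrier F"
  have "G.gconv (\<lambda>g. B g i h' j') (\<lambda>g. B g i h j) g
    = G.gconv (\<lambda>g. if g = s j' then (if h' = inv (s i) then \<chi> i j' else 0) else 0) (\<lambda>g. B g i h j) g"
    using c by (intro G.gconv_cong) (auto simp: form)
  also have "\<dots> = (if h' = inv (s i) then \<chi> i j' else 0) * B (inv (s j') \<otimes> g) i h j"
    using c by (simp add: G.gconv_delta_left)
  also have "\<dots> = (if act h j = h' then B g i h (j \<otimes>\<^bsub>F\<^esub> j') else 0)"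
  proof -
    have "inv (s j') \<otimes> g = s j \<longleftrightarrow> g = s (j \<otimes>\<^bsub>F\<^esub> j')"
      using c by (simp add: F.m_comm[of j j'] s_mult) (metis G.inv_solve_left s_closed)
    thus ?thesis using c by (auto simp: form mult_right)
  qed
  finally show "(if act h j = h' then B g i h (j \<otimes>\<^bsub>F\<^esub> j') else 0)
    = G.gconv (\<lambda>g. B g i h' j') (\<lambda>g. B g i h j) g" ..
next
  fix g i h j u
  assume c: "g \<in> carrier G" "i \<in> carrier F" "h \<in> carrier G" "j \<in> carrier F" "u \<in> carrier G"
  have "g \<otimes> inv u = s j \<longleftrightarrow> inv (act u j) \<otimes> g = s j"
  proof -
    have "g \<otimes> inv u = s j \<longleftrightarrow> g = s j \<otimes> u"
      using c by (metis G.inv_solve_right s_closed)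
    moreover have "inv (act u j) \<otimes> g = s j \<longleftrightarrow> g = act u j \<otimes> s j"
      using c by (metis G.inv_solve_left act_closed s_closed)
    moreover have "act u j \<otimes> s j = s j \<otimes> u"
      using c by (simp add: act_inner G.m_assoc)
    ultimately show ?thesis by simp
  qed
  moreover have "h \<otimes> inv (act u i) = inv (s i) \<longleftrightarrow> inv u \<otimes> h = inv (s i)"
  proof -
    have "h \<otimes> inv (act u i) = inv (s i) \<longleftrightarrow> h = inv (s i) \<otimes> act u i"
      using c by (metis G.inv_solve_right act_closed s_closed G.inv_closed)
    moreover have "inv u \<otimes> h = inv (s i) \<longleftrightarrow> h = u \<otimes> inv (s i)"
      using c by (metis G.inv_solve_left s_closed G.inv_closed)
    moreover have "inv (s i) \<otimes> act u i = u \<otimes> inv (s i)"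
      using c by (simp add: act_inner G.m_assoc[symmetric])
    ultimately show ?thesis by simp
  qed
  ultimately show "B (g \<otimes> inv u) i (h \<otimes> inv (act u i)) j
     = B (inv (act u j) \<otimes> g) i (inv u \<otimes> h) j"
    using c by (simp add: form)
qed

lemma conv_inverse_form:
  "\<exists>\<Psi>. conv_inverse B \<Psi> \<and> conv_inverse \<Psi> B"
proof (intro exI conjI)
  \<comment> \<open>For fixed (i, j), \<open>B\<close> is \<chi>(i,j) times a single element of G
    \<times> G; the inverse element with the inverse coefficient undoes it.\<close>
  let ?\<Psi> = "\<lambda>g i h j. if g = inv (s j) \<and> h = s i then inverse (\<chi> i j) else 0"
  show "conv_inverse B ?\<Psi>"
    unfolding conv_inverse_def
  proof (intro ballI)
    fix g i h j assume c: "g \<in> carrier G" "i \<in> carrier F" "h \<in> carrier G" "j \<in> carrier F"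
    have "(\<Sum>g'\<in>carrier G. \<Sum>h'\<in>carrier G.
         B g' i h' j * ?\<Psi> (inv g' \<otimes> g) i (inv h' \<otimes> h) j)
      = (\<Sum>g'\<in>carrier G. \<Sum>h'\<in>carrier G. (if g' = s j \<and> h' = inv (s i) then \<chi> i j else 0) *
          ?\<Psi> (inv g' \<otimes> g) i (inv h' \<otimes> h) j)"
      using c by (intro sum.cong refl) (simp only: form)
    also have "\<dots> = \<chi> i j * ?\<Psi> (inv (s j) \<otimes> g) i (inv (inv (s i)) \<otimes> h) j"
      using c by (intro sum_sum_delta) simp_all
    also have "\<dots> = (if g = \<one> \<and> h = \<one> then 1 else 0)"
      using c nonzero by simp
    finally show "(\<Sum>g'\<in>carrier G. \<Sum>h'\<in>carrier G.
         B g' i h' j * ?\<Psi> (inv g' \<otimes> g) i (inv h' \<otimes> h) j) =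
      (if g = \<one> \<and> h = \<one> then 1 else 0)" .
  qed
  show "conv_inverse ?\<Psi> B"
    unfolding conv_inverse_def
  proof (intro ballI)
    fix g i h j assume c: "g \<in> carrier G" "i \<in> carrier F" "h \<in> carrier G" "j \<in> carrier F"
    have "(\<Sum>g'\<in>carrier G. \<Sum>h'\<in>carrier G.
         ?\<Psi> g' i h' j * B (inv g' \<otimes> g) i (inv h' \<otimes> h) j)
      = inverse (\<chi> i j) * B (inv (inv (s j)) \<otimes> g) i (inv (s i) \<otimes> h) j"
      using c by (intro sum_sum_delta) simp_all
    also have "\<dots> = (if g = \<one> \<and> h = \<one> then 1 else 0)"
      using c nonzero by (simp add: form)
    finally show "(\<Sum>g'\<in>carrier G. \<Sum>h'\<in>carrier G.
         ?\<Psi> g' i h' j * B (inv g' \<otimes> g) i (inv h' \<otimes> h) j) =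
      (if g = \<one> \<and> h = \<one> then 1 else 0)" .
  qed
qed

end

end

section \<open>Pairings on the functions on a group\<close>

lemma (in group) idempotent_pairing_support_commute:
  fixes C :: "'a \<Rightarrow> 'a \<Rightarrow> 'k::field"
  assumes fin: "finite (carrier G)"
    and mult: "\<And>g g' h. g \<in> carrier G \<Longrightarrow> g' \<in> carrier G \<Longrightarrow> h \<in> carrier G \<Longrightarrow>
      gconv (C g) (C g') h = (if g = g' then C g h else 0)"
    and comult: "\<And>g h h'. g \<in> carrier G \<Longrightarrow> h \<in> carrier G \<Longrightarrow> h' \<in> carrier G \<Longrightarrow>
      gconv (\<lambda>g. C g h) (\<lambda>g. C g h') g = (if h = h' then C g h else 0)"
    and c: "g1 \<in> carrier G" "h1 \<in> carrier G" "g2 \<in> carrier G" "h2 \<in> carrier G"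
    and nz: "C g1 h1 \<noteq> 0" "C g2 h2 \<noteq> 0"
  shows "h1 \<otimes> h2 = h2 \<otimes> h1"
proof -
  \<comment> \<open>\<open>h\<close> times \<open>C g h\<close> is a linear combination of the commuting idempotents \<open>\<Sum>h. C a h \<cdot> h\<close>.\<close>
  have expand: "(\<Sum>a\<in>carrier G. C (inv a \<otimes> g) h * C a x) = (if x = h then C g h else 0)"
    if "g \<in> carrier G" "h \<in> carrier G" "x \<in> carrier G" for g h x
    using comult[of g x h] that by (simp add: gconv_def mult.commute)
  have prod: "(\<Sum>a\<in>carrier G. \<Sum>b\<in>carrier G. C (inv a \<otimes> g) h * C (inv b \<otimes> g') h' * gconv (C a) (C b) y)
      = C g h * (if inv h \<otimes> y = h' then C g' h' else 0)"
    if "g \<in> carrier G" "h \<in> carrier G" "g' \<in> carrier G" "h' \<in> carrier G" "y \<in> carrier G" for g h g' h' y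
  proof -
    have "(\<Sum>a\<in>carrier G. \<Sum>b\<in>carrier G. C (inv a \<otimes> g) h * C (inv b \<otimes> g') h' * gconv (C a) (C b) y)
      = (\<Sum>a\<in>carrier G. \<Sum>b\<in>carrier G.
          gconv (\<lambda>x. C (inv a \<otimes> g) h * C a x) (\<lambda>x. C (inv b \<otimes> g') h' * C b x) y)"
      by (simp add: gconv_def sum_distrib_left mult_ac)
    also have "\<dots> = gconv (\<lambda>x. if x = h then C g h else 0) (\<lambda>x. if x = h' then C g' h' else 0) y"
      unfolding sum_gconv[OF fin] by (rule gconv_cong) (use that expand in auto)
    finally show ?thesis using that fin by (simp add: gconv_delta_left)
  qed
  \<comment> \<open>The product of the two terms is read at the coordinate h1 h2. In one order it is
    C(g1,h1) C(g2,h2), hence nonzero; in the other it can be nonzero only if h1 h2 = h2 h1.\<close>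
  let ?y = "h1 \<otimes> h2"
  have "C g1 h1 * C g2 h2 = (\<Sum>a\<in>carrier G. \<Sum>b\<in>carrier G.
      C (inv a \<otimes> g1) h1 * C (inv b \<otimes> g2) h2 * gconv (C a) (C b) ?y)"
    using c by (subst prod) (simp_all add: m_assoc[symmetric])
  also have "\<dots> = (\<Sum>a\<in>carrier G. \<Sum>b\<in>carrier G.
      C (inv b \<otimes> g2) h2 * C (inv a \<otimes> g1) h1 * gconv (C b) (C a) ?y)"
    using c by (intro sum.cong refl) (auto simp: mult)
  also have "\<dots> = (\<Sum>b\<in>carrier G. \<Sum>a\<in>carrier G.
      C (inv b \<otimes> g2) h2 * C (inv a \<otimes> g1) h1 * gconv (C b) (C a) ?y)"
    by (rule sum.swap)
  also have "\<dots> = C g2 h2 * (if inv h2 \<otimes> ?y = h1 then C g1 h1 else 0)"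
    using c by (subst prod) simp_all
  finally have "inv h2 \<otimes> ?y = h1"
    using nz by (auto split: if_splits)
  thus ?thesis using c by (metis inv_solve_left m_closed)
qed

text \<open>Take a root of 1 + x + ... + x^(n-1). It is not 1, because the value at 1 is n, which is
  nonzero in characteristic 0.\<close>

lemma nontrivial_root_of_unity_exists:
  assumes "n > 1"
  obtains \<omega> :: "'k::{alg_closed_field, field_char_0}" where "\<omega> ^ n = 1" "\<omega> \<noteq> 1"
proof -
  obtain x :: 'k where x: "(\<Sum>k\<le>n - 1. 1 * x ^ k) = 0"
    using alg_closed[of "n - 1" "\<lambda>_. 1 :: 'k"] assms by auto
  have s: "{..n - 1} = {..<n}" using assms by auto
  have "(x - 1) * (\<Sum>k<n. x ^ k) = x ^ n - 1"
    using power_diff_1_eq[of x n] by simp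
  moreover have z: "(\<Sum>k<n. x ^ k) = 0" using x unfolding s by simp
  ultimately have "x ^ n = 1" by simp
  moreover have "x \<noteq> 1" using z assms by auto
  ultimately show thesis using that by blast
qed

lemma power_mod_eq:
  fixes \<omega> :: "'k::field"
  assumes "\<omega> ^ n = 1"
  shows "\<omega> ^ (m mod n) = \<omega> ^ m"
proof -
  have "\<omega> ^ m = \<omega> ^ (n * (m div n) + m mod n)" by simp
  also have "\<dots> = \<omega> ^ (m mod n)"
    by (simp only: power_add power_mult assms power_one mult_1_left)
  finally show ?thesis by simp
qed

text \<open>For \<omega>^n = 1 this is the additive character of \<int>/n with value \<omega> at 1.
  The exponent is reduced modulo n because negative exponents occur in the Fourier
  inversion.\<close>

definition zpow :: "nat \<Rightarrow> 'k::field \<Rightarrow> int \<Rightarrow> 'k" where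
  "zpow n \<omega> z = \<omega> ^ nat (z mod int n)"

lemma zpow_0 [simp]: "zpow n \<omega> 0 = 1"
  by (simp add: zpow_def)

lemma zpow_cong: "z mod int n = w mod int n \<Longrightarrow> zpow n \<omega> z = zpow n \<omega> w"
  by (simp add: zpow_def)

lemma zpow_add:
  assumes "\<omega> ^ n = 1" "n > 0"
  shows "zpow n \<omega> (z + w) = zpow n \<omega> z * zpow n \<omega> w"
proof -
  have "nat ((z + w) mod int n) = (nat (z mod int n) + nat (w mod int n)) mod n"
  proof -
    have "nat ((z + w) mod int n) = nat ((z mod int n + w mod int n) mod int n)"
      by (simp add: mod_add_eq)
    also have "\<dots> = nat (z mod int n + w mod int n) mod nat (int n)"
      using assms(2) by (intro nat_mod_distrib) auto
    also have "nat (z mod int n + w mod int n) = nat (z mod int n) + nat (w mod int n)"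
      using assms(2) by (intro nat_add_distrib) auto
    finally show ?thesis by simp
  qed
  thus ?thesis using power_mod_eq[OF assms(1)] by (simp add: zpow_def power_add)
qed

lemma zpow_of_nat:
  assumes "\<omega> ^ n = 1"
  shows "zpow n \<omega> (int m) = \<omega> ^ m"
proof -
  have "nat (int m mod int n) = m mod n" by (metis nat_int zmod_int)
  thus ?thesis using power_mod_eq[OF assms] by (simp add: zpow_def)
qed

lemma carrier_Z: "n > 0 \<Longrightarrow> carrier (integer_mod_group n) = {0..<int n}"
  by (simp add: carrier_integer_mod_group)

lemma Z_diff:
  assumes "n > 0" "x \<in> {0..<int n}"
  shows "inv\<^bsub>integer_mod_group n\<^esub> x \<otimes>\<^bsub>integer_mod_group n\<^esub> y = (y - x) mod int n"
  using assms by (simp add: carrier_Z mod_add_left_eq)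

text \<open>Orthogonality of characters. As p is prime, a nonzero x has c0 with c0 x = 1 modulo p,
  and translating the index by c0 multiplies the sum by \<omega>, which differs from 1.\<close>

lemma sum_zpow:
  fixes \<omega> :: "'k::field"
  assumes p: "prime p" and \<omega>: "\<omega> ^ p = 1" "\<omega> \<noteq> 1" and x: "x \<in> {0..<int p}"
  shows "(\<Sum>c\<in>{0..<int p}. zpow p \<omega> (c * x)) = (if x = 0 then of_nat p else 0)"
proof (cases "x = 0")
  case False
  have p0: "p > 0" using p prime_gt_0_nat by blast
  interpret Z: group "integer_mod_group p" by simp
  have "coprime x (int p)"
    using p x False by (metis atLeastLessThan_iff coprime_commute linorder_not_le order_le_less prime_imp_coprime prime_nat_int_transfer zdvd_imp_le)
  then obtain d where d: "[x * d = 1] (mod int p)"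
    using cong_solve_coprime_int by blast
  define c0 where "c0 = d mod int p"
  have c0: "c0 \<in> {0..<int p}" using p0 by (simp add: c0_def)
  have "(c0 * x) mod int p = 1 mod int p"
    using d by (simp add: c0_def cong_def mult.commute mod_mult_right_eq)
  hence E1: "zpow p \<omega> (c0 * x) = \<omega>"
    using zpow_cong[of "c0 * x" p 1 \<omega>] zpow_of_nat[OF \<omega>(1), of 1] by simp
  let ?S = "\<Sum>c\<in>{0..<int p}. zpow p \<omega> (c * x)"
  have "?S = (\<Sum>c\<in>{0..<int p}. zpow p \<omega> (((c0 + c) mod int p) * x))"
    using Z.sum_left_translate[of c0 "\<lambda>c. zpow p \<omega> (c * x)"] c0 p0 by (simp add: carrier_Z)
  also have "\<dots> = (\<Sum>c\<in>{0..<int p}. \<omega> * zpow p \<omega> (c * x))"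
  proof (rule sum.cong[OF refl])
    fix c
    have "zpow p \<omega> (((c0 + c) mod int p) * x) = zpow p \<omega> (c0 * x + c * x)"
      by (rule zpow_cong) (simp add: mod_mult_left_eq distrib_right)
    thus "zpow p \<omega> (((c0 + c) mod int p) * x) = \<omega> * zpow p \<omega> (c * x)"
      by (simp add: zpow_add[OF \<omega>(1) p0] E1)
  qed
  also have "\<dots> = \<omega> * ?S" by (rule sum_distrib_left[symmetric])
  finally have "?S = \<omega> * ?S" .
  hence "(1 - \<omega>) * ?S = 0" by (simp add: algebra_simps)
  thus ?thesis using \<omega>(2) False by simp
qed simp

lemma idempotent_pairing_Zp_trivial:
  fixes C :: "int \<Rightarrow> int \<Rightarrow> 'k::{alg_closed_field, field_char_0}" and t :: int and p :: nat
  defines "gconv \<equiv> group.gconv (integer_mod_group p)"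
  assumes p: "prime p" and t: "coprime t (int p)" "\<not> [t * t = 1] (mod int p)"
    and mult: "\<And>x x' y. x \<in> {0..<int p} \<Longrightarrow> x' \<in> {0..<int p} \<Longrightarrow> y \<in> {0..<int p} \<Longrightarrow>
      gconv (C x) (C x') y = (if x = x' then C x y else 0)"
    and comult: "\<And>x y y'. x \<in> {0..<int p} \<Longrightarrow> y \<in> {0..<int p} \<Longrightarrow> y' \<in> {0..<int p} \<Longrightarrow>
      gconv (\<lambda>x. C x y) (\<lambda>x. C x y') x = (if y = y' then C x y else 0)"
    and invariant: "\<And>x y. x \<in> {0..<int p} \<Longrightarrow> y \<in> {0..<int p} \<Longrightarrow>
      C ((t * x) mod int p) ((t * y) mod int p) = C x y"
    and unit: "\<And>y. y \<in> {0..<int p} \<Longrightarrow> (\<Sum>x\<in>{0..<int p}. C x y) = (if y = 0 then 1 else 0)"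
    and counit: "\<And>x. x \<in> {0..<int p} \<Longrightarrow> (\<Sum>y\<in>{0..<int p}. C x y) = (if x = 0 then 1 else 0)"
    and xy: "x \<in> {0..<int p}" "y \<in> {0..<int p}"
  shows "C x y = (if x = 0 \<and> y = 0 then 1 else 0)"
proof -
  have p0: "p > 0" using p prime_gt_0_nat by blast
  interpret Z: group "integer_mod_group p" by simp
  let ?Z = "{0..<int p}"
  have car: "carrier (integer_mod_group p) = ?Z" using p0 by (simp add: carrier_Z)
  have fin: "finite (carrier (integer_mod_group p))" by (simp add: car)
  have md: "z mod int p \<in> ?Z" for z using p0 by simp
  obtain \<omega> :: 'k where \<omega>: "\<omega> ^ p = 1" "\<omega> \<noteq> 1"
    using nontrivial_root_of_unity_exists[of p] p prime_gt_1_nat by blast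
  define E where "E = zpow p \<omega>"
  have E_add: "E (z + w) = E z * E w" for z w unfolding E_def by (rule zpow_add[OF \<omega>(1) p0])
  have E_cong: "z mod int p = w mod int p \<Longrightarrow> E z = E w" for z w unfolding E_def by (rule zpow_cong)
  \<comment> \<open>\<open>\<Phi> c x\<close> is the pairing of e_x with the character y \<mapsto>
    \<omega>^(c y), written in the basis of the e_y.\<close>
  define \<Phi> where "\<Phi> c x = (\<Sum>y\<in>?Z. C x y * E (c * y))" for c x
  have orth: "\<Phi> c x * \<Phi> c x' = (if x = x' then \<Phi> c x else 0)" if "x \<in> ?Z" "x' \<in> ?Z" for c x x'
  proof -
    have "\<Phi> c x * \<Phi> c x' = (\<Sum>y\<in>?Z. gconv (\<lambda>y. C x y * E (c * y)) (\<lambda>y. C x' y * E (c * y)) y)"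
      using Z.sum_gconv_total[OF fin, of "\<lambda>y. C x y * E (c * y)" "\<lambda>y. C x' y * E (c * y)"]
      by (simp add: car \<Phi>_def gconv_def)
    also have "\<dots> = (\<Sum>y\<in>?Z. gconv (C x) (C x') y * E (c * y))"
    proof (rule sum.cong[OF refl])
      fix y assume "y \<in> ?Z"
      \<comment> \<open>A character is multiplicative along each factorisation, so weighting both
        factors by it weights their convolution by it. This makes \<open>\<Phi> c\<close> a
        character of the functions on \<int>/p.\<close>
      have "E (c * h) * E (c * ((y - h) mod int p)) = E (c * y)" for h
        unfolding E_add[symmetric]
      proof (rule E_cong)
        have "(c * h + c * ((y - h) mod int p)) mod int p = (c * h + c * (y - h)) mod int p"
          by (metis mod_add_right_eq mod_mult_right_eq)
        thus "(c * h + c * ((y - h) mod int p)) mod int p = (c * y) mod int p"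
          by (simp add: algebra_simps)
      qed
      thus "gconv (\<lambda>y. C x y * E (c * y)) (\<lambda>y. C x' y * E (c * y)) y = gconv (C x) (C x') y * E (c * y)"
        unfolding gconv_def Z.gconv_def sum_distrib_right car
        using p0 by (intro sum.cong) (auto simp: Z_diff mult.assoc mult.left_commute simp del: mult_integer_mod_group)
    qed
    also have "\<dots> = (if x = x' then \<Phi> c x else 0)"
      using that by (simp add: mult \<Phi>_def)
    finally show ?thesis .
  qed
  have one: "sum (\<Phi> c) ?Z = 1" for c
  proof -
    have "sum (\<Phi> c) ?Z = (\<Sum>y\<in>?Z. (\<Sum>x\<in>?Z. C x y) * E (c * y))"
      unfolding \<Phi>_def sum_distrib_right by (rule sum.swap)
    also have "\<dots> = (\<Sum>y\<in>?Z. if y = 0 then 1 else 0)"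
      by (rule sum.cong) (auto simp: unit E_def)
    finally show ?thesis using p0 by simp
  qed
  have "\<exists>a\<in>?Z. \<forall>x\<in>?Z. \<Phi> c x = (if x = a then 1 else 0)" for c
    by (rule orthogonal_idempotents_field) (use orth one in auto)
  then have "\<exists>\<phi>. \<forall>c. \<phi> c \<in> ?Z \<and> (\<forall>x\<in>?Z. \<Phi> c x = (if x = \<phi> c then 1 else 0))"
    by (intro choice) blast
  then obtain \<phi> where \<phi>: "\<And>c. \<phi> c \<in> ?Z" "\<And>c x. x \<in> ?Z \<Longrightarrow> \<Phi> c x = (if x = \<phi> c then 1 else 0)"
    by blast
  \<comment> \<open>Orthogonality in the second variable turns the pointwise product of two
    characters into a convolution of their pairings. As \<open>\<Phi> c'\<close> is concentrated at
    \<open>\<phi> c'\<close>, that convolution is a translation.\<close>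
  have \<Phi>_add: "\<Phi> (c' + c) x = \<Phi> c ((x - \<phi> c') mod int p)" if x: "x \<in> ?Z" for c c' x
  proof -
    have "\<Phi> c ((x - \<phi> c') mod int p) = gconv (\<lambda>x. if x = \<phi> c' then 1 else 0) (\<Phi> c) x"
      using Z.gconv_delta_left[OF fin, of "\<phi> c'" 1 "\<Phi> c" x] \<phi>(1)[of c']
      by (simp add: gconv_def car Z_diff[OF p0 \<phi>(1)] del: mult_integer_mod_group inv_integer_mod_group)
    also have "\<dots> = gconv (\<Phi> c') (\<Phi> c) x"
      unfolding gconv_def by (rule Z.gconv_cong) (use \<phi> x in \<open>auto simp: car\<close>)
    also have "\<dots> = (\<Sum>y'\<in>?Z. \<Sum>y\<in>?Z. gconv (\<lambda>x. C x y' * E (c' * y')) (\<lambda>x. C x y * E (c * y)) x)"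
      unfolding gconv_def \<Phi>_def by (rule Z.sum_gconv[symmetric]) simp
    also have "\<dots> = (\<Sum>y'\<in>?Z. \<Sum>y\<in>?Z. if y' = y then C x y * E ((c' + c) * y) else 0)"
    proof (intro sum.cong refl)
      fix y' y assume y: "y' \<in> ?Z" "y \<in> ?Z"
      have "gconv (\<lambda>x. C x y' * E (c' * y')) (\<lambda>x. C x y * E (c * y)) x
        = gconv (\<lambda>x. C x y') (\<lambda>x. C x y) x * (E (c' * y') * E (c * y))"
        unfolding gconv_def Z.gconv_def sum_distrib_right by (intro sum.cong) (auto simp: mult_ac)
      thus "gconv (\<lambda>x. C x y' * E (c' * y')) (\<lambda>x. C x y * E (c * y)) x
        = (if y' = y then C x y * E ((c' + c) * y) else 0)"
        using x y by (simp add: comult E_add distrib_right)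
    qed
    also have "\<dots> = \<Phi> (c' + c) x" by (simp add: \<Phi>_def)
    finally show ?thesis by simp
  qed
  have \<phi>_add: "\<phi> (c' + c) = (\<phi> c' + \<phi> c) mod int p" for c c'
  proof -
    let ?x = "(\<phi> c' + \<phi> c) mod int p"
    have "(?x - \<phi> c') mod int p = \<phi> c"
      using \<phi>(1)[of c] by (simp add: mod_diff_left_eq)
    hence "\<Phi> (c' + c) ?x = 1" using \<Phi>_add[OF md] \<phi> by simp
    thus ?thesis using \<phi>(2)[OF md] by (metis zero_neq_one)
  qed
  have \<phi>_0: "\<phi> 0 = 0"
  proof -
    have "\<Phi> 0 0 = 1" using counit[of 0] p0 by (simp add: \<Phi>_def E_def)
    thus ?thesis using \<phi>(2)[of 0 0] p0 by (auto split: if_splits)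
  qed
  have \<phi>_mult: "\<phi> (int n * c) = (int n * \<phi> c) mod int p" for n c
  proof (induction n)
    case (Suc n)
    have "\<phi> (int (Suc n) * c) = \<phi> (c + int n * c)" by (simp add: distrib_right)
    also have "\<dots> = (\<phi> c + (int n * \<phi> c) mod int p) mod int p" by (simp add: \<phi>_add Suc)
    finally show ?case by (simp add: mod_add_right_eq distrib_right)
  qed (simp add: \<phi>_0)
  \<comment> \<open>\<open>\<phi>_mult\<close> takes a natural multiplier, so the integer
    \<open>t\<close> is replaced by its residue.\<close>
  define t' where "t' = nat (t mod int p)"
  have t': "int t' = t mod int p" using p0 by (simp add: t'_def)
  have bij: "bij_betw (\<lambda>y. (t * y) mod int p) ?Z ?Z"
  proof -
    have "inj_on (\<lambda>y. (t * y) mod int p) ?Z"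
    proof (rule inj_onI)
      fix u v assume u: "u \<in> ?Z" "v \<in> ?Z" and "(t * u) mod int p = (t * v) mod int p"
      hence "[t * u = t * v] (mod int p)" by (simp add: cong_def)
      hence "[u = v] (mod int p)" using t(1) by (simp add: cong_mult_lcancel)
      thus "u = v" using u by (simp add: cong_def)
    qed
    moreover have "(\<lambda>y. (t * y) mod int p) ` ?Z \<subseteq> ?Z" using md by blast
    ultimately show ?thesis
      by (simp add: bij_betw_def endo_inj_surj)
  qed
  \<comment> \<open>The substitution y \<mapsto> t y, together with the invariance of
    \<open>C\<close>, moves the factor t from the point to the character.\<close>
  have \<Phi>_t: "\<Phi> c ((t * x) mod int p) = \<Phi> (int t' * c) x" if "x \<in> ?Z" for c x
  proof -
    have "\<Phi> c ((t * x) mod int p) = (\<Sum>y\<in>?Z. C ((t * x) mod int p) ((t * y) mod int p) * E (c * ((t * y) mod int p)))"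
      unfolding \<Phi>_def by (rule sum.reindex_bij_betw[OF bij, symmetric])
    also have "\<dots> = \<Phi> (int t' * c) x"
      unfolding \<Phi>_def
    proof (rule sum.cong[OF refl])
      fix y assume "y \<in> ?Z"
      moreover have "E (c * ((t * y) mod int p)) = E (int t' * c * y)"
        unfolding t' by (rule E_cong) (metis mod_mult_left_eq mod_mult_right_eq mult.assoc mult.commute)
      ultimately show "C ((t * x) mod int p) ((t * y) mod int p) * E (c * ((t * y) mod int p))
        = C x y * E (int t' * c * y)"
        using that by (simp add: invariant)
    qed
    finally show ?thesis .
  qed
  have "\<phi> c = 0" for c
  proof -
    have "\<Phi> c ((t * \<phi> (int t' * c)) mod int p) = 1"
      using \<Phi>_t[OF \<phi>(1)] \<phi> by simp
    hence "\<phi> c = (t * \<phi> (int t' * c)) mod int p"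
      using \<phi>(2)[OF md] by (metis zero_neq_one)
    also have "\<dots> = (t * t * \<phi> c) mod int p"
      unfolding \<phi>_mult unfolding t' by (simp add: mod_mult_left_eq mod_mult_right_eq mult.assoc)
    finally have "(t * t * \<phi> c) mod int p = \<phi> c mod int p"
      by (metis mod_mod_trivial)
    hence "int p dvd t * t * \<phi> c - \<phi> c" by (simp add: mod_eq_dvd_iff)
    also have "t * t * \<phi> c - \<phi> c = (t * t - 1) * \<phi> c" by (simp add: algebra_simps)
    finally have "int p dvd t * t - 1 \<or> int p dvd \<phi> c"
      using p by (simp add: prime_dvd_mult_iff)
    moreover have "\<not> int p dvd t * t - 1" using t(2) by (simp add: cong_iff_dvd_diff)
    ultimately show ?thesis
      using \<phi>(1)[of c] by (metis atLeastLessThan_iff linorder_not_le order_le_less zdvd_imp_le)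
  qed
  hence \<Phi>: "\<Phi> c x = (if x = 0 then 1 else 0)" for c using \<phi>(2)[OF xy(1)] by simp
  \<comment> \<open>Fourier inversion: this sum is p C(x,y). Evaluating it with the trivial \<phi>
    determines \<open>C\<close>, since p is nonzero in the field.\<close>
  have "(\<Sum>c\<in>?Z. \<Phi> c x * E (c * (- y))) = (\<Sum>c\<in>?Z. \<Sum>z\<in>?Z. C x z * E (c * ((z - y) mod int p)))"
    unfolding \<Phi>_def sum_distrib_right
  proof (intro sum.cong refl)
    fix c z
    have "E (c * z) * E (c * (- y)) = E (c * ((z - y) mod int p))"
      unfolding E_add[symmetric] by (rule E_cong) (simp add: mod_mult_right_eq algebra_simps)
    thus "C x z * E (c * z) * E (c * (- y)) = C x z * E (c * ((z - y) mod int p))"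
      by (simp add: mult.assoc)
  qed
  also have "\<dots> = (\<Sum>z\<in>?Z. C x z * (\<Sum>c\<in>?Z. E (c * ((z - y) mod int p))))"
    unfolding sum_distrib_left by (rule sum.swap)
  also have "\<dots> = (\<Sum>z\<in>?Z. if z = y then C x z * of_nat p else 0)"
  proof (rule sum.cong[OF refl])
    fix z assume z: "z \<in> ?Z"
    have "(z - y) mod int p = 0 \<longleftrightarrow> z = y"
      using z xy(2) by (metis mod_eq_dvd_iff dvd_eq_mod_eq_0 mod_pos_pos_trivial atLeastLessThan_iff)
    thus "C x z * (\<Sum>c\<in>?Z. E (c * ((z - y) mod int p))) = (if z = y then C x z * of_nat p else 0)"
      unfolding E_def by (subst sum_zpow[OF p \<omega> md]) auto
  qed
  also have "\<dots> = C x y * of_nat p" using xy by simp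
  finally have "C x y * of_nat p = (\<Sum>c\<in>?Z. \<Phi> c x * E (c * (- y)))" ..
  also have "\<dots> = (if x = 0 then \<Sum>c\<in>?Z. E (c * ((- y) mod int p)) else 0)"
  proof -
    have "E (c * (- y)) = E (c * ((- y) mod int p))" for c
      by (rule E_cong) (simp add: mod_mult_right_eq)
    thus ?thesis by (simp add: \<Phi>)
  qed
  also have "\<dots> = (if x = 0 \<and> y = 0 then of_nat p else 0)"
  proof -
    have "(- y) mod int p = 0 \<longleftrightarrow> y = 0"
      using xy(2) by (metis add.inverse_neutral atLeastLessThan_iff dvd_eq_mod_eq_0 dvd_minus_iff mod_0 mod_pos_pos_trivial)
    thus ?thesis unfolding E_def by (subst sum_zpow[OF p \<omega> md]) auto
  qed
  finally show ?thesis using p0 by (auto split: if_splits)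
qed

section \<open>Braiding structures on the first family\<close>

lemma cong_power_exponent:
  fixes t :: nat
  assumes "[t ^ n = 1] (mod p)" "[a = b] (mod n)"
  shows "[t ^ a = t ^ b] (mod p)"
proof -
  have *: "[t ^ (a mod n) = t ^ a] (mod p)" for a
  proof -
    have "[(t ^ n) ^ (a div n) * t ^ (a mod n) = 1 ^ (a div n) * t ^ (a mod n)] (mod p)"
      by (intro cong_mult cong_pow assms(1) cong_refl)
    moreover have "(t ^ n) ^ (a div n) * t ^ (a mod n) = t ^ a"
      by (simp flip: power_mult power_add)
    ultimately show ?thesis by (simp add: cong_sym)
  qed
  show ?thesis using *[of a] *[of b] assms(2) by (metis cong_def)
qed

text \<open>The order of t modulo p divides both exponents. It is the source of all nontriviality
  statements about powers of t and m below.\<close>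

lemma cong_power_one_coprime:
  fixes t :: nat
  assumes "[t ^ n = 1] (mod p)" "[t ^ m = 1] (mod p)" "coprime n m"
  shows "[t = 1] (mod p)"
proof -
  have "ord p t dvd n" "ord p t dvd m" using assms(1,2) unfolding ord_divides .
  hence "ord p t dvd 1" using assms(3) coprime_common_divisor by blast
  hence "[t ^ 1 = 1] (mod p)" by (simp only: ord_divides)
  thus ?thesis by simp
qed

lemma sum_snd_zero:
  fixes f :: "'a \<times> int \<Rightarrow> 'k::comm_monoid_add"
  assumes "q > 0" "\<And>a b. a \<in> A \<Longrightarrow> b \<in> {0..<q} \<Longrightarrow> b \<noteq> 0 \<Longrightarrow> f (a, b) = 0"
  shows "(\<Sum>c\<in>A \<times> {0..<q}. f c) = (\<Sum>a\<in>A. f (a, 0))"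
proof -
  have "(\<Sum>c\<in>A \<times> {0..<q}. f c) = (\<Sum>a\<in>A. \<Sum>b\<in>{0..<q}. f (a, b))"
    by (simp add: sum.cartesian_product)
  also have "\<dots> = (\<Sum>a\<in>A. \<Sum>b\<in>{0..<q}. if b = 0 then f (a, b) else 0)"
    using assms(2) by (intro sum.cong) auto
  also have "\<dots> = (\<Sum>a\<in>A. f (a, 0))" using assms(1) by simp
  finally show ?thesis .
qed

lemma mod_add_mult_right: "(x + a * (z mod m)) mod m = (x + a * z) mod (m :: int)"
  by (metis mod_add_right_eq mod_mult_right_eq)

locale nonabelian_pq =
  fixes p q t :: nat and k_itself :: "'k::{alg_closed_field, field_char_0} itself"
  assumes p: "prime p" and q: "prime q" and oddq: "odd q"
    and tq: "[t ^ q = 1] (mod p)" and t1: "\<not> [t = 1] (mod p)"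
begin

abbreviation G :: "(int \<times> int) monoid" where "G \<equiv> Zp_sd_Zq p q t"
abbreviation F :: "int monoid" where "F \<equiv> integer_mod_group q"
abbreviation T :: "int \<Rightarrow> int" where "T y \<equiv> int t ^ nat y"

definition act :: "int \<times> int \<Rightarrow> int \<Rightarrow> int \<times> int" where
  "act = (\<lambda>(x, y) n. ((T n * x) mod int p, y))"

lemma p0: "p > 0" "int p > 0" and q0: "q > 0" "int q > 0" and p1: "p > 1" and q1: "q > 1"
  using prime_gt_1_nat[OF p] prime_gt_1_nat[OF q] by simp_all

lemma carrier_G: "carrier G = {0..<int p} \<times> {0..<int q}"
  using p0 q0 by (simp add: Zp_sd_Zq_def semidirect_def carrier_integer_mod_group)

lemma carrier_F: "carrier F = {0..<int q}"
  using q0 by (simp add: carrier_integer_mod_group)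

lemma mult_G: "(x, y) \<otimes>\<^bsub>G\<^esub> (x', y') = ((x + T y * x') mod int p, (y + y') mod int q)"
  by (simp add: Zp_sd_Zq_def semidirect_def mod_add_right_eq)

lemma one_G: "\<one>\<^bsub>G\<^esub> = (0, 0)"
  by (simp add: Zp_sd_Zq_def semidirect_def)

lemma T_cong: "[T ((y + y') mod int q) = T y * T y'] (mod int p)" if "y \<ge> 0" "y' \<ge> 0"
proof -
  have n: "nat ((y + y') mod int q) = (nat y + nat y') mod q"
    using that by (simp add: nat_mod_distrib nat_add_distrib)
  have "[t ^ (n mod q) = t ^ n] (mod p)" for n
    by (rule cong_power_exponent[OF tq]) simp
  hence "[int (t ^ ((nat y + nat y') mod q)) = int (t ^ (nat y + nat y'))] (mod int p)"
    by (simp only: cong_int_iff)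
  thus ?thesis unfolding n by (simp add: power_add)
qed

lemma T_add: "y \<ge> 0 \<Longrightarrow> y' \<ge> 0 \<Longrightarrow> (T ((y + y') mod int q) * z) mod int p = (T y * T y' * z) mod int p"
  using cong_scalar_right[OF T_cong] by (simp add: cong_def)

lemma T_eq_one: "y = 0" if "[T y = 1] (mod int p)" "y \<in> {0..<int q}"
proof (rule ccontr)
  assume "y \<noteq> 0"
  hence "0 < nat y" "nat y < q" using that by auto
  hence "coprime (nat y) q"
    using q by (metis coprime_commute nat_dvd_not_less prime_imp_coprime_nat)
  moreover have "[t ^ nat y = 1] (mod p)"
    using that(1) by (metis cong_int_iff of_nat_1 of_nat_power)
  ultimately show False using cong_power_one_coprime tq t1 by blast
qed

lemma coprime_t: "coprime (int t) (int p)"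
proof -
  have "coprime (t ^ q) p" using tq by (metis cong_imp_coprime cong_sym coprime_1_left)
  thus ?thesis using q0 by simp
qed

lemma t_square: "\<not> [int t * int t = 1] (mod int p)"
proof
  assume "[int t * int t = 1] (mod int p)"
  hence "[t ^ 2 = 1] (mod p)" by (metis cong_int_iff of_nat_1 of_nat_mult power2_eq_square)
  thus False using cong_power_one_coprime[OF _ tq] t1 oddq by simp
qed

lemma group_G: "group G"
proof (rule groupI)
  show "x \<otimes>\<^bsub>G\<^esub> y \<in> carrier G" if "x \<in> carrier G" "y \<in> carrier G" for x y
    using p0 q0 by (cases x; cases y) (simp add: mult_G carrier_G)
  show "\<one>\<^bsub>G\<^esub> \<in> carrier G" using p0 q0 by (simp add: one_G carrier_G)
  show "x \<otimes>\<^bsub>G\<^esub> y \<otimes>\<^bsub>G\<^esub> z = x \<otimes>\<^bsub>G\<^esub> (y \<otimes>\<^bsub>G\<^esub> z)"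
    if "x \<in> carrier G" "y \<in> carrier G" "z \<in> carrier G" for x y z
  proof -
    obtain a b a' b' a'' b'' where e: "x = (a, b)" "y = (a', b')" "z = (a'', b'')"
      by (metis surj_pair)
    have b: "b \<ge> 0" "b' \<ge> 0" using that by (simp_all add: e carrier_G)
    have "((a + T b * a') mod int p + T ((b + b') mod int q) * a'') mod int p
      = ((a + T b * a') + (T ((b + b') mod int q) * a'') mod int p) mod int p"
      by (simp add: mod_simps)
    also have "\<dots> = (a + T b * ((a' + T b' * a'') mod int p)) mod int p"
      unfolding T_add[OF b] by (simp add: mod_add_right_eq mod_add_mult_right algebra_simps)
        (metis add.assoc mod_add_right_eq)
    finally show ?thesis
      by (simp add: e mult_G mod_simps add.assoc)
  qed
  show "\<one>\<^bsub>G\<^esub> \<otimes>\<^bsub>G\<^esub> x = x" if "x \<in> carrier G" for x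
    using that by (cases x) (simp add: one_G mult_G carrier_G)
  show "\<exists>y\<in>carrier G. y \<otimes>\<^bsub>G\<^esub> x = \<one>\<^bsub>G\<^esub>" if "x \<in> carrier G" for x
  proof -
    obtain a b where x: "x = (a, b)" by (metis surj_pair)
    let ?b = "(- b) mod int q"
    show ?thesis
      by (rule bexI[of _ "((- (T ?b * a)) mod int p, ?b)"])
        (use p0 q0 in \<open>simp_all add: x mult_G one_G carrier_G mod_simps\<close>)
  qed
qed

text \<open>The relation b a b^(-1) = a^t makes the action of g^f on G the conjugation by b^f, and b
  itself is fixed by both.\<close>

sublocale ab_ext_inner G F act k_itself "\<lambda>f. (0, f)"
proof -
  interpret G: group G by (rule group_G)
  interpret F: comm_group F by simp
  \<comment> \<open>Some field has to be named to use the facts of the locale. Its assumptions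
    concern G, F and the action, so the rationals serve.\<close>
  interpret ab_ext_untwisted G F act "TYPE(rat)"
  proof
    show "finite (carrier G)" "finite (carrier F)" by (simp_all add: carrier_G carrier_F)
    show "act g f \<in> carrier G" if "g \<in> carrier G" for g f
      using that p0 by (cases g) (simp add: act_def carrier_G)
    show "act g \<one>\<^bsub>F\<^esub> = g" if "g \<in> carrier G" for g
      using that by (cases g) (simp add: act_def carrier_G)
    show "act (act g f) f' = act g (f \<otimes>\<^bsub>F\<^esub> f')"
      if "g \<in> carrier G" "f \<in> carrier F" "f' \<in> carrier F" for g f f'
      using that by (cases g) (simp add: act_def carrier_F T_add mod_mult_right_eq mult.assoc mult.left_commute)
  qed
  show "ab_ext_inner G F act (\<lambda>f. (0, f))"
  proof
    show s: "(0, f) \<in> carrier G" if "f \<in> carrier F" for f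
      using that p0 by (simp add: carrier_G carrier_F)
    show "(0, f \<otimes>\<^bsub>F\<^esub> f') = (0, f) \<otimes>\<^bsub>G\<^esub> (0, f')" for f f'
      by (simp add: mult_G)
    show "act g f = (0, f) \<otimes>\<^bsub>G\<^esub> g \<otimes>\<^bsub>G\<^esub> inv\<^bsub>G\<^esub> (0, f)" if "g \<in> carrier G" "f \<in> carrier F" for g f
    proof -
      have "act g f \<otimes>\<^bsub>G\<^esub> (0, f) = (0, f) \<otimes>\<^bsub>G\<^esub> g"
        by (cases g) (simp add: act_def mult_G add.commute)
      thus ?thesis using that s by (metis G.inv_solve_right G.m_closed act_closed)
    qed
    show "z = \<one>\<^bsub>G\<^esub>" if z: "z \<in> carrier G" and c: "\<And>u. u \<in> carrier G \<Longrightarrow> z \<otimes>\<^bsub>G\<^esub> u = u \<otimes>\<^bsub>G\<^esub> z" for z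
    proof -
      obtain x y where e: "z = (x, y)" by (metis surj_pair)
      \<comment> \<open>Commuting with a gives t^y = 1 modulo p, hence y = 0. Commuting with b then
        gives (t - 1) x = 0, hence x = 0.\<close>
      have "(x + T y) mod int p = (1 + x) mod int p"
        using c[of "(1, 0)"] p1 q0 by (simp add: e mult_G carrier_G)
      hence "[x + T y = x + 1] (mod int p)" by (simp add: cong_def add.commute)
      hence "[T y = 1] (mod int p)" by (simp only: cong_add_lcancel)
      hence y: "y = 0" using T_eq_one z by (simp add: e carrier_G)
      have "x mod int p = (int t * x) mod int p"
        using c[of "(0, 1)"] p0 q1 by (simp add: e mult_G carrier_G)
      hence "int p dvd int t * x - x" by (metis mod_eq_dvd_iff)
      also have "int t * x - x = (int t - 1) * x" by (simp add: algebra_simps)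
      finally have "int p dvd int t - 1 \<or> int p dvd x"
        using p by (simp add: prime_dvd_mult_iff)
      moreover have "\<not> int p dvd int t - 1"
        using t1 by (metis cong_iff_dvd_diff cong_int_iff of_nat_1)
      ultimately have "x = 0"
        using z by (auto simp: e carrier_G dest: zdvd_imp_le)
      with y show ?thesis by (simp add: e one_G)
    qed
  qed
qed

end

section \<open>Triviality of the pairing on the functions on G, and the classification for the first
  family\<close>

context nonabelian_pq begin

text \<open>If a^x b^y lies in the support, so does its conjugate by a, which is \<open>?h\<close>.
  The two must commute, and comparing their products leaves (t^y - 1)^2 = 0 modulo p, so t^y = 1 and
  y = 0.\<close>

lemma conj_invariant_support:
  fixes C :: "int \<times> int \<Rightarrow> int \<times> int \<Rightarrow> 'k"
  assumes mult: "\<And>g g' h. g \<in> carrier G \<Longrightarrow> g' \<in> carrier G \<Longrightarrow> h \<in> carrier G \<Longrightarrow>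
      G.gconv (C g) (C g') h = (if g = g' then C g h else 0)"
    and comult: "\<And>g h h'. g \<in> carrier G \<Longrightarrow> h \<in> carrier G \<Longrightarrow> h' \<in> carrier G \<Longrightarrow>
      G.gconv (\<lambda>g. C g h) (\<lambda>g. C g h') g = (if h = h' then C g h else 0)"
    and conj: "\<And>g h u. g \<in> carrier G \<Longrightarrow> h \<in> carrier G \<Longrightarrow> u \<in> carrier G \<Longrightarrow>
      C (inv\<^bsub>G\<^esub> u \<otimes>\<^bsub>G\<^esub> g \<otimes>\<^bsub>G\<^esub> u) (inv\<^bsub>G\<^esub> u \<otimes>\<^bsub>G\<^esub> h \<otimes>\<^bsub>G\<^esub> u) = C g h"
    and g: "g \<in> carrier G" and h: "h \<in> carrier G" and nz: "C g h \<noteq> 0"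
  shows "snd h = 0"
proof -
  obtain x y where e: "h = (x, y)" by (metis surj_pair)
  have xy: "x \<in> {0..<int p}" "y \<in> {0..<int q}" using h by (auto simp: e carrier_G)
  let ?u = "(1, 0) :: int \<times> int" and ?h = "((x - 1 + T y) mod int p, y)"
  have u: "?u \<in> carrier G" using p1 q0 by (simp add: carrier_G)
  have h': "?h \<in> carrier G" using p0 xy by (simp add: carrier_G)
  have "?u \<otimes>\<^bsub>G\<^esub> ?h = h \<otimes>\<^bsub>G\<^esub> ?u"
    by (simp add: e mult_G mod_simps algebra_simps)
  hence "?h = inv\<^bsub>G\<^esub> ?u \<otimes>\<^bsub>G\<^esub> h \<otimes>\<^bsub>G\<^esub> ?u"
    using u h h' by (simp add: G.m_assoc G.inv_solve_left)
  hence nz': "C (inv\<^bsub>G\<^esub> ?u \<otimes>\<^bsub>G\<^esub> g \<otimes>\<^bsub>G\<^esub> ?u) ?h \<noteq> 0"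
    using conj[OF g h u] nz by simp
  have "h \<otimes>\<^bsub>G\<^esub> ?h = ?h \<otimes>\<^bsub>G\<^esub> h"
    by (rule G.idempotent_pairing_support_commute[OF fin_G mult comult g h _ h' nz nz'])
      (use g u in auto)
  hence "(x + T y * (x - 1 + T y)) mod int p = (x - 1 + T y + T y * x) mod int p"
    by (simp add: e mult_G mod_add_left_eq mod_add_mult_right)
  hence "int p dvd (x + T y * (x - 1 + T y)) - (x - 1 + T y + T y * x)"
    by (simp add: mod_eq_dvd_iff)
  also have "(x + T y * (x - 1 + T y)) - (x - 1 + T y + T y * x) = (T y - 1) * (T y - 1)"
    by (simp add: algebra_simps)
  finally have "int p dvd T y - 1"
    using p by (simp add: prime_dvd_mult_iff)
  hence "[T y = 1] (mod int p)" by (simp add: cong_iff_dvd_diff)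
  with T_eq_one xy show ?thesis by (simp add: e)
qed

text \<open>It is enough that the left factor is supported on the powers of a: at a power of a the
  right factor is then evaluated only at powers of a.\<close>

lemma gconv_first_factor:
  assumes v: "\<And>a b. (a, b) \<in> carrier G \<Longrightarrow> b \<noteq> 0 \<Longrightarrow> v (a, b) = 0" and x: "x \<in> {0..<int p}"
  shows "G.gconv v w (x, 0) = group.gconv (integer_mod_group p) (\<lambda>x. v (x, 0)) (\<lambda>x. w (x, 0)) x"
proof -
  interpret Z: group "integer_mod_group p" by simp
  have "G.gconv v w (x, 0) = (\<Sum>a\<in>{0..<int p}. v (a, 0) * w (inv\<^bsub>G\<^esub> (a, 0) \<otimes>\<^bsub>G\<^esub> (x, 0)))"
    unfolding G.gconv_def carrier_G
    by (rule sum_snd_zero) (use q0 v in \<open>auto simp: carrier_G\<close>)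
  also have "\<dots> = (\<Sum>a\<in>{0..<int p}. v (a, 0) * w ((x - a) mod int p, 0))"
  proof (rule sum.cong[OF refl])
    fix a assume a: "a \<in> {0..<int p}"
    have "(a, 0) \<otimes>\<^bsub>G\<^esub> ((x - a) mod int p, 0) = (x, 0)"
      using x by (simp add: mult_G mod_simps)
    hence "((x - a) mod int p, 0) = inv\<^bsub>G\<^esub> (a, 0) \<otimes>\<^bsub>G\<^esub> (x, 0)"
      using a x p0 q0 by (intro G.inv_solve_left[THEN iffD2]) (auto simp: carrier_G)
    thus "v (a, 0) * w (inv\<^bsub>G\<^esub> (a, 0) \<otimes>\<^bsub>G\<^esub> (x, 0)) = v (a, 0) * w ((x - a) mod int p, 0)"
      by simp
  qed
  also have "\<dots> = Z.gconv (\<lambda>x. v (x, 0)) (\<lambda>x. w (x, 0)) x"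
    unfolding Z.gconv_def carrier_Z[OF p0(1)]
    by (intro sum.cong refl) (simp add: Z_diff p0 del: mult_integer_mod_group inv_integer_mod_group)
  finally show ?thesis .
qed

lemma braiding_on_functions_trivial:
  assumes B: "is_braiding B" and inv: "conv_inverse B \<Psi>"
    and g: "g \<in> carrier G" and h: "h \<in> carrier G"
  shows "B g \<one>\<^bsub>F\<^esub> h \<one>\<^bsub>F\<^esub> = (if g = \<one>\<^bsub>G\<^esub> \<and> h = \<one>\<^bsub>G\<^esub> then 1 else 0)"
proof -
  define C where "C g h = B g \<one>\<^bsub>F\<^esub> h \<one>\<^bsub>F\<^esub>" for g h
  have mult: "G.gconv (C g) (C g') h = (if g = g' then C g h else 0)"
    if "g \<in> carrier G" "g' \<in> carrier G" "h \<in> carrier G" for g g' h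
    using braiding_mult_left[OF B that(1) F.one_closed that(2) F.one_closed that(3) F.one_closed] that
    unfolding C_def by (simp del: one_integer_mod_group mult_integer_mod_group)
  have comult: "G.gconv (\<lambda>g. C g h) (\<lambda>g. C g h') g = (if h = h' then C g h else 0)"
    if "g \<in> carrier G" "h \<in> carrier G" "h' \<in> carrier G" for g h h'
    using braiding_mult_right[OF B that(1) F.one_closed that(3) F.one_closed that(2) F.one_closed] that
    unfolding C_def by (auto simp del: one_integer_mod_group mult_integer_mod_group)
  \<comment> \<open>The third axiom at (g u, h u) with i = j = 1: the left side cancels to C(g,h)
    and the right side is the pairing of the conjugates.\<close>
  have conj: "C (inv\<^bsub>G\<^esub> u \<otimes>\<^bsub>G\<^esub> g \<otimes>\<^bsub>G\<^esub> u) (inv\<^bsub>G\<^esub> u \<otimes>\<^bsub>G\<^esub> h \<otimes>\<^bsub>G\<^esub> u) = C g h"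
    if "g \<in> carrier G" "h \<in> carrier G" "u \<in> carrier G" for g h u
    using braiding_commute[OF B, of "g \<otimes>\<^bsub>G\<^esub> u" "\<one>\<^bsub>F\<^esub>" "h \<otimes>\<^bsub>G\<^esub> u" "\<one>\<^bsub>F\<^esub>" u] that
    unfolding C_def by (simp add: G.m_assoc del: one_integer_mod_group)
  have supp_h: "snd h = 0" if "g \<in> carrier G" "h \<in> carrier G" "C g h \<noteq> 0" for g h
    by (rule conj_invariant_support[OF mult comult conj that])
  have supp_g: "snd g = 0" if "g \<in> carrier G" "h \<in> carrier G" "C g h \<noteq> 0" for g h
  \<comment> \<open>Exchanging the variables of C exchanges the two orthogonality properties, so the
    same argument bounds the support in \<open>g\<close>.\<close>
  proof (rule conj_invariant_support[where C = "\<lambda>h g. C g h" and g = h and h = g])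
    show "G.gconv (\<lambda>h. C h g) (\<lambda>h. C h g') h = (if g = g' then C h g else 0)"
      if "g \<in> carrier G" "g' \<in> carrier G" "h \<in> carrier G" for g g' h
      using comult that by simp
    show "G.gconv (\<lambda>g. C h g) (\<lambda>g. C h' g) g = (if h = h' then C h g else 0)"
      if "g \<in> carrier G" "h \<in> carrier G" "h' \<in> carrier G" for g h h'
      using mult that by simp
  qed (use that conj in auto)
  obtain x z y w where e: "g = (x, z)" "h = (y, w)" by (metis surj_pair)
  have c0: "(x, 0) \<in> carrier G" if "x \<in> {0..<int p}" for x
    using that q0 by (simp add: carrier_G)
  have xy: "x \<in> {0..<int p}" "y \<in> {0..<int p}" using g h by (auto simp: e carrier_G)
  have "C (x, 0) (y, 0) = (if x = 0 \<and> y = 0 then 1 else 0)"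
  proof (rule idempotent_pairing_Zp_trivial[OF p coprime_t t_square _ _ _ _ _ xy])
    fix x x' y assume c: "x \<in> {0..<int p}" "x' \<in> {0..<int p}" "y \<in> {0..<int p}"
    have "group.gconv (integer_mod_group p) (\<lambda>y. C (x, 0) (y, 0)) (\<lambda>y. C (x', 0) (y, 0)) y
      = G.gconv (C (x, 0)) (C (x', 0)) (y, 0)"
      using c c0 supp_h by (intro gconv_first_factor[symmetric]) force+
    also have "\<dots> = (if x = x' then C (x, 0) (y, 0) else 0)"
      using mult c c0 by simp
    finally show "group.gconv (integer_mod_group p) (\<lambda>y. C (x, 0) (y, 0)) (\<lambda>y. C (x', 0) (y, 0)) y
      = (if x = x' then C (x, 0) (y, 0) else 0)" .
  next
    fix x y y' assume c: "x \<in> {0..<int p}" "y \<in> {0..<int p}" "y' \<in> {0..<int p}"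
    have "group.gconv (integer_mod_group p) (\<lambda>x. C (x, 0) (y, 0)) (\<lambda>x. C (x, 0) (y', 0)) x
      = G.gconv (\<lambda>g. C g (y, 0)) (\<lambda>g. C g (y', 0)) (x, 0)"
      using c c0 supp_g by (intro gconv_first_factor[symmetric]) force+
    also have "\<dots> = (if y = y' then C (x, 0) (y, 0) else 0)"
      using comult c c0 by simp
    finally show "group.gconv (integer_mod_group p) (\<lambda>x. C (x, 0) (y, 0)) (\<lambda>x. C (x, 0) (y', 0)) x
      = (if y = y' then C (x, 0) (y, 0) else 0)" .
  next
    fix x y assume c: "x \<in> {0..<int p}" "y \<in> {0..<int p}"
    have f: "1 \<in> carrier F" using q1 by (simp add: carrier_F)
    \<comment> \<open>u = b^(-1), so that \<open>conj\<close> conjugates by b and acts on the powers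
      of a as multiplication of the exponent by t.\<close>
    define u where "u = inv\<^bsub>G\<^esub> ((0, 1) :: int \<times> int)"
    have s1: "(0, 1) \<in> carrier G" using p0 q1 by (simp add: carrier_G)
    hence u: "u \<in> carrier G" "inv\<^bsub>G\<^esub> u = (0, 1)" by (simp_all add: u_def)
    have act1: "inv\<^bsub>G\<^esub> u \<otimes>\<^bsub>G\<^esub> (z, 0) \<otimes>\<^bsub>G\<^esub> u = ((int t * z) mod int p, 0)" if "z \<in> {0..<int p}" for z
      using act_inner[OF c0[OF that] f] unfolding u(2) unfolding u_def by (simp add: act_def)
    show "C ((int t * x) mod int p, 0) ((int t * y) mod int p, 0) = C (x, 0) (y, 0)"
      using conj[OF c0[OF c(1)] c0[OF c(2)] u(1)] unfolding act1[OF c(1)] act1[OF c(2)] .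
  next
    fix y assume c: "y \<in> {0..<int p}"
    have "(\<Sum>x\<in>{0..<int p}. C (x, 0) (y, 0)) = (\<Sum>g\<in>carrier G. C g (y, 0))"
      unfolding carrier_G
      by (rule sum_snd_zero[symmetric]) (use q0 supp_g c0[OF c] in \<open>force simp: carrier_G\<close>)+
    also have "\<dots> = (if y = 0 then 1 else 0)"
      unfolding C_def using braiding_unit_left[OF B inv c0[OF c] F.one_closed] by (simp add: one_G)
    finally show "(\<Sum>x\<in>{0..<int p}. C (x, 0) (y, 0)) = (if y = 0 then 1 else 0)" .
  next
    fix x assume c: "x \<in> {0..<int p}"
    have "(\<Sum>y\<in>{0..<int p}. C (x, 0) (y, 0)) = (\<Sum>h\<in>carrier G. C (x, 0) h)"
      unfolding carrier_G
      by (rule sum_snd_zero[symmetric]) (use q0 supp_h c0[OF c] in \<open>force simp: carrier_G\<close>)+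
    also have "\<dots> = (if x = 0 then 1 else 0)"
      unfolding C_def using braiding_unit_right[OF B inv c0[OF c] F.one_closed] by (simp add: one_G)
    finally show "(\<Sum>y\<in>{0..<int p}. C (x, 0) (y, 0)) = (if x = 0 then 1 else 0)" .
  qed
  moreover have "z = 0 \<and> w = 0" if "C g h \<noteq> 0"
    using supp_g[OF g h that] supp_h[OF g h that] by (simp add: e)
  ultimately have "C g h = (if g = \<one>\<^bsub>G\<^esub> \<and> h = \<one>\<^bsub>G\<^esub> then 1 else 0)"
    by (cases "z = 0 \<and> w = 0") (auto simp: e one_G)
  thus ?thesis by (simp only: C_def)
qed

lemma A0_eq: "A0 p q t = H"
  unfolding A0_def H_def by (simp add: act_def)

lemma gen_b_pow: "gen_b [^]\<^bsub>G\<^esub> (j::nat) = (0, int j mod int q)"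
  by (induction j) (simp_all add: one_G mult_G mod_simps add.commute)

lemma gen_b_pow_neg: "gen_b [^]\<^bsub>G\<^esub> (- int i) = inv\<^bsub>G\<^esub> (0, int i mod int q)"
proof -
  have "gen_b \<in> carrier G" using p0 q1 by (simp add: carrier_G)
  thus ?thesis by (simp add: G.int_pow_neg_int gen_b_pow)
qed

theorem braiding_structures_A0:
  assumes \<beta>: "linear_form (basis (H \<otimes>\<^sub>H H)) \<beta>"
  shows "braiding_structure H \<beta> \<longleftrightarrow>
    (\<exists>\<mu>. \<mu> ^ q = 1 \<and>
      (\<forall>h\<in>carrier G. \<forall>k\<in>carrier G. \<forall>i<q. \<forall>j<q.
         \<beta> (bvec (h, gen_g [^]\<^bsub>F\<^esub> i) \<otimes>\<^sub>v bvec (k, gen_g [^]\<^bsub>F\<^esub> j)) =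
         (if h = gen_b [^]\<^bsub>G\<^esub> j then 1 else 0) *
         (if k = gen_b [^]\<^bsub>G\<^esub> (- int i) then 1 else 0) * \<mu> ^ (i * j)))"
    (is "_ \<longleftrightarrow> (\<exists>\<mu>. \<mu> ^ q = 1 \<and> ?form \<mu>)")
proof -
  define B where "B g i h j = \<beta> (bvec ((g, i), (h, j)))" for g i h j
  have iff: "braiding_structure H \<beta> \<longleftrightarrow> (\<exists>\<Psi>. conv_inverse B \<Psi> \<and> conv_inverse \<Psi> B) \<and> is_braiding B"
    using braiding_structure_H_iff[of \<beta>] \<beta> unfolding basis_tensor B_def by blast
  \<comment> \<open>The formula runs over exponents below q, the coordinates over residues in
    \<open>F\<close>; below q the generator powers identify the two.\<close>
  have form_iff: "?form \<mu> \<longleftrightarrow> (\<forall>g\<in>carrier G. \<forall>i\<in>carrier F. \<forall>h\<in>carrier G. \<forall>j\<in>carrier F.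
      B g i h j = (if g = (0, j) \<and> h = inv\<^bsub>G\<^esub> (0, i) then \<mu> ^ (nat i * nat j) else 0))" (is "_ \<longleftrightarrow> ?R") for \<mu>
  proof
    assume f: "?form \<mu>"
    show ?R
    proof (intro ballI)
      fix g i h j assume c: "g \<in> carrier G" "i \<in> carrier F" "h \<in> carrier G" "j \<in> carrier F"
      have "nat i < q" "nat j < q" using c by (auto simp: carrier_F)
      from f[rule_format, OF c(1,3) this] c
      show "B g i h j = (if g = (0, j) \<and> h = inv\<^bsub>G\<^esub> (0, i) then \<mu> ^ (nat i * nat j) else 0)"
        unfolding gen_b_pow gen_b_pow_neg by (simp add: B_def bvec_tens carrier_F)
    qed
  next
    assume f: ?R
    show "?form \<mu>"
    proof (intro ballI allI impI)
      fix g h i j assume c: "g \<in> carrier G" "h \<in> carrier G" "i < q" "j < q"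
      have "int i \<in> carrier F" "int j \<in> carrier F" using c by (auto simp: carrier_F)
      from f[rule_format, OF c(1) this(1) c(2) this(2)] c
      show "\<beta> (bvec (g, gen_g [^]\<^bsub>F\<^esub> i) \<otimes>\<^sub>v bvec (h, gen_g [^]\<^bsub>F\<^esub> j)) =
         (if g = gen_b [^]\<^bsub>G\<^esub> j then 1 else 0) *
         (if h = gen_b [^]\<^bsub>G\<^esub> (- int i) then 1 else 0) * \<mu> ^ (i * j)"
        unfolding gen_b_pow gen_b_pow_neg by (simp add: B_def bvec_tens)
    qed
  qed
  show ?thesis
  proof
    assume "braiding_structure H \<beta>"
    then obtain \<Psi> where \<Psi>: "conv_inverse B \<Psi>" and br: "is_braiding B" unfolding iff by blast
    obtain \<chi> where \<chi>: "\<And>g i h j. g \<in> carrier G \<Longrightarrow> i \<in> carrier F \<Longrightarrow> h \<in> carrier G \<Longrightarrow> j \<in> carrier F \<Longrightarrow>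
        B g i h j = (if g = (0, j) \<and> h = inv\<^bsub>G\<^esub> (0, i) then \<chi> i j else 0)"
      and mult: "\<And>i i' j. i \<in> carrier F \<Longrightarrow> i' \<in> carrier F \<Longrightarrow> j \<in> carrier F \<Longrightarrow>
        \<chi> (i \<otimes>\<^bsub>F\<^esub> i') j = \<chi> i j * \<chi> i' j"
        "\<And>i j j'. i \<in> carrier F \<Longrightarrow> j \<in> carrier F \<Longrightarrow> j' \<in> carrier F \<Longrightarrow>
        \<chi> i (j \<otimes>\<^bsub>F\<^esub> j') = \<chi> i j * \<chi> i j'"
      and one: "\<And>j. j \<in> carrier F \<Longrightarrow> \<chi> \<one>\<^bsub>F\<^esub> j = 1" "\<And>i. i \<in> carrier F \<Longrightarrow> \<chi> i \<one>\<^bsub>F\<^esub> = 1"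
      using braiding_form[OF br \<Psi> braiding_on_functions_trivial[OF br \<Psi>]] by blast
    have g1: "1 \<in> carrier F" using q1 by (simp add: carrier_F)
    have m: "int n mod int q \<in> carrier F" for n using q0 by (simp add: carrier_F)
    have pow_left: "\<chi> (int n mod int q) j = \<chi> 1 j ^ n" if "j \<in> carrier F" for n j
    proof (induction n)
      case (Suc n)
      have "\<chi> (int (Suc n) mod int q) j = \<chi> (1 \<otimes>\<^bsub>F\<^esub> (int n mod int q)) j"
        by (simp add: mod_simps)
      also have "\<dots> = \<chi> 1 j * \<chi> (int n mod int q) j" by (rule mult(1)[OF g1 m that])
      finally show ?case by (simp add: Suc)
    qed (use one that in simp)
    have pow_right: "\<chi> i (int n mod int q) = \<chi> i 1 ^ n" if "i \<in> carrier F" for n i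
    proof (induction n)
      case (Suc n)
      have "\<chi> i (int (Suc n) mod int q) = \<chi> i (1 \<otimes>\<^bsub>F\<^esub> (int n mod int q))"
        by (simp add: mod_simps)
      also have "\<dots> = \<chi> i 1 * \<chi> i (int n mod int q)" by (rule mult(2)[OF that g1 m])
      finally show ?case by (simp add: Suc)
    qed (use one that in simp)
    \<comment> \<open>A bicharacter of a cyclic group is determined by its value at a pair of
      generators, and that value is a root of unity of order dividing q.\<close>
    define \<mu> where "\<mu> = \<chi> 1 1"
    have "\<mu> ^ q = 1" using pow_left[OF g1, of q] one(1)[OF g1] by (simp add: \<mu>_def)
    moreover have "\<chi> i j = \<mu> ^ (nat i * nat j)" if "i \<in> carrier F" "j \<in> carrier F" for i j
    proof -
      have "\<chi> i j = \<chi> 1 j ^ nat i" using pow_left[OF that(2), of "nat i"] that by (simp add: carrier_F)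
      also have "\<chi> 1 j = \<mu> ^ nat j" using pow_right[OF g1, of "nat j"] that by (simp add: carrier_F \<mu>_def)
      finally show ?thesis by (simp add: power_mult[symmetric] mult.commute)
    qed
    ultimately show "\<exists>\<mu>. \<mu> ^ q = 1 \<and> ?form \<mu>"
      unfolding form_iff using \<chi> by (intro exI[of _ \<mu>]) simp
  next
    assume "\<exists>\<mu>. \<mu> ^ q = 1 \<and> ?form \<mu>"
    then obtain \<mu> where \<mu>: "\<mu> ^ q = 1"
      and f: "\<And>g i h j. g \<in> carrier G \<Longrightarrow> i \<in> carrier F \<Longrightarrow> h \<in> carrier G \<Longrightarrow> j \<in> carrier F \<Longrightarrow>
        B g i h j = (if g = (0, j) \<and> h = inv\<^bsub>G\<^esub> (0, i) then \<mu> ^ (nat i * nat j) else 0)"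
      unfolding form_iff by blast
    define \<chi> where "\<chi> i j = \<mu> ^ (nat i * nat j)" for i j :: int
    have m0: "\<mu> \<noteq> 0" using \<mu> q0 by (metis power_0_left zero_neq_one neq0_conv)
    have md: "nat ((i + j) mod int q) = (nat i + nat j) mod q" if "i \<ge> 0" "j \<ge> 0" for i j
      using that by (simp add: nat_mod_distrib nat_add_distrib)
    have pm: "(\<mu> ^ k) ^ (n mod q) = (\<mu> ^ k) ^ n" for k n
      by (rule power_mod_eq) (metis \<mu> power_commutes power_mult mult.commute power_one)
    have left: "\<chi> (i \<otimes>\<^bsub>F\<^esub> i') j = \<chi> i j * \<chi> i' j"
      if "i \<in> carrier F" "i' \<in> carrier F" "j \<in> carrier F" for i i' j
    proof -
      have "\<chi> (i \<otimes>\<^bsub>F\<^esub> i') j = (\<mu> ^ nat j) ^ ((nat i + nat i') mod q)"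
        using that by (simp add: \<chi>_def md carrier_F power_mult[symmetric] mult.commute)
      thus ?thesis unfolding pm by (simp add: \<chi>_def power_mult[symmetric] power_add[symmetric] algebra_simps)
    qed
    have right: "\<chi> i (j \<otimes>\<^bsub>F\<^esub> j') = \<chi> i j * \<chi> i j'"
      if "i \<in> carrier F" "j \<in> carrier F" "j' \<in> carrier F" for i j j'
    proof -
      have "\<chi> i (j \<otimes>\<^bsub>F\<^esub> j') = (\<mu> ^ nat i) ^ ((nat j + nat j') mod q)"
        using that by (simp add: \<chi>_def md carrier_F power_mult[symmetric])
      thus ?thesis unfolding pm by (simp add: \<chi>_def power_mult[symmetric] power_add[symmetric] algebra_simps)
    qed
    have nz: "\<chi> i j \<noteq> 0" for i j using m0 by (simp add: \<chi>_def)
    note f' = f[folded \<chi>_def]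
    show "braiding_structure H \<beta>"
      unfolding iff
      using is_braiding_form[OF left right nz f'] conv_inverse_form[OF left right nz f'] by blast
  qed
qed

end

section \<open>Quasitriangular structures in coordinates\<close>

text \<open>Peels off the first tensor factor. Applied twice, it reduces products in the triple
  tensor power to products in H.\<close>

lemma hprod_tensor:
  "hprod (H \<otimes>\<^sub>H K) X Y (c, d) = (\<Sum>a\<in>basis H. \<Sum>b\<in>basis H.
     hprod K (\<lambda>u. X (a, u)) (\<lambda>u. Y (b, u)) d * hmul H a b c)"
proof -
  have "hprod (H \<otimes>\<^sub>H K) X Y (c, d) = (\<Sum>a\<in>basis H. \<Sum>a'\<in>basis K. \<Sum>b\<in>basis H. \<Sum>b'\<in>basis K.
      X (a, a') * Y (b, b') * hmul K a' b' d * hmul H a b c)"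
    unfolding hprod_def basis_tensor sum.cartesian_product'
    by (simp add: hopf_tensor_def tens_def mult_ac)
  also have "\<dots> = (\<Sum>a\<in>basis H. \<Sum>b\<in>basis H. \<Sum>a'\<in>basis K. \<Sum>b'\<in>basis K.
      X (a, a') * Y (b, b') * hmul K a' b' d * hmul H a b c)"
    by (rule sum.cong[OF refl]) (rule sum.swap)
  finally show ?thesis by (simp add: hprod_def sum_distrib_right)
qed

context ab_ext_data begin

text \<open>A product equal to e_u # n starts with some e_u # f, and f determines the second factor.
  A double sum over the basis becomes one sum over \<open>F\<close>.\<close>

lemma sum_sum_hmul:
  "(\<Sum>a\<in>carrier G \<times> carrier F. \<Sum>b\<in>carrier G \<times> carrier F. \<Phi> a b * hmul H a b (u, n))
    = (if u \<in> carrier G \<and> n \<in> carrier F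
       then \<Sum>f\<in>carrier F. \<Phi> (u, f) (act u f, inv\<^bsub>F\<^esub> f \<otimes>\<^bsub>F\<^esub> n) else 0)"
proof -
  have inner: "(\<Sum>g'\<in>carrier G. \<Sum>f'\<in>carrier F. \<Phi> (g, f) (g', f') * hmul H (g, f) (g', f') (u, n))
     = (if g = u then (if n \<in> carrier F then \<Phi> (g, f) (act g f, inv\<^bsub>F\<^esub> f \<otimes>\<^bsub>F\<^esub> n) else 0) else 0)"
    if "g \<in> carrier G" "f \<in> carrier F" for g f
  proof (cases "g = u \<and> n \<in> carrier F")
    case True
    have "f' = inv\<^bsub>F\<^esub> f \<otimes>\<^bsub>F\<^esub> n \<longleftrightarrow> n = f \<otimes>\<^bsub>F\<^esub> f'" if "f' \<in> carrier F" for f'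
      using that \<open>f \<in> carrier F\<close> True by (metis F.inv_solve_left)
    hence "(\<Sum>g'\<in>carrier G. \<Sum>f'\<in>carrier F. \<Phi> (g, f) (g', f') * hmul H (g, f) (g', f') (u, n))
      = (\<Sum>g'\<in>carrier G. \<Sum>f'\<in>carrier F.
          (if g' = act g f \<and> f' = inv\<^bsub>F\<^esub> f \<otimes>\<^bsub>F\<^esub> n then 1 else 0) * \<Phi> (g, f) (g', f'))"
      using that True by (intro sum.cong refl) (auto simp: hmul_H bvec_def)
    also have "\<dots> = 1 * \<Phi> (g, f) (act g f, inv\<^bsub>F\<^esub> f \<otimes>\<^bsub>F\<^esub> n)"
      using that True by (intro sum_sum_delta) simp_all
    finally show ?thesis using True by simp
  next
    case False
    hence "(\<Sum>g'\<in>carrier G. \<Sum>f'\<in>carrier F. \<Phi> (g, f) (g', f') * hmul H (g, f) (g', f') (u, n)) = 0"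
      using that by (intro sum.neutral ballI) (auto simp: hmul_H bvec_def)
    with False show ?thesis by auto
  qed
  have "(\<Sum>a\<in>carrier G \<times> carrier F. \<Sum>b\<in>carrier G \<times> carrier F. \<Phi> a b * hmul H a b (u, n))
    = (\<Sum>g\<in>carrier G. \<Sum>f\<in>carrier F.
        if g = u then (if n \<in> carrier F then \<Phi> (g, f) (act g f, inv\<^bsub>F\<^esub> f \<otimes>\<^bsub>F\<^esub> n) else 0) else 0)"
    unfolding sum.cartesian_product' using inner by (intro sum.cong refl) simp
  also have "\<dots> = (\<Sum>f\<in>carrier F. \<Sum>g\<in>carrier G.
        if g = u then (if n \<in> carrier F then \<Phi> (g, f) (act g f, inv\<^bsub>F\<^esub> f \<otimes>\<^bsub>F\<^esub> n) else 0) else 0)"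
    by (rule sum.swap)
  also have "\<dots> = (if u \<in> carrier G \<and> n \<in> carrier F
       then \<Sum>f\<in>carrier F. \<Phi> (u, f) (act u f, inv\<^bsub>F\<^esub> f \<otimes>\<^bsub>F\<^esub> n) else 0)"
    by (auto intro!: sum.neutral)
  finally show ?thesis .
qed

lemma hprod_H:
  "hprod H x y (u, n) = (if u \<in> carrier G \<and> n \<in> carrier F
     then \<Sum>f\<in>carrier F. x (u, f) * y (act u f, inv\<^bsub>F\<^esub> f \<otimes>\<^bsub>F\<^esub> n) else 0)"
  unfolding hprod_def basis_H by (rule sum_sum_hmul)

lemma hprod_H2:
  assumes "u \<in> carrier G" "n \<in> carrier F" "v \<in> carrier G" "l \<in> carrier F"
  shows "hprod (H \<otimes>\<^sub>H H) X Y ((u, n), (v, l)) = (\<Sum>f\<in>carrier F. \<Sum>f'\<in>carrier F.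
     X ((u, f), (v, f')) * Y ((act u f, inv\<^bsub>F\<^esub> f \<otimes>\<^bsub>F\<^esub> n), (act v f', inv\<^bsub>F\<^esub> f' \<otimes>\<^bsub>F\<^esub> l)))"
  unfolding hprod_tensor basis_H sum_sum_hmul using assms by (simp add: hprod_H)

lemma hprod_H2_outside:
  assumes "c \<notin> basis H \<times> basis H"
  shows "hprod (H \<otimes>\<^sub>H H) X Y c = 0"
proof -
  obtain u n v l where "c = ((u, n), (v, l))" by (metis surj_pair)
  with assms show ?thesis
    by (auto simp: hprod_tensor sum_sum_hmul hprod_H)
qed

lemma hone_H: "hone H (g, f) = (if g \<in> carrier G \<and> f = \<one>\<^bsub>F\<^esub> then 1 else 0)"
proof -
  have "hone H (g, f) = (\<Sum>x\<in>carrier G. if x = g then (if f = \<one>\<^bsub>F\<^esub> then 1 else 0) else 0)"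
    by (auto simp: H_def ab_ext_def bvec_def intro!: sum.cong)
  thus ?thesis by simp
qed

lemma hprod_H3:
  "hprod (H \<otimes>\<^sub>H H \<otimes>\<^sub>H H) X Y ((u, n), (v, l), (w, k)) =
    (if u \<in> carrier G \<and> n \<in> carrier F \<and> v \<in> carrier G \<and> l \<in> carrier F \<and> w \<in> carrier G \<and> k \<in> carrier F
     then \<Sum>f\<in>carrier F. \<Sum>f'\<in>carrier F. \<Sum>f''\<in>carrier F. X ((u, f), (v, f'), (w, f'')) *
       Y ((act u f, inv\<^bsub>F\<^esub> f \<otimes>\<^bsub>F\<^esub> n), (act v f', inv\<^bsub>F\<^esub> f' \<otimes>\<^bsub>F\<^esub> l), (act w f'', inv\<^bsub>F\<^esub> f'' \<otimes>\<^bsub>F\<^esub> k))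
     else 0)"
  unfolding hprod_tensor basis_H sum_sum_hmul by (auto simp: hprod_H intro!: sum.neutral)

lemma inv_mult_eq_one_iff: "f \<in> carrier F \<Longrightarrow> n \<in> carrier F \<Longrightarrow> inv\<^bsub>F\<^esub> f \<otimes>\<^bsub>F\<^esub> n = \<one>\<^bsub>F\<^esub> \<longleftrightarrow> f = n"
  by (metis F.inv_closed F.inv_equality F.inv_inv F.l_inv)

text \<open>R_13 carries the unit in the second slot and R_23 in the first. This fixes the
  F-components f' = 1 and f = n there, and only the sum in the third slot remains.\<close>

lemma R13_R23:
  assumes "u \<in> carrier G" "n \<in> carrier F" "v \<in> carrier G" "l \<in> carrier F" "w \<in> carrier G" "k \<in> carrier F"
  shows "hprod (H \<otimes>\<^sub>H H \<otimes>\<^sub>H H) (R13 H R) (R23 H R) ((u, n), (v, l), (w, k)) =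
    (\<Sum>f\<in>carrier F. R ((u, n), (w, f)) * R ((v, l), (act w f, inv\<^bsub>F\<^esub> f \<otimes>\<^bsub>F\<^esub> k)))"
proof -
  have "hprod (H \<otimes>\<^sub>H H \<otimes>\<^sub>H H) (R13 H R) (R23 H R) ((u, n), (v, l), (w, k)) =
    (\<Sum>f\<in>carrier F. \<Sum>f'\<in>carrier F. (if f = n \<and> f' = \<one>\<^bsub>F\<^esub> then 1 else 0) *
      (\<Sum>f''\<in>carrier F. R ((u, f), (w, f'')) *
         R ((act v f', inv\<^bsub>F\<^esub> f' \<otimes>\<^bsub>F\<^esub> l), (act w f'', inv\<^bsub>F\<^esub> f'' \<otimes>\<^bsub>F\<^esub> k))))"
    using assms unfolding hprod_H3 sum_distrib_left
    by (simp only: simp_thms if_True)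
      (intro sum.cong refl, auto simp: R13_def R23_def hone_H inv_mult_eq_one_iff)
  also have "\<dots> = 1 * (\<Sum>f''\<in>carrier F. R ((u, n), (w, f'')) *
         R ((act v \<one>\<^bsub>F\<^esub>, inv\<^bsub>F\<^esub> \<one>\<^bsub>F\<^esub> \<otimes>\<^bsub>F\<^esub> l), (act w f'', inv\<^bsub>F\<^esub> f'' \<otimes>\<^bsub>F\<^esub> k)))"
    using assms by (intro sum_sum_delta) simp_all
  finally show ?thesis using assms by simp
qed

lemma R13_R12:
  assumes "u \<in> carrier G" "n \<in> carrier F" "v \<in> carrier G" "l \<in> carrier F" "w \<in> carrier G" "k \<in> carrier F"
  shows "hprod (H \<otimes>\<^sub>H H \<otimes>\<^sub>H H) (R13 H R) (R12 H R) ((u, n), (v, l), (w, k)) =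
    (\<Sum>f\<in>carrier F. R ((u, f), (w, k)) * R ((act u f, inv\<^bsub>F\<^esub> f \<otimes>\<^bsub>F\<^esub> n), (v, l)))"
proof -
  have "hprod (H \<otimes>\<^sub>H H \<otimes>\<^sub>H H) (R13 H R) (R12 H R) ((u, n), (v, l), (w, k)) =
    (\<Sum>f\<in>carrier F. \<Sum>f'\<in>carrier F. \<Sum>f''\<in>carrier F. (if f' = \<one>\<^bsub>F\<^esub> \<and> f'' = k then 1 else 0) *
      (R ((u, f), (w, f'')) *
         R ((act u f, inv\<^bsub>F\<^esub> f \<otimes>\<^bsub>F\<^esub> n), (act v f', inv\<^bsub>F\<^esub> f' \<otimes>\<^bsub>F\<^esub> l))))"
    using assms unfolding hprod_H3
    by (simp only: simp_thms if_True)
      (intro sum.cong refl, auto simp: R13_def R12_def hone_H inv_mult_eq_one_iff)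
  also have "\<dots> = (\<Sum>f\<in>carrier F. 1 * (R ((u, f), (w, k)) *
         R ((act u f, inv\<^bsub>F\<^esub> f \<otimes>\<^bsub>F\<^esub> n), (act v \<one>\<^bsub>F\<^esub>, inv\<^bsub>F\<^esub> \<one>\<^bsub>F\<^esub> \<otimes>\<^bsub>F\<^esub> l))))"
    by (rule sum.cong[OF refl], rule sum_sum_delta) (use assms in simp_all)
  finally show ?thesis using assms by simp
qed

lemma comul_left_H:
  assumes "u \<in> carrier G" "n \<in> carrier F" "v \<in> carrier G"
  shows "comul_left H R ((u, n), (v, l), c) = (if n = l then \<tau> u v n * R ((u \<otimes> v, n), c) else 0)"
proof -
  have "comul_left H R ((u, n), (v, l), c) =
    (\<Sum>g\<in>carrier G. \<Sum>f\<in>carrier F. (if g = u \<otimes> v \<and> f = n then (if n = l then \<tau> u v n else 0) else 0) * R ((g, f), c))"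
    unfolding comul_left_def basis_H sum.cartesian_product' prod.case
    using assms by (intro sum.cong refl) (auto simp: hcomul_H_coord)
  also have "\<dots> = (if n = l then \<tau> u v n else 0) * R ((u \<otimes> v, n), c)"
    using assms by (intro sum_sum_delta) simp_all
  finally show ?thesis by simp
qed

lemma comul_right_H:
  assumes "u \<in> carrier G" "n \<in> carrier F" "v \<in> carrier G"
  shows "comul_right H R (c, (u, n), (v, l)) = (if n = l then \<tau> u v n * R (c, (u \<otimes> v, n)) else 0)"
proof -
  have "comul_right H R (c, (u, n), (v, l)) =
    (\<Sum>g\<in>carrier G. \<Sum>f\<in>carrier F. (if g = u \<otimes> v \<and> f = n then (if n = l then \<tau> u v n else 0) else 0) * R (c, (g, f)))"
    unfolding comul_right_def basis_H sum.cartesian_product' prod.case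
    using assms by (intro sum.cong refl) (auto simp: hcomul_H_coord)
  also have "\<dots> = (if n = l then \<tau> u v n else 0) * R (c, (u \<otimes> v, n))"
    using assms by (intro sum_sum_delta) simp_all
  finally show ?thesis by simp
qed

text \<open>The axiom at the coordinate (u # n, v # l, w # k). Both tensor factors in the coproduct
  of e_g # n have F-component n, hence the case distinction on n = l.\<close>

definition is_qt_left where
  "is_qt_left R \<longleftrightarrow> (\<forall>u\<in>carrier G. \<forall>n\<in>carrier F. \<forall>v\<in>carrier G. \<forall>l\<in>carrier F. \<forall>w\<in>carrier G. \<forall>k\<in>carrier F.
    (if n = l then \<tau> u v n * R ((u \<otimes> v, n), (w, k)) else 0) =
    (\<Sum>f\<in>carrier F. R ((u, n), (w, f)) * R ((v, l), (act w f, inv\<^bsub>F\<^esub> f \<otimes>\<^bsub>F\<^esub> k))))"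

definition is_qt_right where
  "is_qt_right R \<longleftrightarrow> (\<forall>u\<in>carrier G. \<forall>n\<in>carrier F. \<forall>v\<in>carrier G. \<forall>l\<in>carrier F. \<forall>w\<in>carrier G. \<forall>k\<in>carrier F.
    (if l = k then \<tau> v w l * R ((u, n), (v \<otimes> w, l)) else 0) =
    (\<Sum>f\<in>carrier F. R ((u, f), (w, k)) * R ((act u f, inv\<^bsub>F\<^esub> f \<otimes>\<^bsub>F\<^esub> n), (v, l))))"

text \<open>The axiom for h = e_g # i at the coordinate (u # n, v # l). The opposite coproduct
  multiplies R from the left, so i is divided off n and l on the left; the coproduct multiplies from
  the right, so i is divided off on the right and the action reaches its own G-components.\<close>

definition is_qt_op where
  "is_qt_op R \<longleftrightarrow> (\<forall>g\<in>carrier G. \<forall>i\<in>carrier F. \<forall>u\<in>carrier G. \<forall>n\<in>carrier F. \<forall>v\<in>carrier G. \<forall>l\<in>carrier F.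
    (if v \<otimes> u = g then \<tau> v u i * R ((act u i, inv\<^bsub>F\<^esub> i \<otimes>\<^bsub>F\<^esub> n), (act v i, inv\<^bsub>F\<^esub> i \<otimes>\<^bsub>F\<^esub> l)) else 0) =
    (if act u (n \<otimes>\<^bsub>F\<^esub> inv\<^bsub>F\<^esub> i) \<otimes> act v (l \<otimes>\<^bsub>F\<^esub> inv\<^bsub>F\<^esub> i) = g
     then \<tau> (act u (n \<otimes>\<^bsub>F\<^esub> inv\<^bsub>F\<^esub> i)) (act v (l \<otimes>\<^bsub>F\<^esub> inv\<^bsub>F\<^esub> i)) i *
       R ((u, n \<otimes>\<^bsub>F\<^esub> inv\<^bsub>F\<^esub> i), (v, l \<otimes>\<^bsub>F\<^esub> inv\<^bsub>F\<^esub> i)) else 0))"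

lemma fun_eq_on_triples:
  fixes X Y :: "('g \<times> 'f) \<times> ('g \<times> 'f) \<times> ('g \<times> 'f) \<Rightarrow> 'a"
  assumes "\<And>u n v l w k. \<not> (u \<in> carrier G \<and> n \<in> carrier F \<and> v \<in> carrier G \<and> l \<in> carrier F \<and>
      w \<in> carrier G \<and> k \<in> carrier F) \<Longrightarrow> X ((u, n), (v, l), (w, k)) = Y ((u, n), (v, l), (w, k))"
  shows "X = Y \<longleftrightarrow> (\<forall>u\<in>carrier G. \<forall>n\<in>carrier F. \<forall>v\<in>carrier G. \<forall>l\<in>carrier F. \<forall>w\<in>carrier G. \<forall>k\<in>carrier F.
    X ((u, n), (v, l), (w, k)) = Y ((u, n), (v, l), (w, k)))"
proof
  assume *: "\<forall>u\<in>carrier G. \<forall>n\<in>carrier F. \<forall>v\<in>carrier G. \<forall>l\<in>carrier F. \<forall>w\<in>carrier G. \<forall>k\<in>carrier F.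
    X ((u, n), (v, l), (w, k)) = Y ((u, n), (v, l), (w, k))"
  show "X = Y"
  proof
    fix c :: "('g \<times> 'f) \<times> ('g \<times> 'f) \<times> ('g \<times> 'f)"
    obtain u n v l w k where c: "c = ((u, n), (v, l), (w, k))" by (metis surj_pair)
    show "X c = Y c" unfolding c using * assms[of u n v l w k] by blast
  qed
qed simp

lemma is_qt_left_iff:
  assumes R: "R \<in> vecs (basis H \<times> basis H)"
  shows "comul_left H R = hprod (H \<otimes>\<^sub>H H \<otimes>\<^sub>H H) (R13 H R) (R23 H R) \<longleftrightarrow> is_qt_left R"
proof -
  have "comul_left H R ((u, n), (v, l), (w, k)) = hprod (H \<otimes>\<^sub>H H \<otimes>\<^sub>H H) (R13 H R) (R23 H R) ((u, n), (v, l), (w, k))"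
    if "\<not> (u \<in> carrier G \<and> n \<in> carrier F \<and> v \<in> carrier G \<and> l \<in> carrier F \<and> w \<in> carrier G \<and> k \<in> carrier F)"
    for u n v l w k
  proof -
    have "comul_left H R ((u, n), (v, l), (w, k)) = 0"
      unfolding comul_left_def prod.case
    proof (rule sum.neutral, rule ballI)
      fix b assume b: "b \<in> basis H"
      obtain g f where gf: "b = (g, f)" by (metis surj_pair)
      show "R (b, (w, k)) * hcomul H b ((u, n), (v, l)) = 0"
      proof (cases "w \<in> carrier G \<and> k \<in> carrier F")
        case True
        with that b show ?thesis by (auto simp: gf hcomul_H_coord)
      next
        case False
        with R show ?thesis by (auto simp: vecs_def gf)
      qed
    qed
    with that show ?thesis by (auto simp: hprod_H3)
  qed
  from fun_eq_on_triples[of "comul_left H R" "hprod (H \<otimes>\<^sub>H H \<otimes>\<^sub>H H) (R13 H R) (R23 H R)", OF this]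
  show ?thesis
    unfolding is_qt_left_def by (simp add: comul_left_H R13_R23)
qed

lemma is_qt_right_iff:
  assumes R: "R \<in> vecs (basis H \<times> basis H)"
  shows "comul_right H R = hprod (H \<otimes>\<^sub>H H \<otimes>\<^sub>H H) (R13 H R) (R12 H R) \<longleftrightarrow> is_qt_right R"
proof -
  have "comul_right H R ((u, n), (v, l), (w, k)) = hprod (H \<otimes>\<^sub>H H \<otimes>\<^sub>H H) (R13 H R) (R12 H R) ((u, n), (v, l), (w, k))"
    if "\<not> (u \<in> carrier G \<and> n \<in> carrier F \<and> v \<in> carrier G \<and> l \<in> carrier F \<and> w \<in> carrier G \<and> k \<in> carrier F)"
    for u n v l w k
  proof -
    have "comul_right H R ((u, n), (v, l), (w, k)) = 0"
      unfolding comul_right_def prod.case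
    proof (rule sum.neutral, rule ballI)
      fix b assume b: "b \<in> basis H"
      obtain g f where gf: "b = (g, f)" by (metis surj_pair)
      show "R ((u, n), b) * hcomul H b ((v, l), (w, k)) = 0"
      proof (cases "u \<in> carrier G \<and> n \<in> carrier F")
        case True
        with that b show ?thesis by (auto simp: gf hcomul_H_coord)
      next
        case False
        with R show ?thesis by (auto simp: vecs_def gf)
      qed
    qed
    with that show ?thesis by (auto simp: hprod_H3)
  qed
  from fun_eq_on_triples[of "comul_right H R" "hprod (H \<otimes>\<^sub>H H \<otimes>\<^sub>H H) (R13 H R) (R12 H R)", OF this]
  show ?thesis
    unfolding is_qt_right_def by (simp add: comul_right_H R13_R12)
qed

lemma is_qt_op_iff:
  "(\<forall>h\<in>vecs (basis H). hprod (H \<otimes>\<^sub>H H) (\<lambda>(u, v). hcoprod H h (v, u)) R =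
      hprod (H \<otimes>\<^sub>H H) R (hcoprod H h)) \<longleftrightarrow> is_qt_op R"
    (is "(\<forall>h\<in>_. ?X h = ?Y h) \<longleftrightarrow> _")
proof -
  have fin: "finite (basis H)" by simp
  have lin: "linear_form (basis H) (\<lambda>h. ?X h c)" "linear_form (basis H) (\<lambda>h. ?Y h c)" for c
    unfolding hprod_def case_prod_unfold
    by (intro linear_form_sum linear_form_mult_right linear_form_mult_left linear_form_hcoprod)+
  have "(\<forall>h\<in>vecs (basis H). ?X h = ?Y h) \<longleftrightarrow> (\<forall>b\<in>basis H. ?X (bvec b) = ?Y (bvec b))"
  proof
    assume *: "\<forall>b\<in>basis H. ?X (bvec b) = ?Y (bvec b)"
    show "\<forall>h\<in>vecs (basis H). ?X h = ?Y h"
    proof (intro ballI ext)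
      fix h :: "'g \<times> 'f \<Rightarrow> 'k" and c assume h: "h \<in> vecs (basis H)"
      show "?X h c = ?Y h c"
        by (rule linear_form_eqI[OF fin lin h]) (simp only: *)
    qed
  qed (metis vecs_bvec)
  also have "\<dots> \<longleftrightarrow> (\<forall>g\<in>carrier G. \<forall>i\<in>carrier F. \<forall>u\<in>carrier G. \<forall>n\<in>carrier F. \<forall>v\<in>carrier G. \<forall>l\<in>carrier F.
     ?X (bvec (g, i)) ((u, n), (v, l)) = ?Y (bvec (g, i)) ((u, n), (v, l)))"
  proof (unfold basis_H ball_Times, intro ball_cong refl)
    fix g i
    show "?X (bvec (g, i)) = ?Y (bvec (g, i)) \<longleftrightarrow>
      (\<forall>u\<in>carrier G. \<forall>n\<in>carrier F. \<forall>v\<in>carrier G. \<forall>l\<in>carrier F.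
        ?X (bvec (g, i)) ((u, n), (v, l)) = ?Y (bvec (g, i)) ((u, n), (v, l)))"
    proof
      assume *: "\<forall>u\<in>carrier G. \<forall>n\<in>carrier F. \<forall>v\<in>carrier G. \<forall>l\<in>carrier F.
        ?X (bvec (g, i)) ((u, n), (v, l)) = ?Y (bvec (g, i)) ((u, n), (v, l))"
      show "?X (bvec (g, i)) = ?Y (bvec (g, i))"
      proof
        fix c :: "('g \<times> 'f) \<times> ('g \<times> 'f)"
        obtain u n v l where c: "c = ((u, n), (v, l))" by (metis surj_pair)
        show "?X (bvec (g, i)) c = ?Y (bvec (g, i)) c"
        proof (cases "c \<in> basis H \<times> basis H")
          case True
          with * show ?thesis unfolding c by simp
        next
          case False
          from hprod_H2_outside[OF this] show ?thesis by (simp only:)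
        qed
      qed
    qed simp
  qed
  also have "\<dots> \<longleftrightarrow> is_qt_op R"
    unfolding is_qt_op_def
  proof (intro ball_cong refl)
    fix g i u n v l
    assume c: "g \<in> carrier G" "i \<in> carrier F" "u \<in> carrier G" "n \<in> carrier F" "v \<in> carrier G" "l \<in> carrier F"
    have h: "hcoprod H (bvec (g, i)) = hcomul H (g, i)"
      using c by (simp add: hcoprod_bvec)
    have "?X (bvec (g, i)) ((u, n), (v, l)) = (\<Sum>f\<in>carrier F. \<Sum>f'\<in>carrier F.
       (if f = i \<and> f' = i then (if v \<otimes> u = g then \<tau> v u i else 0) else 0) *
       R ((act u f, inv\<^bsub>F\<^esub> f \<otimes>\<^bsub>F\<^esub> n), (act v f', inv\<^bsub>F\<^esub> f' \<otimes>\<^bsub>F\<^esub> l)))"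
      unfolding h hprod_H2[OF c(3-6)] using c by (intro sum.cong refl) (auto simp: hcomul_H_coord)
    also have "\<dots> = (if v \<otimes> u = g then \<tau> v u i else 0) *
       R ((act u i, inv\<^bsub>F\<^esub> i \<otimes>\<^bsub>F\<^esub> n), (act v i, inv\<^bsub>F\<^esub> i \<otimes>\<^bsub>F\<^esub> l))"
      using c by (intro sum_sum_delta) simp_all
    finally have X: "?X (bvec (g, i)) ((u, n), (v, l)) = (if v \<otimes> u = g then \<tau> v u i else 0) *
       R ((act u i, inv\<^bsub>F\<^esub> i \<otimes>\<^bsub>F\<^esub> n), (act v i, inv\<^bsub>F\<^esub> i \<otimes>\<^bsub>F\<^esub> l))" .
    let ?n = "n \<otimes>\<^bsub>F\<^esub> inv\<^bsub>F\<^esub> i" and ?l = "l \<otimes>\<^bsub>F\<^esub> inv\<^bsub>F\<^esub> i"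
    have f: "inv\<^bsub>F\<^esub> f \<otimes>\<^bsub>F\<^esub> n = i \<longleftrightarrow> f = n \<otimes>\<^bsub>F\<^esub> inv\<^bsub>F\<^esub> i" if "f \<in> carrier F" "n \<in> carrier F" for f n
      using that c(2) by (metis F.inv_closed F.inv_solve_left F.inv_solve_right)
    have "?Y (bvec (g, i)) ((u, n), (v, l)) = (\<Sum>f\<in>carrier F. \<Sum>f'\<in>carrier F.
       (if f = ?n \<and> f' = ?l then (if act u ?n \<otimes> act v ?l = g then \<tau> (act u ?n) (act v ?l) i else 0) else 0) *
       R ((u, f), (v, f')))"
      unfolding h hprod_H2[OF c(3-6)] using c by (intro sum.cong refl) (auto simp: hcomul_H_coord f)
    also have "\<dots> = (if act u ?n \<otimes> act v ?l = g then \<tau> (act u ?n) (act v ?l) i else 0) *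
       R ((u, ?n), (v, ?l))"
      using c by (intro sum_sum_delta) simp_all
    finally have Y: "?Y (bvec (g, i)) ((u, n), (v, l)) =
       (if act u ?n \<otimes> act v ?l = g then \<tau> (act u ?n) (act v ?l) i else 0) * R ((u, ?n), (v, ?l))" .
    show "?X (bvec (g, i)) ((u, n), (v, l)) = ?Y (bvec (g, i)) ((u, n), (v, l)) \<longleftrightarrow>
      (if v \<otimes> u = g then \<tau> v u i * R ((act u i, inv\<^bsub>F\<^esub> i \<otimes>\<^bsub>F\<^esub> n), (act v i, inv\<^bsub>F\<^esub> i \<otimes>\<^bsub>F\<^esub> l)) else 0) =
      (if act u ?n \<otimes> act v ?l = g then \<tau> (act u ?n) (act v ?l) i * R ((u, ?n), (v, ?l)) else 0)"
      unfolding X Y by simp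
  qed
  finally show ?thesis .
qed

lemma quasitriangular_H_iff:
  "quasitriangular H R \<longleftrightarrow> R \<in> vecs (basis H \<times> basis H) \<and> hinvertible (H \<otimes>\<^sub>H H) R \<and>
    is_qt_left R \<and> is_qt_right R \<and> is_qt_op R"
  unfolding quasitriangular_def is_qt_op_iff basis_tensor
  using is_qt_left_iff is_qt_right_iff by blast

end

section \<open>Quantum tori\<close>

text \<open>Gaussian elimination for fewer equations than unknowns: the coordinate x is removed from
  all vectors with the help of a pivot k0, and the relation found for the rest is completed at
  k0.\<close>

lemma linear_dependence:
  fixes v :: "'i \<Rightarrow> 's \<Rightarrow> 'k::field"
  assumes "finite S" "finite K" "card S < card K"
  shows "\<exists>c. (\<exists>k\<in>K. c k \<noteq> 0) \<and> (\<forall>x\<in>S. (\<Sum>k\<in>K. c k * v k x) = 0)"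
  using assms
proof (induction S arbitrary: K v)
  case empty
  hence "K \<noteq> {}" by auto
  thus ?case by (intro exI[of _ "\<lambda>_. 1"]) auto
next
  case (insert x S)
  show ?case
  proof (cases "\<forall>k\<in>K. v k x = 0")
    case True
    have "card S < card K" using insert by simp
    from insert.IH[OF insert.prems(1) this, of v] obtain c
      where "\<exists>k\<in>K. c k \<noteq> 0" "\<forall>x\<in>S. (\<Sum>k\<in>K. c k * v k x) = 0" by blast
    with True show ?thesis by (intro exI[of _ c]) auto
  next
    case False
    then obtain k0 where k0: "k0 \<in> K" "v k0 x \<noteq> 0" by blast
    \<comment> \<open>The multiple of the pivot vector is chosen so that every \<open>v' k\<close>
      vanishes at x.\<close>
    define v' where "v' k y = v k y - v k x / v k0 x * v k0 y" for k y
    have "card S < card (K - {k0})" using insert k0 by simp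
    from insert.IH[OF _ this, of v'] insert.prems(1) obtain c
      where c: "\<exists>k\<in>K - {k0}. c k \<noteq> 0" "\<forall>x\<in>S. (\<Sum>k\<in>K - {k0}. c k * v' k x) = 0" by auto
    define c0 where "c0 = - (\<Sum>k\<in>K - {k0}. c k * v k x) / v k0 x"
    define c' where "c' k = (if k = k0 then c0 else c k)" for k
    have split: "(\<Sum>k\<in>K. c' k * v k y) = c0 * v k0 y + (\<Sum>k\<in>K - {k0}. c k * v k y)" for y
      using insert.prems(1) k0(1) by (simp add: sum.remove[of K k0] c'_def)
    have "(\<Sum>k\<in>K - {k0}. c k * v' k y) = c0 * v k0 y + (\<Sum>k\<in>K - {k0}. c k * v k y)" for y
    proof -
      have "(\<Sum>k\<in>K - {k0}. c k * v' k y)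
        = (\<Sum>k\<in>K - {k0}. c k * v k y - (c k * v k x) * (v k0 y / v k0 x))"
        by (intro sum.cong refl) (simp add: v'_def right_diff_distrib)
      moreover have "c0 * v k0 y = - (\<Sum>k\<in>K - {k0}. c k * v k x) * (v k0 y / v k0 x)"
        by (simp add: c0_def)
      ultimately show ?thesis
        by (simp add: sum_subtractf sum_distrib_right del: times_divide_eq_right)
    qed
    hence "\<forall>y\<in>S. (\<Sum>k\<in>K. c' k * v k y) = 0" using c(2) by (simp add: split)
    moreover have "(\<Sum>k\<in>K. c' k * v k x) = 0" using k0 by (simp add: split c0_def)
    moreover have "\<exists>k\<in>K. c' k \<noteq> 0" using c(1) by (auto simp: c'_def)
    ultimately show ?thesis by blast
  qed
qed

text \<open>The operator of a matrix with index set \<open>S\<close>. Vectors are total functions,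
  so eigenvector equations are imposed at the points of \<open>S\<close> only.\<close>

definition kapp :: "'s set \<Rightarrow> ('s \<Rightarrow> 's \<Rightarrow> 'k::field) \<Rightarrow> ('s \<Rightarrow> 'k) \<Rightarrow> 's \<Rightarrow> 'k" where
  "kapp S K v = (\<lambda>i. \<Sum>n\<in>S. K i n * v n)"

lemma kapp_sum: "kapp S K (\<lambda>i. \<Sum>a\<in>A. f a i) = (\<lambda>i. \<Sum>a\<in>A. kapp S K (f a) i)"
  by (rule ext) (simp add: kapp_def sum_distrib_left sum.swap[of _ A])

lemma kapp_scale: "kapp S K (\<lambda>i. c * v i) = (\<lambda>i. c * kapp S K v i)"
  by (rule ext) (simp add: kapp_def sum_distrib_left mult_ac)

lemma kapp_cong: "(\<And>i. i \<in> S \<Longrightarrow> v i = w i) \<Longrightarrow> kapp S K v = kapp S K w"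
  by (auto simp: kapp_def)

lemma kapp_kapp:
  "kapp S K (kapp S L v) = kapp S (\<lambda>i l. \<Sum>n\<in>S. K i n * L n l) v"
proof
  fix i
  have "kapp S K (kapp S L v) i = (\<Sum>n\<in>S. \<Sum>l\<in>S. K i n * L n l * v l)"
    by (simp add: kapp_def sum_distrib_left mult.assoc)
  also have "\<dots> = (\<Sum>l\<in>S. \<Sum>n\<in>S. K i n * L n l * v l)" by (rule sum.swap)
  finally show "kapp S K (kapp S L v) i = kapp S (\<lambda>i l. \<Sum>n\<in>S. K i n * L n l) v i"
    by (simp add: kapp_def sum_distrib_right)
qed

text \<open>Applying A - c(k0) to a linear relation removes the eigenvector of k0 and multiplies
  every other coefficient by the nonzero c(k) - c(k0).\<close>

lemma eigenvectors_independent: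
  fixes v :: "'i \<Rightarrow> 's \<Rightarrow> 'k::field"
  assumes "finite K" "inj_on c K"
    and "\<And>k i. k \<in> K \<Longrightarrow> i \<in> S \<Longrightarrow> kapp S A (v k) i = c k * v k i"
    and "\<And>k. k \<in> K \<Longrightarrow> \<exists>i\<in>S. v k i \<noteq> 0"
    and "\<And>i. i \<in> S \<Longrightarrow> (\<Sum>k\<in>K. d k * v k i) = 0"
    and "k \<in> K"
  shows "d k = 0"
  using assms
proof (induction K arbitrary: d k)
  case (insert k0 K)
  have comb: "d k0 * v k0 i + (\<Sum>k\<in>K. d k * v k i) = 0" if "i \<in> S" for i
    using insert.prems(4)[OF that] insert.hyps by simp
  have "(\<Sum>k\<in>K. d k * (c k - c k0) * v k i) = 0" if i: "i \<in> S" for i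
  proof -
    have "kapp S A (\<lambda>i. \<Sum>k\<in>insert k0 K. d k * v k i) = kapp S A (\<lambda>i. 0)"
      by (rule kapp_cong) (use insert.prems(4) in blast)
    hence "(\<Sum>k\<in>insert k0 K. d k * kapp S A (v k) i) = 0"
      by (simp only: kapp_sum kapp_scale) (simp add: kapp_def fun_eq_iff)
    moreover have "(\<Sum>k\<in>insert k0 K. d k * kapp S A (v k) i) = (\<Sum>k\<in>insert k0 K. d k * (c k * v k i))"
      using insert.prems(2) i by (intro sum.cong) auto
    ultimately have "d k0 * (c k0 * v k0 i) + (\<Sum>k\<in>K. d k * (c k * v k i)) = 0"
      using insert.hyps by simp
    moreover have "c k0 * (d k0 * v k0 i + (\<Sum>k\<in>K. d k * v k i)) = 0" using comb[OF i] by simp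
    moreover have "(\<Sum>k\<in>K. d k * (c k - c k0) * v k i)
      = (\<Sum>k\<in>K. d k * (c k * v k i)) - c k0 * (\<Sum>k\<in>K. d k * v k i)"
      by (simp add: algebra_simps sum_distrib_left sum_subtractf)
    moreover have "(\<Sum>k\<in>K. d k * (c k * v k i)) - c k0 * (\<Sum>k\<in>K. d k * v k i)
      = (d k0 * (c k0 * v k0 i) + (\<Sum>k\<in>K. d k * (c k * v k i)))
        - c k0 * (d k0 * v k0 i + (\<Sum>k\<in>K. d k * v k i))"
      by (simp add: algebra_simps)
    ultimately show ?thesis by (simp only: diff_zero)
  qed
  hence "d k * (c k - c k0) = 0" if "k \<in> K" for k
    using insert.IH[of "\<lambda>k. d k * (c k - c k0)" k] insert.prems that by (simp add: inj_on_insert)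
  moreover have "c k \<noteq> c k0" if "k \<in> K" for k
    using insert.prems(1) insert.hyps(2) that by (auto simp: inj_on_def)
  ultimately have K: "d k = 0" if "k \<in> K" for k using that by force
  moreover have "d k0 = 0"
  proof -
    obtain i where i: "i \<in> S" "v k0 i \<noteq> 0" using insert.prems(3)[of k0] by blast
    with comb[OF i(1)] K show ?thesis by simp
  qed
  ultimately show ?case using insert.prems(5) by auto
qed simp

lemma primitive_root_inj:
  fixes \<omega> :: "'k::field"
  assumes "primitive_root_of_unity n \<omega>"
  shows "inj_on (\<lambda>k. \<omega> ^ k) {..<n}"
proof -
  have nz: "\<omega> \<noteq> 0" if "n > 0"
    using assms that by (auto simp: primitive_root_of_unity_def zero_power)
  have "k = l" if "k \<le> l" "l < n" "\<omega> ^ k = \<omega> ^ l" for k l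
  proof (rule ccontr)
    assume "k \<noteq> l"
    have "\<omega> ^ k * \<omega> ^ (l - k) = \<omega> ^ l" using that(1) by (metis le_add_diff_inverse power_add)
    hence "\<omega> ^ k * \<omega> ^ (l - k) = \<omega> ^ k * 1" using that by simp
    hence "\<omega> ^ (l - k) = 1" using nz that by simp
    thus False using assms that \<open>k \<noteq> l\<close> by (auto simp: primitive_root_of_unity_def)
  qed
  thus ?thesis by (intro inj_onI) (metis lessThan_iff nle_le)
qed

text \<open>The operator of \<open>(0, 1)\<close> would move an eigenvector of the operator of \<open>(1, 0)\<close> through
  \<open>q\<close> distinct eigenvalues.\<close>

lemma quantum_torus_trivial:
  fixes K :: "int \<times> int \<Rightarrow> 's \<Rightarrow> 's \<Rightarrow> 'k::field_char_0"
  assumes S: "finite S" "card S < q" and q1: "q > 1" and \<omega>: "primitive_root_of_unity q \<omega>"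
    and comp: "\<And>g h i l. g \<in> {0..<int q} \<times> {0..<int q} \<Longrightarrow> h \<in> {0..<int q} \<times> {0..<int q} \<Longrightarrow>
      i \<in> S \<Longrightarrow> l \<in> S \<Longrightarrow> (\<Sum>n\<in>S. K g i n * K h n l) = \<omega> ^ (nat (snd h) * nat (fst g)) * K (g \<otimes>\<^bsub>Zq_Zq q\<^esub> h) i l"
    and g: "g \<in> {0..<int q} \<times> {0..<int q}" and i: "i \<in> S" and l: "l \<in> S"
  shows "K g i l = 0"
proof (rule ccontr)
  assume nz: "K g i l \<noteq> 0"
  let ?Q = "{0..<int q} \<times> {0..<int q}"
  let ?U = "\<lambda>g. kapp S (K g)"
  have q0: "int q > 0" using q1 by simp
  have mult: "(x, y) \<otimes>\<^bsub>Zq_Zq q\<^esub> (x', y') = ((x + x') mod int q, (y + y') mod int q)" for x y x' y'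
    by (simp add: Zq_Zq_def)
  have \<omega>q: "\<omega> ^ q = 1" using \<omega> by (simp add: primitive_root_of_unity_def)
  have \<omega>0: "\<omega> \<noteq> 0" using \<omega>q q1 by (metis power_0_left zero_neq_one not_one_less_zero)
  have U: "?U g (?U h v) i = \<omega> ^ (nat (snd h) * nat (fst g)) * ?U (g \<otimes>\<^bsub>Zq_Zq q\<^esub> h) v i"
    if "g \<in> ?Q" "h \<in> ?Q" "i \<in> S" for g h v i
  proof -
    have "?U g (?U h v) i = (\<Sum>l\<in>S. (\<Sum>n\<in>S. K g i n * K h n l) * v l)"
      by (simp only: kapp_kapp) (simp add: kapp_def)
    also have "\<dots> = (\<Sum>l\<in>S. \<omega> ^ (nat (snd h) * nat (fst g)) * K (g \<otimes>\<^bsub>Zq_Zq q\<^esub> h) i l * v l)"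
      using that by (intro sum.cong) (simp_all only: comp)
    finally show ?thesis by (simp add: kapp_def sum_distrib_left mult.assoc)
  qed
  \<comment> \<open>The column l of \<open>K g\<close>, nonzero at i. \<open>K (0, 0)\<close> need
    not be the identity, but it fixes this column because (0, 0) g = g with trivial cocycle.\<close>
  define \<psi> where "\<psi> = ?U g (\<lambda>n. if n = l then 1 else 0)"
  have \<psi>i: "\<psi> i = K g i l"
    using S l by (simp add: \<psi>_def kapp_def if_distrib[of "\<lambda>z. K g i _ * z"] cong: if_cong)
  have \<psi>1: "?U (0, 0) \<psi> i = \<psi> i" if "i \<in> S" for i
    using U[of "(0, 0)" g i] g that q0 unfolding \<psi>_def by (cases g) (simp add: mult)
  \<comment> \<open>The operators of (s, 0) compose without cocycle, like a cyclic group of order q.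
    This sum is q times the component of \<psi> on which (1, 0) acts by \<omega>^(-k).\<close>
  define \<phi> where "\<phi> k i = (\<Sum>s<q. \<omega> ^ (k * s) * ?U (int s, 0) \<psi> i)" for k i
  have geo: "(\<Sum>k<q. \<omega> ^ (k * s)) = (if s = 0 then of_nat q else 0)" if "s < q" for s
  proof (cases "s = 0")
    case False
    have "(\<omega> ^ s - 1) * (\<Sum>k<q. (\<omega> ^ s) ^ k) = (\<omega> ^ s) ^ q - 1"
      by (rule power_diff_1_eq[symmetric])
    also have "(\<omega> ^ s) ^ q = 1" by (metis \<omega>q mult.commute power_mult power_one)
    finally have "(\<omega> ^ s - 1) * (\<Sum>k<q. (\<omega> ^ s) ^ k) = 0" by simp
    moreover have "\<omega> ^ s \<noteq> 1" using \<omega> that False by (auto simp: primitive_root_of_unity_def)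
    ultimately have "(\<Sum>k<q. (\<omega> ^ s) ^ k) = 0" by simp
    thus ?thesis using False by (simp add: power_mult[symmetric] mult.commute)
  qed simp
  \<comment> \<open>The components add up to q \<psi>, so one of them is nonzero at i.\<close>
  have "(\<Sum>k<q. \<phi> k i) = (\<Sum>s<q. (\<Sum>k<q. \<omega> ^ (k * s)) * ?U (int s, 0) \<psi> i)"
    unfolding \<phi>_def sum_distrib_right by (rule sum.swap)
  also have "\<dots> = (\<Sum>s<q. if s = 0 then of_nat q * ?U (int s, 0) \<psi> i else 0)"
    by (intro sum.cong) (auto simp: geo)
  also have "\<dots> = of_nat q * \<psi> i" using q1 \<psi>1 i by simp
  finally have "(\<Sum>k<q. \<phi> k i) \<noteq> 0" using nz \<psi>i q1 by simp
  then obtain k where k: "k < q" "\<phi> k i \<noteq> 0" by (meson lessThan_iff sum.neutral)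
  define c where "c = inverse (\<omega> ^ k)"
  have c: "\<omega> ^ k * c = 1" "c \<noteq> 0" using \<omega>0 by (simp_all add: c_def)
  have eig: "?U (1, 0) (\<phi> k) j = c * \<phi> k j" if j: "j \<in> S" for j
  proof -
    \<comment> \<open>The summands of \<open>\<phi> k\<close>, with the index wrapped so that f(q) =
      f(0). Applying (1, 0) and multiplying by \<omega>^k shifts the sum cyclically.\<close>
    define f where "f s = \<omega> ^ (k * s) * ?U (int s mod int q, 0) \<psi> j" for s
    have per: "f q = f 0" using \<omega>q by (simp add: f_def power_mult mult.commute[of k])
    have "\<omega> ^ k * ?U (1, 0) (\<phi> k) j = (\<Sum>s<q. \<omega> ^ k * (\<omega> ^ (k * s) * ?U (1, 0) (?U (int s, 0) \<psi>) j))"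
    proof -
      have "\<phi> k = (\<lambda>i. \<Sum>s<q. \<omega> ^ (k * s) * ?U (int s, 0) \<psi> i)" by (rule ext) (rule \<phi>_def)
      hence "?U (1, 0) (\<phi> k) = (\<lambda>i. \<Sum>s<q. \<omega> ^ (k * s) * ?U (1, 0) (?U (int s, 0) \<psi>) i)"
        by (simp only: kapp_sum kapp_scale)
      thus ?thesis by (simp add: sum_distrib_left)
    qed
    also have "\<dots> = (\<Sum>s<q. f (Suc s))"
    proof (rule sum.cong[OF refl])
      fix s assume "s \<in> {..<q}"
      hence "?U (1, 0) (?U (int s, 0) \<psi>) j = ?U (int (Suc s) mod int q, 0) \<psi> j"
        using U[of "(1, 0)" "(int s, 0)" j] j q1 by (simp add: mult)
      thus "\<omega> ^ k * (\<omega> ^ (k * s) * ?U (1, 0) (?U (int s, 0) \<psi>) j) = f (Suc s)"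
        by (simp only: f_def mult_Suc_right power_add mult.assoc)
    qed
    also have "\<dots> = (\<Sum>s<q. f s)"
      using sum.lessThan_Suc_shift[of f q] sum.lessThan_Suc[of f q] per by (simp del: sum.lessThan_Suc)
    also have "\<dots> = \<phi> k j" unfolding \<phi>_def f_def by (rule sum.cong) auto
    finally have "\<omega> ^ k * ?U (1, 0) (\<phi> k) j = \<phi> k j" .
    thus ?thesis using c by (metis mult.assoc mult.commute mult_1_left)
  qed
  have unit: "?U (0, 0) (\<phi> k) j = \<phi> k j" if j: "j \<in> S" for j
  proof -
    have "\<phi> k = (\<lambda>i. \<Sum>s<q. \<omega> ^ (k * s) * ?U (int s, 0) \<psi> i)" by (rule ext) (rule \<phi>_def)
    hence "?U (0, 0) (\<phi> k) j = (\<Sum>s<q. \<omega> ^ (k * s) * ?U (0, 0) (?U (int s, 0) \<psi>) j)"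
      by (simp only: kapp_sum kapp_scale)
    also have "\<dots> = \<phi> k j"
      unfolding \<phi>_def using U[of "(0, 0)" "(int _, 0)" j] j q1 by (intro sum.cong) (simp_all add: mult)
    finally show ?thesis .
  qed
  \<comment> \<open>Moving (1, 0) past (0, r) costs \<omega>^r, so these vectors have eigenvalues c
    \<omega>^r under (1, 0).\<close>
  define \<chi> where "\<chi> r = ?U (0, int r) (\<phi> k)" for r
  have "?U (1, 0) (\<chi> r) j = (c * \<omega> ^ r) * \<chi> r j" if r: "r < q" and j: "j \<in> S" for r j
  proof -
    have "?U (1, 0) (\<chi> r) j = \<omega> ^ r * ?U (1, int r) (\<phi> k) j"
      using U[of "(1, 0)" "(0, int r)" j] r j q1 by (simp add: mult \<chi>_def)
    also have "?U (1, int r) (\<phi> k) j = ?U (0, int r) (?U (1, 0) (\<phi> k)) j"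
      using U[of "(0, int r)" "(1, 0)" j] r j q1 by (simp add: mult)
    also have "?U (0, int r) (?U (1, 0) (\<phi> k)) = ?U (0, int r) (\<lambda>j. c * \<phi> k j)"
      by (rule kapp_cong) (rule eig)
    finally show ?thesis by (simp add: kapp_scale \<chi>_def)
  qed
  \<comment> \<open>The operator of (0, -r) brings \<open>\<chi> r\<close> back to
    \<open>\<phi> k\<close>; the cocycle is trivial because both first coordinates are 0.\<close>
  moreover have "\<exists>j\<in>S. \<chi> r j \<noteq> 0" if r: "r < q" for r
  proof (rule ccontr)
    assume "\<not> (\<exists>j\<in>S. \<chi> r j \<noteq> 0)"
    hence "?U (0, (- int r) mod int q) (\<chi> r) = ?U (0, (- int r) mod int q) (\<lambda>_. 0)"
      by (intro kapp_cong) blast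
    hence "?U (0, (- int r) mod int q) (\<chi> r) i = 0" by (simp add: kapp_def)
    moreover have "?U (0, (- int r) mod int q) (\<chi> r) i = ?U (0, 0) (\<phi> k) i"
      using U[of "(0, (- int r) mod int q)" "(0, int r)" i] r i q0 by (simp add: mult mod_simps \<chi>_def)
    ultimately show False using unit[OF i] k by simp
  qed
  moreover have "inj_on (\<lambda>r. c * \<omega> ^ r) {..<q}"
    using primitive_root_inj[OF \<omega>] c(2) by (auto simp: inj_on_def)
  moreover obtain d where d: "\<exists>r\<in>{..<q}. d r \<noteq> 0" "\<forall>j\<in>S. (\<Sum>r<q. d r * \<chi> r j) = 0"
    using linear_dependence[of S "{..<q}" \<chi>] S by auto
  ultimately show False
    using eigenvectors_independent[of "{..<q}" "\<lambda>r. c * \<omega> ^ r" S "K (1, 0)" \<chi> d] by auto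
qed

section \<open>Bicharacters and quasitriangular structures\<close>

text \<open>\<open>qt_support\<close> isolates the consequence of the quantum torus argument, so
  that the passage to bicharacters can be made for any abelian G.\<close>

locale ab_ext_abelian = ab_ext_data G F act \<tau> + G: comm_group G
  for G :: "'g monoid" (structure) and F :: "'f monoid" and act :: "'g \<Rightarrow> 'f \<Rightarrow> 'g"
    and \<tau> :: "'g \<Rightarrow> 'g \<Rightarrow> 'f \<Rightarrow> 'k::field" +
  assumes \<tau>_one: "g \<in> carrier G \<Longrightarrow> h \<in> carrier G \<Longrightarrow> \<tau> g h \<one>\<^bsub>F\<^esub> = 1"
    and qt_support: "is_qt_left R \<Longrightarrow> is_qt_right R \<Longrightarrow> u \<in> carrier G \<Longrightarrow> n \<in> carrier F \<Longrightarrow>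
      v \<in> carrier G \<Longrightarrow> l \<in> carrier F \<Longrightarrow> R ((u, n), (v, l)) \<noteq> 0 \<Longrightarrow> n = \<one>\<^bsub>F\<^esub> \<and> l = \<one>\<^bsub>F\<^esub>"
begin

text \<open>The element of the tensor square with coefficient w(u,v) at e_u \<otimes> e_v. The e_u
  are orthogonal idempotents, so multiplication by it is diagonal and invertibility is
  pointwise.\<close>

definition R_of :: "('g \<Rightarrow> 'g \<Rightarrow> 'k) \<Rightarrow> ('g \<times> 'f) \<times> ('g \<times> 'f) \<Rightarrow> 'k" where
  "R_of w = (\<lambda>((u, n), (v, l)).
     if u \<in> carrier G \<and> v \<in> carrier G \<and> n = \<one>\<^bsub>F\<^esub> \<and> l = \<one>\<^bsub>F\<^esub> then w u v else 0)"

lemma R_of_apply: "R_of w ((u, n), (v, l)) =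
   (if u \<in> carrier G \<and> v \<in> carrier G \<and> n = \<one>\<^bsub>F\<^esub> \<and> l = \<one>\<^bsub>F\<^esub> then w u v else 0)"
  by (simp add: R_of_def)

lemma hone_H2: "hone (H \<otimes>\<^sub>H H) ((u, n), (v, l)) =
   (if u \<in> carrier G \<and> v \<in> carrier G \<and> n = \<one>\<^bsub>F\<^esub> \<and> l = \<one>\<^bsub>F\<^esub> then 1 else 0)"
  by (simp add: hopf_tensor_def tens_def hone_H)

lemma hprod_R_of:
  assumes "u \<in> carrier G" "n \<in> carrier F" "v \<in> carrier G" "l \<in> carrier F"
  shows "hprod (H \<otimes>\<^sub>H H) (R_of w) Y ((u, n), (v, l)) = w u v * Y ((u, n), (v, l))"
proof -
  have "hprod (H \<otimes>\<^sub>H H) (R_of w) Y ((u, n), (v, l)) = (\<Sum>f\<in>carrier F. \<Sum>f'\<in>carrier F.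
     (if f = \<one>\<^bsub>F\<^esub> \<and> f' = \<one>\<^bsub>F\<^esub> then w u v else 0) *
     Y ((act u f, inv\<^bsub>F\<^esub> f \<otimes>\<^bsub>F\<^esub> n), (act v f', inv\<^bsub>F\<^esub> f' \<otimes>\<^bsub>F\<^esub> l)))"
    unfolding hprod_H2[OF assms] using assms by (intro sum.cong refl) (simp add: R_of_apply)
  also have "\<dots> = w u v * Y ((act u \<one>\<^bsub>F\<^esub>, inv\<^bsub>F\<^esub> \<one>\<^bsub>F\<^esub> \<otimes>\<^bsub>F\<^esub> n), (act v \<one>\<^bsub>F\<^esub>, inv\<^bsub>F\<^esub> \<one>\<^bsub>F\<^esub> \<otimes>\<^bsub>F\<^esub> l))"
    by (intro sum_sum_delta) simp_all
  finally show ?thesis using assms by simp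
qed

lemma hinvertible_R_of_iff:
  "hinvertible (H \<otimes>\<^sub>H H) (R_of w) \<longleftrightarrow> (\<forall>u\<in>carrier G. \<forall>v\<in>carrier G. w u v \<noteq> 0)"
proof
  assume "hinvertible (H \<otimes>\<^sub>H H) (R_of w)"
  then obtain Y where Y: "hprod (H \<otimes>\<^sub>H H) (R_of w) Y = hone (H \<otimes>\<^sub>H H)"
    unfolding hinvertible_def by blast
  show "\<forall>u\<in>carrier G. \<forall>v\<in>carrier G. w u v \<noteq> 0"
  proof (intro ballI)
    fix u v assume "u \<in> carrier G" "v \<in> carrier G"
    hence "w u v * Y ((u, \<one>\<^bsub>F\<^esub>), (v, \<one>\<^bsub>F\<^esub>)) = 1"
      using hprod_R_of[of u "\<one>\<^bsub>F\<^esub>" v "\<one>\<^bsub>F\<^esub>" w Y] by (simp add: Y hone_H2)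
    thus "w u v \<noteq> 0" by auto
  qed
next
  assume nz: "\<forall>u\<in>carrier G. \<forall>v\<in>carrier G. w u v \<noteq> 0"
  have *: "hprod (H \<otimes>\<^sub>H H) (R_of x) (R_of y) = hone (H \<otimes>\<^sub>H H)"
    if xy: "\<And>u v. u \<in> carrier G \<Longrightarrow> v \<in> carrier G \<Longrightarrow> x u v * y u v = 1" for x y
  proof
    fix c :: "('g \<times> 'f) \<times> ('g \<times> 'f)"
    obtain u n v l where c: "c = ((u, n), (v, l))" by (metis surj_pair)
    show "hprod (H \<otimes>\<^sub>H H) (R_of x) (R_of y) c = hone (H \<otimes>\<^sub>H H) c"
    proof (cases "c \<in> basis H \<times> basis H")
      case True
      thus ?thesis unfolding c by (simp add: hprod_R_of hone_H2 R_of_apply xy)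
    next
      case False
      thus ?thesis unfolding hprod_H2_outside[OF False] unfolding c by (auto simp: hone_H2)
    qed
  qed
  let ?Y = "R_of (\<lambda>u v. inverse (w u v))"
  have "?Y \<in> vecs (basis (H \<otimes>\<^sub>H H))"
    by (auto simp: vecs_def R_of_def)
  moreover have "hprod (H \<otimes>\<^sub>H H) (R_of w) ?Y = hone (H \<otimes>\<^sub>H H)" "hprod (H \<otimes>\<^sub>H H) ?Y (R_of w) = hone (H \<otimes>\<^sub>H H)"
    using nz by (auto intro!: *)
  ultimately show "hinvertible (H \<otimes>\<^sub>H H) (R_of w)" unfolding hinvertible_def by blast
qed

lemma is_qt_left_R_of_iff:
  "is_qt_left (R_of w) \<longleftrightarrow> (\<forall>u\<in>carrier G. \<forall>v\<in>carrier G. \<forall>x\<in>carrier G. w (u \<otimes> v) x = w u x * w v x)"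
proof -
  have "(\<Sum>f\<in>carrier F. R_of w ((u, n), (x, f)) * R_of w ((v, l), (act x f, inv\<^bsub>F\<^esub> f \<otimes>\<^bsub>F\<^esub> k)))
     = (if n = \<one>\<^bsub>F\<^esub> \<and> l = \<one>\<^bsub>F\<^esub> \<and> k = \<one>\<^bsub>F\<^esub> then w u x * w v x else 0)"
    if "u \<in> carrier G" "n \<in> carrier F" "v \<in> carrier G" "l \<in> carrier F" "x \<in> carrier G" "k \<in> carrier F"
    for u n v l x k
  proof -
    have "(\<Sum>f\<in>carrier F. R_of w ((u, n), (x, f)) * R_of w ((v, l), (act x f, inv\<^bsub>F\<^esub> f \<otimes>\<^bsub>F\<^esub> k)))
      = (\<Sum>f\<in>carrier F. if f = \<one>\<^bsub>F\<^esub> then (if n = \<one>\<^bsub>F\<^esub> \<and> l = \<one>\<^bsub>F\<^esub> \<and> k = \<one>\<^bsub>F\<^esub> then w u x * w v x else 0) else 0)"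
      using that by (intro sum.cong) (auto simp: R_of_apply)
    thus ?thesis by simp
  qed
  hence eq: "is_qt_left (R_of w) \<longleftrightarrow> (\<forall>u\<in>carrier G. \<forall>n\<in>carrier F. \<forall>v\<in>carrier G. \<forall>l\<in>carrier F. \<forall>x\<in>carrier G. \<forall>k\<in>carrier F.
     (if n = \<one>\<^bsub>F\<^esub> \<and> l = \<one>\<^bsub>F\<^esub> \<and> k = \<one>\<^bsub>F\<^esub> then w (u \<otimes> v) x else 0) =
     (if n = \<one>\<^bsub>F\<^esub> \<and> l = \<one>\<^bsub>F\<^esub> \<and> k = \<one>\<^bsub>F\<^esub> then w u x * w v x else 0))"
    unfolding is_qt_left_def by (intro ball_cong refl) (auto simp: R_of_apply \<tau>_one)
  show ?thesis
  proof
    assume *: "is_qt_left (R_of w)"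
    show "\<forall>u\<in>carrier G. \<forall>v\<in>carrier G. \<forall>x\<in>carrier G. w (u \<otimes> v) x = w u x * w v x"
    proof (intro ballI)
      fix u v x assume "u \<in> carrier G" "v \<in> carrier G" "x \<in> carrier G"
      from *[unfolded eq, rule_format, OF this(1) F.one_closed this(2) F.one_closed this(3) F.one_closed]
      show "w (u \<otimes> v) x = w u x * w v x" by simp
    qed
  qed (simp add: eq)
qed

lemma is_qt_right_R_of_iff:
  "is_qt_right (R_of w) \<longleftrightarrow> (\<forall>u\<in>carrier G. \<forall>v\<in>carrier G. \<forall>x\<in>carrier G. w u (v \<otimes> x) = w u v * w u x)"
proof -
  have "(\<Sum>f\<in>carrier F. R_of w ((u, f), (x, k)) * R_of w ((act u f, inv\<^bsub>F\<^esub> f \<otimes>\<^bsub>F\<^esub> n), (v, l)))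
     = (if n = \<one>\<^bsub>F\<^esub> \<and> l = \<one>\<^bsub>F\<^esub> \<and> k = \<one>\<^bsub>F\<^esub> then w u v * w u x else 0)"
    if "u \<in> carrier G" "n \<in> carrier F" "v \<in> carrier G" "l \<in> carrier F" "x \<in> carrier G" "k \<in> carrier F"
    for u n v l x k
  proof -
    have "(\<Sum>f\<in>carrier F. R_of w ((u, f), (x, k)) * R_of w ((act u f, inv\<^bsub>F\<^esub> f \<otimes>\<^bsub>F\<^esub> n), (v, l)))
      = (\<Sum>f\<in>carrier F. if f = \<one>\<^bsub>F\<^esub> then (if n = \<one>\<^bsub>F\<^esub> \<and> l = \<one>\<^bsub>F\<^esub> \<and> k = \<one>\<^bsub>F\<^esub> then w u v * w u x else 0) else 0)"
      using that by (intro sum.cong) (auto simp: R_of_apply)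
    thus ?thesis by simp
  qed
  hence eq: "is_qt_right (R_of w) \<longleftrightarrow> (\<forall>u\<in>carrier G. \<forall>n\<in>carrier F. \<forall>v\<in>carrier G. \<forall>l\<in>carrier F. \<forall>x\<in>carrier G. \<forall>k\<in>carrier F.
     (if n = \<one>\<^bsub>F\<^esub> \<and> l = \<one>\<^bsub>F\<^esub> \<and> k = \<one>\<^bsub>F\<^esub> then w u (v \<otimes> x) else 0) =
     (if n = \<one>\<^bsub>F\<^esub> \<and> l = \<one>\<^bsub>F\<^esub> \<and> k = \<one>\<^bsub>F\<^esub> then w u v * w u x else 0))"
    unfolding is_qt_right_def by (intro ball_cong refl) (auto simp: R_of_apply \<tau>_one)
  show ?thesis
  proof
    assume *: "is_qt_right (R_of w)"
    show "\<forall>u\<in>carrier G. \<forall>v\<in>carrier G. \<forall>x\<in>carrier G. w u (v \<otimes> x) = w u v * w u x"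
    proof (intro ballI)
      fix u v x assume "u \<in> carrier G" "v \<in> carrier G" "x \<in> carrier G"
      from *[unfolded eq, rule_format, OF this(1) F.one_closed this(2) F.one_closed this(3) F.one_closed]
      show "w u (v \<otimes> x) = w u v * w u x" by simp
    qed
  qed (simp add: eq)
qed

text \<open>Both R-values vanish unless n = l = i. There the two conditions on g agree, because both
  say that g is the product of u and v in an abelian group.\<close>

lemma is_qt_op_R_of_iff:
  "is_qt_op (R_of w) \<longleftrightarrow> (\<forall>u\<in>carrier G. \<forall>v\<in>carrier G. \<forall>i\<in>carrier F.
     \<tau> v u i * w (act u i) (act v i) = \<tau> u v i * w u v)"
proof
  assume *: "is_qt_op (R_of w)"
  show "\<forall>u\<in>carrier G. \<forall>v\<in>carrier G. \<forall>i\<in>carrier F. \<tau> v u i * w (act u i) (act v i) = \<tau> u v i * w u v"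
  proof (intro ballI)
    fix u v i assume c: "u \<in> carrier G" "v \<in> carrier G" "i \<in> carrier F"
    have "v \<otimes> u \<in> carrier G" using c by simp
    from *[unfolded is_qt_op_def, rule_format, OF this c(3,1,3,2,3)] c
    show "\<tau> v u i * w (act u i) (act v i) = \<tau> u v i * w u v"
      by (simp add: R_of_apply G.m_comm)
  qed
next
  assume *: "\<forall>u\<in>carrier G. \<forall>v\<in>carrier G. \<forall>i\<in>carrier F. \<tau> v u i * w (act u i) (act v i) = \<tau> u v i * w u v"
  show "is_qt_op (R_of w)"
    unfolding is_qt_op_def
  proof (intro ballI)
    fix g i u n v l
    assume c: "g \<in> carrier G" "i \<in> carrier F" "u \<in> carrier G" "n \<in> carrier F" "v \<in> carrier G" "l \<in> carrier F"
    have r: "n \<otimes>\<^bsub>F\<^esub> inv\<^bsub>F\<^esub> i = \<one>\<^bsub>F\<^esub> \<longleftrightarrow> n = i" if "n \<in> carrier F" for n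
      using that c(2) by (metis F.inv_closed F.inv_equality F.inv_inv F.r_inv)
    show "(if v \<otimes> u = g then \<tau> v u i * R_of w ((act u i, inv\<^bsub>F\<^esub> i \<otimes>\<^bsub>F\<^esub> n), (act v i, inv\<^bsub>F\<^esub> i \<otimes>\<^bsub>F\<^esub> l)) else 0) =
      (if act u (n \<otimes>\<^bsub>F\<^esub> inv\<^bsub>F\<^esub> i) \<otimes> act v (l \<otimes>\<^bsub>F\<^esub> inv\<^bsub>F\<^esub> i) = g
       then \<tau> (act u (n \<otimes>\<^bsub>F\<^esub> inv\<^bsub>F\<^esub> i)) (act v (l \<otimes>\<^bsub>F\<^esub> inv\<^bsub>F\<^esub> i)) i *
         R_of w ((u, n \<otimes>\<^bsub>F\<^esub> inv\<^bsub>F\<^esub> i), (v, l \<otimes>\<^bsub>F\<^esub> inv\<^bsub>F\<^esub> i)) else 0)"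
    proof (cases "n = i \<and> l = i")
      case True
      thus ?thesis using c * by (simp add: R_of_apply G.m_comm[of u v])
    next
      case False
      thus ?thesis using c by (auto simp: R_of_apply r inv_mult_eq_one_iff)
    qed
  qed
qed

lemma quasitriangular_iff_bicharacter:
  "quasitriangular H R \<longleftrightarrow> (\<exists>w. bicharacter G w \<and> R = R_of w \<and>
    (\<forall>u\<in>carrier G. \<forall>v\<in>carrier G. \<forall>i\<in>carrier F. \<tau> v u i * w (act u i) (act v i) = \<tau> u v i * w u v))"
proof -
  have R_of: "quasitriangular H (R_of w) \<longleftrightarrow> bicharacter G w \<and>
    (\<forall>u\<in>carrier G. \<forall>v\<in>carrier G. \<forall>i\<in>carrier F. \<tau> v u i * w (act u i) (act v i) = \<tau> u v i * w u v)" for w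
  proof -
    have "R_of w \<in> vecs (basis H \<times> basis H)" by (auto simp: vecs_def R_of_def)
    thus ?thesis
      unfolding quasitriangular_H_iff hinvertible_R_of_iff is_qt_left_R_of_iff is_qt_right_R_of_iff
        is_qt_op_R_of_iff bicharacter_def by blast
  qed
  have "R = R_of (\<lambda>u v. R ((u, \<one>\<^bsub>F\<^esub>), (v, \<one>\<^bsub>F\<^esub>)))" if "quasitriangular H R"
  proof
    fix c :: "('g \<times> 'f) \<times> ('g \<times> 'f)"
    obtain u n v l where c: "c = ((u, n), (v, l))" by (metis surj_pair)
    have q: "R \<in> vecs (basis H \<times> basis H)" "is_qt_left R" "is_qt_right R"
      using that unfolding quasitriangular_H_iff by auto
    show "R c = R_of (\<lambda>u v. R ((u, \<one>\<^bsub>F\<^esub>), (v, \<one>\<^bsub>F\<^esub>))) c"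
    proof (cases "c \<in> basis H \<times> basis H")
      case True
      hence m: "u \<in> carrier G" "n \<in> carrier F" "v \<in> carrier G" "l \<in> carrier F"
        by (simp_all add: c)
      show ?thesis
      proof (cases "n = \<one>\<^bsub>F\<^esub> \<and> l = \<one>\<^bsub>F\<^esub>")
        case True
        with m show ?thesis by (simp add: c R_of_apply)
      next
        case False
        with qt_support[OF q(2,3) m] have "R c = 0" unfolding c by blast
        with False show ?thesis unfolding c R_of_apply by (simp only: simp_thms if_False)
      qed
    next
      case False
      hence "R c = 0" using q(1) unfolding vecs_def by blast
      with False show ?thesis unfolding c by (auto simp: R_of_apply)
    qed
  qed
  with R_of show ?thesis by metis
qed

end

section \<open>Matrices of the twisted group algebra extracted from R\<close>

context ab_ext_data begin

text \<open>The kernel in (i, k) is the matrix of the element with coefficients R(.,.;h,l) on the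
  module with basis F induced from the point u. Substituting n = i f turns matrix composition into
  the second axiom at \<open>act u i\<close>, which reverses the order of g and h.\<close>

lemma qt_right_kernel:
  assumes R: "is_qt_right R" and c: "u \<in> carrier G" "g \<in> carrier G" "h \<in> carrier G"
    "l \<in> carrier F" "i \<in> carrier F" "k \<in> carrier F"
  shows "(\<Sum>n\<in>carrier F. R ((act u i, inv\<^bsub>F\<^esub> i \<otimes>\<^bsub>F\<^esub> n), (g, l)) * R ((act u n, inv\<^bsub>F\<^esub> n \<otimes>\<^bsub>F\<^esub> k), (h, l)))
    = \<tau> h g l * R ((act u i, inv\<^bsub>F\<^esub> i \<otimes>\<^bsub>F\<^esub> k), (h \<otimes> g, l))"
proof -
  have "(\<Sum>n\<in>carrier F. R ((act u i, inv\<^bsub>F\<^esub> i \<otimes>\<^bsub>F\<^esub> n), (g, l)) * R ((act u n, inv\<^bsub>F\<^esub> n \<otimes>\<^bsub>F\<^esub> k), (h, l)))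
    = (\<Sum>f\<in>carrier F. R ((act u i, inv\<^bsub>F\<^esub> i \<otimes>\<^bsub>F\<^esub> (i \<otimes>\<^bsub>F\<^esub> f)), (g, l)) *
        R ((act u (i \<otimes>\<^bsub>F\<^esub> f), inv\<^bsub>F\<^esub> (i \<otimes>\<^bsub>F\<^esub> f) \<otimes>\<^bsub>F\<^esub> k), (h, l)))"
    by (rule F.sum_left_translate[OF c(5), symmetric])
  also have "\<dots> = (\<Sum>f\<in>carrier F. R ((act u i, f), (g, l)) *
        R ((act (act u i) f, inv\<^bsub>F\<^esub> f \<otimes>\<^bsub>F\<^esub> (inv\<^bsub>F\<^esub> i \<otimes>\<^bsub>F\<^esub> k)), (h, l)))"
  proof (rule sum.cong[OF refl])
    fix f assume f: "f \<in> carrier F"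
    have "inv\<^bsub>F\<^esub> i \<otimes>\<^bsub>F\<^esub> (i \<otimes>\<^bsub>F\<^esub> f) = f" using c f by (simp add: F.m_assoc[symmetric])
    moreover have "inv\<^bsub>F\<^esub> (i \<otimes>\<^bsub>F\<^esub> f) \<otimes>\<^bsub>F\<^esub> k = inv\<^bsub>F\<^esub> f \<otimes>\<^bsub>F\<^esub> (inv\<^bsub>F\<^esub> i \<otimes>\<^bsub>F\<^esub> k)"
      using c f by (simp add: F.inv_mult_group F.m_assoc)
    ultimately show "R ((act u i, inv\<^bsub>F\<^esub> i \<otimes>\<^bsub>F\<^esub> (i \<otimes>\<^bsub>F\<^esub> f)), (g, l)) *
        R ((act u (i \<otimes>\<^bsub>F\<^esub> f), inv\<^bsub>F\<^esub> (i \<otimes>\<^bsub>F\<^esub> f) \<otimes>\<^bsub>F\<^esub> k), (h, l))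
      = R ((act u i, f), (g, l)) *
        R ((act (act u i) f, inv\<^bsub>F\<^esub> f \<otimes>\<^bsub>F\<^esub> (inv\<^bsub>F\<^esub> i \<otimes>\<^bsub>F\<^esub> k)), (h, l))"
      using c f by (simp add: act_act)
  qed
  also have "\<dots> = \<tau> h g l * R ((act u i, inv\<^bsub>F\<^esub> i \<otimes>\<^bsub>F\<^esub> k), (h \<otimes> g, l))"
    using R[unfolded is_qt_right_def, rule_format, of "act u i" "inv\<^bsub>F\<^esub> i \<otimes>\<^bsub>F\<^esub> k" h l g l] c by simp
  finally show ?thesis .
qed

text \<open>The same for the second tensor factor. It comes from the first axiom, so the order of g
  and h is kept.\<close>

lemma qt_left_kernel:
  assumes R: "is_qt_left R" and c: "w \<in> carrier G" "g \<in> carrier G" "h \<in> carrier G"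
    "l \<in> carrier F" "i \<in> carrier F" "k \<in> carrier F"
  shows "(\<Sum>n\<in>carrier F. R ((g, l), (act w i, inv\<^bsub>F\<^esub> i \<otimes>\<^bsub>F\<^esub> n)) * R ((h, l), (act w n, inv\<^bsub>F\<^esub> n \<otimes>\<^bsub>F\<^esub> k)))
    = \<tau> g h l * R ((g \<otimes> h, l), (act w i, inv\<^bsub>F\<^esub> i \<otimes>\<^bsub>F\<^esub> k))"
proof -
  have "(\<Sum>n\<in>carrier F. R ((g, l), (act w i, inv\<^bsub>F\<^esub> i \<otimes>\<^bsub>F\<^esub> n)) * R ((h, l), (act w n, inv\<^bsub>F\<^esub> n \<otimes>\<^bsub>F\<^esub> k)))
    = (\<Sum>f\<in>carrier F. R ((g, l), (act w i, inv\<^bsub>F\<^esub> i \<otimes>\<^bsub>F\<^esub> (i \<otimes>\<^bsub>F\<^esub> f))) *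
        R ((h, l), (act w (i \<otimes>\<^bsub>F\<^esub> f), inv\<^bsub>F\<^esub> (i \<otimes>\<^bsub>F\<^esub> f) \<otimes>\<^bsub>F\<^esub> k)))"
    by (rule F.sum_left_translate[OF c(5), symmetric])
  also have "\<dots> = (\<Sum>f\<in>carrier F. R ((g, l), (act w i, f)) *
        R ((h, l), (act (act w i) f, inv\<^bsub>F\<^esub> f \<otimes>\<^bsub>F\<^esub> (inv\<^bsub>F\<^esub> i \<otimes>\<^bsub>F\<^esub> k))))"
  proof (rule sum.cong[OF refl])
    fix f assume f: "f \<in> carrier F"
    have "inv\<^bsub>F\<^esub> i \<otimes>\<^bsub>F\<^esub> (i \<otimes>\<^bsub>F\<^esub> f) = f" using c f by (simp add: F.m_assoc[symmetric])
    moreover have "inv\<^bsub>F\<^esub> (i \<otimes>\<^bsub>F\<^esub> f) \<otimes>\<^bsub>F\<^esub> k = inv\<^bsub>F\<^esub> f \<otimes>\<^bsub>F\<^esub> (inv\<^bsub>F\<^esub> i \<otimes>\<^bsub>F\<^esub> k)"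
      using c f by (simp add: F.inv_mult_group F.m_assoc)
    ultimately show "R ((g, l), (act w i, inv\<^bsub>F\<^esub> i \<otimes>\<^bsub>F\<^esub> (i \<otimes>\<^bsub>F\<^esub> f))) *
        R ((h, l), (act w (i \<otimes>\<^bsub>F\<^esub> f), inv\<^bsub>F\<^esub> (i \<otimes>\<^bsub>F\<^esub> f) \<otimes>\<^bsub>F\<^esub> k))
      = R ((g, l), (act w i, f)) *
        R ((h, l), (act (act w i) f, inv\<^bsub>F\<^esub> f \<otimes>\<^bsub>F\<^esub> (inv\<^bsub>F\<^esub> i \<otimes>\<^bsub>F\<^esub> k)))"
      using c f by (simp add: act_act)
  qed
  also have "\<dots> = \<tau> g h l * R ((g \<otimes> h, l), (act w i, inv\<^bsub>F\<^esub> i \<otimes>\<^bsub>F\<^esub> k))"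
    using R[unfolded is_qt_left_def, rule_format, of g l h l "act w i" "inv\<^bsub>F\<^esub> i \<otimes>\<^bsub>F\<^esub> k"] c by simp
  finally show ?thesis .
qed

end

section \<open>Quasitriangular structures on the second family\<close>

lemma primitive_root_eq_one_iff:
  assumes "primitive_root_of_unity n \<omega>" "n > 0"
  shows "\<omega> ^ k = 1 \<longleftrightarrow> n dvd k"
proof -
  have "\<omega> ^ k = \<omega> ^ (k mod n)"
    using assms by (simp add: power_mod_eq primitive_root_of_unity_def)
  moreover have "\<omega> ^ (k mod n) = 1 \<longleftrightarrow> k mod n = 0"
    using assms by (metis mod_less_divisor neq0_conv power_0 primitive_root_of_unity_def)
  ultimately show ?thesis by (simp add: dvd_eq_mod_eq_0)
qed

lemma primitive_root_power:
  assumes "primitive_root_of_unity q \<zeta>" "prime q" "\<not> q dvd e"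
  shows "primitive_root_of_unity q (\<zeta> ^ e)"
proof -
  have q0: "q > 0" using assms(2) prime_gt_0_nat by blast
  have "(\<zeta> ^ e) ^ q = 1"
    using primitive_root_eq_one_iff[OF assms(1) q0] by (simp flip: power_mult)
  moreover have "(\<zeta> ^ e) ^ i \<noteq> 1" if "0 < i" "i < q" for i
  proof
    assume "(\<zeta> ^ e) ^ i = 1"
    hence "q dvd e * i" by (simp only: power_mult[symmetric] primitive_root_eq_one_iff[OF assms(1) q0])
    hence "q dvd i" using assms(2,3) by (simp add: prime_dvd_mult_iff)
    thus False using that by (auto dest: dvd_imp_le)
  qed
  ultimately show ?thesis by (simp add: primitive_root_of_unity_def)
qed

locale B_lambda =
  fixes p q m lam :: nat and \<zeta> :: "'k::field_char_0"
  assumes p: "prime p" and q: "prime q" and qp: "[q = 1] (mod p)"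
    and mp: "[m ^ p = 1] (mod q)" and m1: "\<not> [m = 1] (mod q)"
    and \<zeta>: "primitive_root_of_unity q \<zeta>" and lam: "lam + 1 < p"
begin

abbreviation G :: "(int \<times> int) monoid" where "G \<equiv> Zq_Zq q"
abbreviation F :: "int monoid" where "F \<equiv> integer_mod_group p"
abbreviation act :: "int \<times> int \<Rightarrow> int \<Rightarrow> int \<times> int" where "act \<equiv> B_act p q m lam"
abbreviation \<tau> :: "int \<times> int \<Rightarrow> int \<times> int \<Rightarrow> int \<Rightarrow> 'k" where "\<tau> \<equiv> B_tau p m \<zeta> lam"

text \<open>The action is given for g^(-i); this is the exponent i with g^n = g^(-i).\<close>

definition neg :: "int \<Rightarrow> nat" where "neg n = nat (- n mod int p)"
definition r :: nat where "r = (m ^ (p - 1)) ^ (lam + 1)"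

lemma p0: "p > 0" "int p > 0" and q0: "q > 0" "int q > 0" and p1: "p > 1" and q1: "q > 1"
  using prime_gt_1_nat[OF p] prime_gt_1_nat[OF q] by simp_all

lemma pq: "p < q"
proof -
  have "p dvd q - 1" using qp q1 by (simp add: cong_altdef_nat)
  thus ?thesis using q1 by (auto dest: dvd_imp_le)
qed

lemma carrier_G: "carrier G = {0..<int q} \<times> {0..<int q}"
  using q0 by (simp add: Zq_Zq_def carrier_integer_mod_group)

lemma carrier_F: "carrier F = {0..<int p}"
  using p0 by (simp add: carrier_integer_mod_group)

lemma mult_G: "(x, y) \<otimes>\<^bsub>G\<^esub> (x', y') = ((x + x') mod int q, (y + y') mod int q)"
  by (simp add: Zq_Zq_def)

lemma one_G: "\<one>\<^bsub>G\<^esub> = (0, 0)"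
  by (simp add: Zq_Zq_def)

lemma comm_group_G: "comm_group G"
proof -
  have "group G" unfolding Zq_Zq_def by (intro DirProd_group) simp_all
  thus ?thesis
    by (rule group.group_comm_groupI) (auto simp: carrier_G mult_G add.commute)
qed

lemma act_apply: "act (x, y) n = ((int (m ^ neg n) * x) mod int q, (int (m ^ (lam * neg n)) * y) mod int q)"
  by (simp add: B_act_def neg_def Let_def)

lemma tau_apply: "\<tau> g h n = (\<zeta> ^ geom (nat n) r) ^ (nat (snd g) * nat (fst h))"
  by (simp add: B_tau_def r_def case_prod_unfold)

lemma int_neg: "int (neg n) = (- n) mod int p"
  using p0 by (simp add: neg_def)

lemma neg_0 [simp]: "neg 0 = 0"
  by (simp add: neg_def)

lemma neg_add: "[neg f' + neg f = neg ((f + f') mod int p)] (mod p)"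
proof -
  have "[int (neg f' + neg f) = int (neg ((f + f') mod int p))] (mod int p)"
    by (simp add: int_neg cong_def mod_simps algebra_simps)
  thus ?thesis by (simp only: cong_int_iff)
qed

lemma cong_mult_mod: "[a = b] (mod q) \<Longrightarrow> (int a * z) mod int q = (int b * z) mod int q"
  by (metis cong_def cong_int_iff cong_scalar_right)

lemma neg_pow_add:
  "[m ^ (k * neg f') * m ^ (k * neg f) = m ^ (k * neg ((f + f') mod int p))] (mod q)"
proof -
  have "[k * (neg f' + neg f) = k * neg ((f + f') mod int p)] (mod p)"
    by (rule cong_scalar_left[OF neg_add])
  from cong_power_exponent[OF mp this] show ?thesis
    by (simp add: distrib_left power_add)
qed

text \<open>(r - 1) times the geometric sum is r^n - 1. If q divided the sum, then m^((p-1)(lam+1)n)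
  would be 1 modulo q. But p - 1, lam + 1 and n lie strictly between 0 and p, so that exponent is
  prime to p, and m^p = 1 would force m = 1.\<close>

lemma primitive_root_tau:
  assumes "n \<in> carrier F" "n \<noteq> 0"
  shows "primitive_root_of_unity q (\<zeta> ^ geom (nat n) r)"
proof (rule primitive_root_power[OF \<zeta> q], rule notI)
  assume "q dvd geom (nat n) r"
  hence "int q dvd int (geom (nat n) r)" by simp
  also have "int (geom (nat n) r) = (\<Sum>i<nat n. int r ^ i)" by (simp add: geom_def)
  finally have "int q dvd (int r - 1) * (\<Sum>i<nat n. int r ^ i)" by (rule dvd_mult)
  also have "(int r - 1) * (\<Sum>i<nat n. int r ^ i) = int (r ^ nat n) - int 1"
    by (simp add: power_diff_1_eq)
  finally have "[int (r ^ nat n) = int 1] (mod int q)" by (simp add: cong_iff_dvd_diff)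
  hence "[r ^ nat n = 1] (mod q)" by (simp only: cong_int_iff)
  hence *: "[m ^ ((p - 1) * (lam + 1) * nat n) = 1] (mod q)"
    by (simp only: r_def power_mult)
  have "\<not> p dvd k" if "0 < k" "k < p" for k using that by (auto dest: dvd_imp_le)
  hence "\<not> p dvd (p - 1) * (lam + 1) * nat n"
    using p p1 lam assms by (auto simp: prime_dvd_mult_iff carrier_F simp del: mult_Suc_right add_Suc_right)
  hence "coprime ((p - 1) * (lam + 1) * nat n) p"
    using p by (metis coprime_commute prime_imp_coprime_nat)
  with cong_power_one_coprime[OF * mp] m1 show False by blast
qed

lemma act_hom: "act (g \<otimes>\<^bsub>G\<^esub> h) n = act g n \<otimes>\<^bsub>G\<^esub> act h n"
  by (cases g; cases h) (simp add: act_apply mult_G mod_simps distrib_left)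

sublocale ab_ext_abelian G F act \<tau>
proof -
  interpret G: comm_group G by (rule comm_group_G)
  interpret F: comm_group F by simp
  interpret ab_ext_data G F act \<tau>
  proof
    show "finite (carrier G)" "finite (carrier F)" by (simp_all add: carrier_G carrier_F)
    show "act g f \<in> carrier G" for g f
      using q0 by (cases g) (simp add: act_apply carrier_G)
    show "act g \<one>\<^bsub>F\<^esub> = g" if "g \<in> carrier G" for g
      using that by (cases g) (simp add: act_apply carrier_G)
    show "act (act g f) f' = act g (f \<otimes>\<^bsub>F\<^esub> f')" for g f f'
    proof -
      obtain x y where g: "g = (x, y)" by (metis surj_pair)
      have "(int (m ^ (k * neg f')) * ((int (m ^ (k * neg f)) * z) mod int q)) mod int q
        = (int (m ^ (k * neg ((f + f') mod int p))) * z) mod int q" for k z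
        using cong_mult_mod[OF neg_pow_add, of k f' f z] by (simp add: mod_mult_right_eq mult.assoc)
      from this[of 1 x] this[of lam y] show ?thesis by (simp add: g act_apply)
    qed
  qed
  show "ab_ext_abelian G F act \<tau>"
  proof
    show "\<tau> g h \<one>\<^bsub>F\<^esub> = 1" for g h by (simp add: tau_apply geom_def)
    fix R u n v l
    assume R: "is_qt_left R" "is_qt_right R"
      and c: "u \<in> carrier G" "n \<in> carrier F" "v \<in> carrier G" "l \<in> carrier F"
      and nz: "R ((u, n), (v, l)) \<noteq> 0"
    have card: "card (carrier F) < q" using pq by (simp add: carrier_F)
    have one: "inv\<^bsub>F\<^esub> \<one>\<^bsub>F\<^esub> \<otimes>\<^bsub>F\<^esub> k = k" if "k \<in> carrier F" for k
      using that by (simp only: F.inv_one F.l_one)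
    have "l = 0"
    proof (rule ccontr)
      assume l: "l \<noteq> 0"
      \<comment> \<open>At i = 1 the kernel entry is R itself. Commutativity of G puts the reversed
        product into the form that the quantum torus lemma expects.\<close>
      have "R ((act u \<one>\<^bsub>F\<^esub>, inv\<^bsub>F\<^esub> \<one>\<^bsub>F\<^esub> \<otimes>\<^bsub>F\<^esub> n), (v, l)) = 0"
      proof (rule quantum_torus_trivial[OF fin_F card q1 primitive_root_tau[OF c(4) l],
            where K = "\<lambda>h i k. R ((act u i, inv\<^bsub>F\<^esub> i \<otimes>\<^bsub>F\<^esub> k), (h, l))"])
        fix g h i k assume gh: "g \<in> {0..<int q} \<times> {0..<int q}" "h \<in> {0..<int q} \<times> {0..<int q}"
          and ik: "i \<in> carrier F" "k \<in> carrier F"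
        have gh': "g \<in> carrier G" "h \<in> carrier G" using gh by (simp_all only: carrier_G)
        show "(\<Sum>n\<in>carrier F. R ((act u i, inv\<^bsub>F\<^esub> i \<otimes>\<^bsub>F\<^esub> n), (g, l)) * R ((act u n, inv\<^bsub>F\<^esub> n \<otimes>\<^bsub>F\<^esub> k), (h, l)))
          = (\<zeta> ^ geom (nat l) r) ^ (nat (snd h) * nat (fst g)) *
            R ((act u i, inv\<^bsub>F\<^esub> i \<otimes>\<^bsub>F\<^esub> k), (g \<otimes>\<^bsub>G\<^esub> h, l))"
          unfolding qt_right_kernel[OF R(2) c(1) gh' c(4) ik] tau_apply G.m_comm[OF gh'] ..
      qed (use c carrier_G in auto)
      hence "R ((u, n), (v, l)) = 0" by (simp only: act_one c one swap_swap)
      with nz show False ..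
    qed
    moreover have "n = 0"
    proof (rule ccontr)
      assume n: "n \<noteq> 0"
      \<comment> \<open>On this side the cocycle is \<tau>(g,h), with the exponent snd g times fst
        h. Swapping the two coordinates of G turns it into the normal form snd h times fst g of the
        quantum torus.\<close>
      have u: "prod.swap u \<in> {0..<int q} \<times> {0..<int q}"
        using c(1) by (cases u) (simp add: carrier_G)
      have "R ((prod.swap (prod.swap u), n), (act v \<one>\<^bsub>F\<^esub>, inv\<^bsub>F\<^esub> \<one>\<^bsub>F\<^esub> \<otimes>\<^bsub>F\<^esub> l)) = 0"
      proof (rule quantum_torus_trivial[OF fin_F card q1 primitive_root_tau[OF c(2) n],
            where K = "\<lambda>h i k. R ((prod.swap h, n), (act v i, inv\<^bsub>F\<^esub> i \<otimes>\<^bsub>F\<^esub> k))"])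
        fix g h i k assume gh: "g \<in> {0..<int q} \<times> {0..<int q}" "h \<in> {0..<int q} \<times> {0..<int q}"
          and ik: "i \<in> carrier F" "k \<in> carrier F"
        have gh': "prod.swap g \<in> carrier G" "prod.swap h \<in> carrier G" using gh by (auto simp: carrier_G)
        have sw: "prod.swap g \<otimes>\<^bsub>G\<^esub> prod.swap h = prod.swap (g \<otimes>\<^bsub>G\<^esub> h)"
          by (cases g; cases h) (simp add: mult_G)
        show "(\<Sum>k'\<in>carrier F. R ((prod.swap g, n), (act v i, inv\<^bsub>F\<^esub> i \<otimes>\<^bsub>F\<^esub> k')) *
            R ((prod.swap h, n), (act v k', inv\<^bsub>F\<^esub> k' \<otimes>\<^bsub>F\<^esub> k)))
          = (\<zeta> ^ geom (nat n) r) ^ (nat (snd h) * nat (fst g)) *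
            R ((prod.swap (g \<otimes>\<^bsub>G\<^esub> h), n), (act v i, inv\<^bsub>F\<^esub> i \<otimes>\<^bsub>F\<^esub> k))"
          unfolding qt_left_kernel[OF R(1) c(3) gh' c(2) ik] tau_apply sw by (simp add: mult.commute)
      qed (simp_all only: u c F.one_closed)
      hence "R ((u, n), (v, l)) = 0" by (simp only: act_one c one swap_swap)
      with nz show False ..
    qed
    ultimately show "n = \<one>\<^bsub>F\<^esub> \<and> l = \<one>\<^bsub>F\<^esub>" by simp
  qed
qed

end

section \<open>Testing the remaining axiom on generators\<close>

context B_lambda begin

lemma zeta_cong: "[a = b] (mod q) \<Longrightarrow> \<zeta> ^ a = \<zeta> ^ b"
  using \<zeta> power_mod_eq[of \<zeta> q] by (metis cong_def primitive_root_of_unity_def)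

lemma nat_mod_add: "x \<ge> 0 \<Longrightarrow> y \<ge> 0 \<Longrightarrow> nat ((x + y) mod int q) = (nat x + nat y) mod q"
  by (simp add: nat_mod_distrib nat_add_distrib)

lemma tau_mult:
  assumes "u \<in> carrier G" "v \<in> carrier G" "x \<in> carrier G"
  shows "\<tau> (u \<otimes>\<^bsub>G\<^esub> v) x n = \<tau> u x n * \<tau> v x n" "\<tau> u (v \<otimes>\<^bsub>G\<^esub> x) n = \<tau> u v n * \<tau> u x n"
proof -
  define \<omega> where "\<omega> = \<zeta> ^ geom (nat n) r"
  have \<omega>: "\<omega> ^ q = 1"
    using \<zeta> by (metis \<omega>_def mult.commute power_mult power_one primitive_root_of_unity_def)
  have pm: "(\<omega> ^ k) ^ (a mod q) = (\<omega> ^ k) ^ a" for a k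
    by (rule power_mod_eq) (metis \<omega> mult.commute power_mult power_one)
  obtain i j i' j' i'' j'' where e: "u = (i, j)" "v = (i', j')" "x = (i'', j'')" by (metis surj_pair)
  have nn: "i \<ge> 0" "j \<ge> 0" "i' \<ge> 0" "j' \<ge> 0" "i'' \<ge> 0" "j'' \<ge> 0"
    using assms by (auto simp: e carrier_G)
  have "\<tau> (u \<otimes>\<^bsub>G\<^esub> v) x n = (\<omega> ^ nat i'') ^ ((nat j + nat j') mod q)"
    using nn by (simp add: tau_apply \<omega>_def[symmetric] e mult_G nat_mod_add power_mult[symmetric] mult.commute)
  also have "\<dots> = \<tau> u x n * \<tau> v x n"
    unfolding pm by (simp add: tau_apply \<omega>_def[symmetric] e power_mult[symmetric] power_add[symmetric] algebra_simps)
  finally show "\<tau> (u \<otimes>\<^bsub>G\<^esub> v) x n = \<tau> u x n * \<tau> v x n" .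
  have "\<tau> u (v \<otimes>\<^bsub>G\<^esub> x) n = (\<omega> ^ nat j) ^ ((nat i' + nat i'') mod q)"
    using nn by (simp add: tau_apply \<omega>_def[symmetric] e mult_G nat_mod_add power_mult[symmetric])
  also have "\<dots> = \<tau> u v n * \<tau> u x n"
    unfolding pm by (simp add: tau_apply \<omega>_def[symmetric] e power_mult[symmetric] power_add[symmetric] algebra_simps)
  finally show "\<tau> u (v \<otimes>\<^bsub>G\<^esub> x) n = \<tau> u v n * \<tau> u x n" .
qed

lemma tau_nonzero: "\<tau> u v n \<noteq> 0"
proof -
  have "\<zeta> \<noteq> 0" using \<zeta> q0 by (auto simp: primitive_root_of_unity_def power_0_left)
  thus ?thesis by (simp add: tau_apply)
qed

text \<open>Acting by g^n on both arguments multiplies the exponent j k by m^(-(lam+1)n) = r^n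
  modulo q, which is exactly the next term of the geometric sum. This is the compatibility of \<tau>
  with the action.\<close>

lemma tau_Suc:
  assumes u: "u \<in> carrier G" and v: "v \<in> carrier G"
  shows "\<tau> u v (int (Suc n)) = \<tau> u v (int n) * \<tau> (act u (int n)) (act v (int n)) 1"
proof -
  obtain x j k y where e: "u = (x, j)" "v = (k, y)" by (metis surj_pair)
  have nn: "j \<ge> 0" "k \<ge> 0" using u v by (auto simp: e carrier_G)
  let ?i = "neg (int n)"
  have nat_mod: "nat ((int a * z) mod int q) = (a * nat z) mod q" if "z \<ge> 0" for a z
    using that by (simp add: nat_mod_distrib nat_mult_distrib)
  have geom1: "geom (Suc 0) r = 1" by (simp add: geom_def)
  have "\<tau> (act u (int n)) (act v (int n)) 1
    = \<zeta> ^ ((m ^ (lam * ?i) * nat j) mod q * ((m ^ ?i * nat k) mod q))"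
    using nn unfolding e tau_apply act_apply fst_conv snd_conv by (simp only: nat_mod) (simp add: geom1)
  also have "\<dots> = \<zeta> ^ (r ^ n * (nat j * nat k))"
  proof (rule zeta_cong)
    have "[int ?i = int ((p - 1) * n)] (mod int p)"
      using p0 by (simp add: int_neg cong_def mod_simps left_diff_distrib of_nat_diff)
        (simp add: mod_diff_left_eq[symmetric])
    hence "[?i = (p - 1) * n] (mod p)" by (simp only: cong_int_iff)
    hence "[(lam + 1) * ?i = (lam + 1) * ((p - 1) * n)] (mod p)" by (rule cong_scalar_left)
    hence "[m ^ ((lam + 1) * ?i) = m ^ ((lam + 1) * ((p - 1) * n))] (mod q)"
      by (rule cong_power_exponent[OF mp])
    moreover have "m ^ ((lam + 1) * ((p - 1) * n)) = r ^ n"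
      by (simp only: r_def power_mult[symmetric]) (simp only: mult.commute mult.left_commute mult.assoc)
    ultimately have "[m ^ (lam * ?i) * m ^ ?i = r ^ n] (mod q)"
      by (simp add: power_add mult.commute)
    hence "[m ^ (lam * ?i) * m ^ ?i * (nat j * nat k) = r ^ n * (nat j * nat k)] (mod q)"
      by (rule cong_scalar_right)
    thus "[(m ^ (lam * ?i) * nat j) mod q * ((m ^ ?i * nat k) mod q) = r ^ n * (nat j * nat k)] (mod q)"
      by (simp add: cong_def mod_mult_eq mult_ac)
  qed
  finally have step: "\<tau> (act u (int n)) (act v (int n)) 1 = \<zeta> ^ (r ^ n * (nat j * nat k))" .
  have "\<tau> u v (int (Suc n)) = (\<zeta> ^ (geom n r + r ^ n)) ^ (nat j * nat k)"
    unfolding tau_apply e nat_int by (simp add: geom_def add.commute)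
  moreover have "\<tau> u v (int n) = (\<zeta> ^ geom n r) ^ (nat j * nat k)"
    unfolding tau_apply e nat_int by simp
  ultimately show ?thesis
    unfolding step by (simp only: power_add power_mult_distrib power_mult)
qed

lemma pow_G: "(x, y) [^]\<^bsub>G\<^esub> (n::nat) = ((int n * x) mod int q, (int n * y) mod int q)"
  by (induction n) (simp_all add: one_G mult_G mod_simps algebra_simps)

text \<open>As c and d are prime to q, a^c and b^d generate G, and a bicharacter is determined on
  generators. In use c = m and d = m^lam, where the conditions on w are given.\<close>

lemma bicharacter_eqI:
  assumes D: "bicharacter G D" and E: "bicharacter G E"
    and c: "coprime c q" and d: "coprime d q"
    and eq: "\<And>u v. u \<in> {(int c mod int q, 0), (0, int d mod int q)} \<Longrightarrow>
      v \<in> {(int c mod int q, 0), (0, int d mod int q)} \<Longrightarrow> D u v = E u v"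
    and u: "u \<in> carrier G" and v: "v \<in> carrier G"
  shows "D u v = (E u v :: 'k)"
proof -
  let ?c = "(int c mod int q, 0) :: int \<times> int" and ?d = "(0, int d mod int q) :: int \<times> int"
  have cd: "?c \<in> carrier G" "?d \<in> carrier G" using q0 by (simp_all add: carrier_G)
  have gen: "\<exists>n n'. u = ?c [^]\<^bsub>G\<^esub> (n::nat) \<otimes>\<^bsub>G\<^esub> ?d [^]\<^bsub>G\<^esub> (n'::nat)" if "u \<in> carrier G" for u
  proof -
    obtain x y where e: "u = (x, y)" by (metis surj_pair)
    have xy: "x \<in> {0..<int q}" "y \<in> {0..<int q}" using that by (simp_all add: e carrier_G)
    have sol: "\<exists>n::nat. (int n * (int e mod int q)) mod int q = z" if "coprime e q" "z \<in> {0..<int q}" for e z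
    proof -
      obtain f where "[e * f = 1] (mod q)" using cong_solve_coprime_nat[OF \<open>coprime e q\<close>] by auto
      hence "[e * f * nat z = 1 * nat z] (mod q)" by (rule cong_scalar_right)
      hence "[int (e * f * nat z) = int (1 * nat z)] (mod int q)" by (simp only: cong_int_iff)
      hence "(int (f * nat z) * int e) mod int q = z"
        using that(2) by (simp add: cong_def mult_ac)
      hence "(int (f * nat z) * (int e mod int q)) mod int q = z"
        by (simp only: mod_mult_right_eq)
      thus ?thesis by blast
    qed
    obtain n n' :: nat where "(int n * (int c mod int q)) mod int q = x" "(int n' * (int d mod int q)) mod int q = y"
      using sol[OF c xy(1)] sol[OF d xy(2)] by blast
    hence "u = ?c [^]\<^bsub>G\<^esub> n \<otimes>\<^bsub>G\<^esub> ?d [^]\<^bsub>G\<^esub> n'"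
      using xy by (simp add: e pow_G mult_G)
    thus ?thesis by blast
  qed
  have pow: "W (x [^]\<^bsub>G\<^esub> (n::nat)) y = W x y ^ n" "W y (x [^]\<^bsub>G\<^esub> n) = W y x ^ n"
    if W: "bicharacter G W" and x: "x \<in> carrier G" and y: "y \<in> carrier G" for W :: "_ \<Rightarrow> _ \<Rightarrow> 'k" and x y n
  proof -
    have nz: "W x y \<noteq> 0" and mult: "W (x \<otimes>\<^bsub>G\<^esub> z) y = W x y * W z y" "W y (x \<otimes>\<^bsub>G\<^esub> z) = W y x * W y z"
      if "x \<in> carrier G" "y \<in> carrier G" "z \<in> carrier G" for x y z
      using W that unfolding bicharacter_def by blast+
    have one: "W \<one>\<^bsub>G\<^esub> y = 1" "W y \<one>\<^bsub>G\<^esub> = 1"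
      using mult[of "\<one>\<^bsub>G\<^esub>" y "\<one>\<^bsub>G\<^esub>"] nz[of "\<one>\<^bsub>G\<^esub>" y "\<one>\<^bsub>G\<^esub>"] nz[of y "\<one>\<^bsub>G\<^esub>" "\<one>\<^bsub>G\<^esub>"] y by simp_all
    show "W (x [^]\<^bsub>G\<^esub> n) y = W x y ^ n"
      using x y by (induction n) (simp_all add: one mult)
    show "W y (x [^]\<^bsub>G\<^esub> n) = W y x ^ n"
      using x y by (induction n) (simp_all add: one mult)
  qed
  obtain n n' l l' :: nat where e: "u = ?c [^]\<^bsub>G\<^esub> n \<otimes>\<^bsub>G\<^esub> ?d [^]\<^bsub>G\<^esub> n'" "v = ?c [^]\<^bsub>G\<^esub> l \<otimes>\<^bsub>G\<^esub> ?d [^]\<^bsub>G\<^esub> l'"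
    using gen u v by meson
  have "W u v = (W ?c ?c ^ l * W ?c ?d ^ l') ^ n * (W ?d ?c ^ l * W ?d ?d ^ l') ^ n'"
    if W: "bicharacter G W" for W :: "_ \<Rightarrow> _ \<Rightarrow> 'k"
  proof -
    have mult: "W (x \<otimes>\<^bsub>G\<^esub> z) y = W x y * W z y" "W y (x \<otimes>\<^bsub>G\<^esub> z) = W y x * W y z"
      if "x \<in> carrier G" "y \<in> carrier G" "z \<in> carrier G" for x y z
      using W that unfolding bicharacter_def by blast+
    have "W u v = W ?c v ^ n * W ?d v ^ n'"
      unfolding e(1) using cd v by (simp only: mult pow[OF W] G.nat_pow_closed)
    moreover have "W x v = W x ?c ^ l * W x ?d ^ l'" if "x \<in> carrier G" for x
      unfolding e(2) using cd that by (simp only: mult pow[OF W] G.nat_pow_closed)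
    ultimately show ?thesis using cd by simp
  qed
  from this[OF D] this[OF E] show ?thesis by (simp add: eq)
qed

lemma neg_1: "neg 1 = p - 1"
proof -
  have "(- 1) mod int p = int p - 1" using p1 by (simp add: zmod_minus1)
  thus ?thesis by (simp add: neg_def nat_diff_distrib)
qed

text \<open>g acts through m^(p-1), which inverts m modulo q. So the conditions comparing w at a, b
  with w at a^m, b^(m^lam) are invariance under g at a pair of generators.\<close>

lemma act_generators:
  "act (int m mod int q, 0) 1 = (1, 0)" "act (0, int (m ^ lam) mod int q) 1 = (0, 1)"
proof -
  have "(int (m ^ (k * (p - 1))) * (int (m ^ k) mod int q)) mod int q = 1" for k
  proof -
    have "k * (p - 1) + k = p * k" using p1 by (simp add: algebra_simps)
    hence "m ^ (k * (p - 1)) * m ^ k = (m ^ p) ^ k"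
      by (simp only: power_add[symmetric] power_mult[symmetric])
    moreover have "[(m ^ p) ^ k = 1] (mod q)" using cong_pow[OF mp, of k] by simp
    ultimately have "[int (m ^ (k * (p - 1)) * m ^ k) = int 1] (mod int q)" by (simp only: cong_int_iff)
    thus ?thesis using q1 by (simp add: cong_def mod_mult_right_eq)
  qed
  from this[of 1] this[of lam] show "act (int m mod int q, 0) 1 = (1, 0)" "act (0, int (m ^ lam) mod int q) 1 = (0, 1)"
    by (simp_all add: act_apply neg_1)
qed

lemma invariance_iff_generators:
  fixes w :: "int \<times> int \<Rightarrow> int \<times> int \<Rightarrow> 'k"
  defines "\<eta> \<equiv> B_eta p m \<zeta> lam" and "am \<equiv> (int m mod int q, 0)" and "bm \<equiv> (0, int (m ^ lam) mod int q)"
  assumes w: "bicharacter G w"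
  shows "(\<forall>u\<in>carrier G. \<forall>v\<in>carrier G. \<forall>i\<in>carrier F. \<tau> v u i * w (act u i) (act v i) = \<tau> u v i * w u v)
    \<longleftrightarrow> w gen_a gen_a = w am am \<and> w gen_a gen_b = w am bm * \<eta> am bm gen_g \<and>
      w gen_b gen_a = w bm am * \<eta> bm am gen_g \<and> w gen_b gen_b = w bm bm"
    (is "?L \<longleftrightarrow> ?R")
proof -
  have \<eta>: "\<eta> u v i = \<tau> u v i * inverse (\<tau> v u i)" for u v i by (simp add: \<eta>_def B_eta_def)
  have cm: "coprime m q"
  proof -
    have "coprime (m ^ p) q" using mp by (metis cong_imp_coprime cong_sym coprime_1_left)
    thus ?thesis using p0 by simp
  qed
  have am: "am \<in> carrier G" "bm \<in> carrier G" using q0 by (simp_all add: am_def bm_def carrier_G)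
  have g1: "1 \<in> carrier F" using p1 by (simp add: carrier_F)
  have acts: "act am 1 = gen_a" "act bm 1 = gen_b"
    unfolding am_def bm_def by (rule act_generators)+
  \<comment> \<open>\<eta> is 1 on equal arguments, which is why the conditions on w(a,a) and w(b,b)
    carry no factor \<eta>.\<close>
  have eta1: "\<eta> am am 1 = 1" "\<eta> bm bm 1 = 1"
    by (simp_all add: \<eta> tau_apply am_def bm_def)
  show ?thesis
  proof
    assume L: ?L
    have "w (act u 1) (act v 1) = w u v * \<eta> u v 1" if "u \<in> carrier G" "v \<in> carrier G" for u v
      using L that g1 tau_nonzero[of v u 1] by (simp add: \<eta> field_simps)
    from this[OF am(1) am(1)] this[OF am] this[OF am(2,1)] this[OF am(2,2)]
    show ?R by (simp add: acts eta1)
  next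
    assume R: ?R
    have wD: "w x y \<noteq> 0" "w (x \<otimes>\<^bsub>G\<^esub> z) y = w x y * w z y" "w y (x \<otimes>\<^bsub>G\<^esub> z) = w y x * w y z"
      if "x \<in> carrier G" "y \<in> carrier G" "z \<in> carrier G" for x y z
      using w that unfolding bicharacter_def by blast+
    \<comment> \<open>Both sides of the invariance under g are bicharacters: acting by g is an
      endomorphism of G, and \<eta> inherits multiplicativity from \<tau>. Hence generators
      suffice.\<close>
    have D: "bicharacter G (\<lambda>u v. w (act u 1) (act v 1))"
      unfolding bicharacter_def using g1 by (simp add: act_hom wD)
    have E: "bicharacter G (\<lambda>u v. w u v * \<eta> u v 1)"
      unfolding bicharacter_def by (simp add: \<eta> wD tau_mult tau_nonzero inverse_mult_distrib mult_ac)
    have 1: "w (act u 1) (act v 1) = w u v * \<eta> u v 1" if "u \<in> carrier G" "v \<in> carrier G" for u v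
    proof (rule bicharacter_eqI[OF D E cm _ _ that, of "m ^ lam"], fold am_def bm_def)
      show "coprime (m ^ lam) q" using cm by simp
      fix u v assume "u \<in> {am, bm}" "v \<in> {am, bm}"
      thus "w (act u 1) (act v 1) = w u v * \<eta> u v 1"
        using R by (auto simp: acts eta1)
    qed
    \<comment> \<open>Invariance under g is applied at the translates of u and v by g^n, and
      \<open>tau_Suc\<close> in both orders of the arguments combines the factors \<eta>.\<close>
    have ind: "w (act u (int n)) (act v (int n)) = w u v * \<eta> u v (int n)"
      if "u \<in> carrier G" "v \<in> carrier G" "n < p" for u v n
      using that(3)
    proof (induction n)
      case 0
      show ?case using that \<tau>_one[of u v] \<tau>_one[of v u] by (simp add: \<eta> act_one[simplified])
    next
      case (Suc n)
      have n: "int n \<in> carrier F" using Suc.prems by (simp add: carrier_F)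
      have a: "act x (int (Suc n)) = act (act x (int n)) 1" if "x \<in> carrier G" for x
        using act_act[OF that n g1] Suc.prems by (simp add: add.commute)
      have "w (act u (int (Suc n))) (act v (int (Suc n)))
        = w (act u (int n)) (act v (int n)) * \<eta> (act u (int n)) (act v (int n)) 1"
        using that n by (simp only: a 1 act_closed)
      also have "\<dots> = w u v * (\<eta> u v (int n) * \<eta> (act u (int n)) (act v (int n)) 1)"
        using Suc by simp
      also have "\<eta> u v (int n) * \<eta> (act u (int n)) (act v (int n)) 1 = \<eta> u v (int (Suc n))"
        unfolding \<eta> tau_Suc[OF that(1,2)] tau_Suc[OF that(2,1)] by simp
      finally show ?case .
    qed
    show ?L
    proof (intro ballI)
      fix u v i assume c: "u \<in> carrier G" "v \<in> carrier G" "i \<in> carrier F"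
      have "w (act u i) (act v i) = w u v * \<eta> u v i"
      proof -
        have "nat i < p" "int (nat i) = i" using c(3) by (auto simp: carrier_F)
        with ind[OF c(1,2), of "nat i"] show ?thesis by simp
      qed
      thus "\<tau> v u i * w (act u i) (act v i) = \<tau> u v i * w u v"
        using tau_nonzero[of v u i] by (simp add: \<eta>)
    qed
  qed
qed

lemma B_alg_eq: "B_alg p q m \<zeta> lam = H"
  by (simp only: B_alg_def H_def)

lemma sum_carrier_G: "(\<Sum>x\<in>carrier G. f x) = (\<Sum>i<q. \<Sum>j<q. f (int i, int j))"
proof -
  have *: "(\<Sum>x\<in>{0..<int q}. g x) = (\<Sum>i<q. g (int i))" for g :: "int \<Rightarrow> 'a::comm_monoid_add"
    by (rule sum.reindex_bij_witness[of _ int nat]) auto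
  show ?thesis unfolding carrier_G sum.cartesian_product' * ..
qed

lemma R_of_eq_sum:
  fixes w :: "int \<times> int \<Rightarrow> int \<times> int \<Rightarrow> 'k"
  defines "e \<equiv> (\<lambda>i j. bvec (gen_a [^]\<^bsub>G\<^esub> i \<otimes>\<^bsub>G\<^esub> gen_b [^]\<^bsub>G\<^esub> j, \<one>\<^bsub>F\<^esub>))"
  shows "R_of w = (\<lambda>c. \<Sum>i<q. \<Sum>j<q. \<Sum>k<q. \<Sum>l<q.
    w (gen_a [^]\<^bsub>G\<^esub> i \<otimes>\<^bsub>G\<^esub> gen_b [^]\<^bsub>G\<^esub> j) (gen_a [^]\<^bsub>G\<^esub> k \<otimes>\<^bsub>G\<^esub> gen_b [^]\<^bsub>G\<^esub> l) * (e i j \<otimes>\<^sub>v e k l) c)"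
proof
  fix c :: "((int \<times> int) \<times> int) \<times> (int \<times> int) \<times> int"
  obtain u n v l where c: "c = ((u, n), (v, l))" by (metis surj_pair)
  have g: "gen_a [^]\<^bsub>G\<^esub> i \<otimes>\<^bsub>G\<^esub> gen_b [^]\<^bsub>G\<^esub> j = (int i, int j)" if "i < q" "j < q" for i j
    using that by (simp add: pow_G mult_G)
  have "(\<Sum>i<q. \<Sum>j<q. \<Sum>k<q. \<Sum>l<q.
    w (gen_a [^]\<^bsub>G\<^esub> i \<otimes>\<^bsub>G\<^esub> gen_b [^]\<^bsub>G\<^esub> j) (gen_a [^]\<^bsub>G\<^esub> k \<otimes>\<^bsub>G\<^esub> gen_b [^]\<^bsub>G\<^esub> l) * (e i j \<otimes>\<^sub>v e k l) c)
    = (\<Sum>x\<in>carrier G. \<Sum>y\<in>carrier G. w x y * (bvec (x, \<one>\<^bsub>F\<^esub>) \<otimes>\<^sub>v bvec (y, \<one>\<^bsub>F\<^esub>)) c)"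
    unfolding sum_carrier_G e_def by (intro sum.cong refl) (simp add: g)
  also have "\<dots> = (\<Sum>x\<in>carrier G. \<Sum>y\<in>carrier G.
      (if x = u \<and> y = v then (if n = \<one>\<^bsub>F\<^esub> \<and> l = \<one>\<^bsub>F\<^esub> then 1 else 0) else 0) * w x y)"
    by (intro sum.cong refl) (auto simp: c tens_def bvec_def)
  also have "\<dots> = R_of w c"
  proof (cases "u \<in> carrier G \<and> v \<in> carrier G")
    case True
    thus ?thesis by (subst sum_sum_delta) (auto simp: c R_of_apply)
  next
    case False
    hence "(\<Sum>x\<in>carrier G. \<Sum>y\<in>carrier G.
      (if x = u \<and> y = v then (if n = \<one>\<^bsub>F\<^esub> \<and> l = \<one>\<^bsub>F\<^esub> then 1 else 0) else 0) * w x y) = 0"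
      by (intro sum.neutral ballI) auto
    with False show ?thesis by (auto simp: c R_of_apply)
  qed
  finally show "R_of w c = (\<Sum>i<q. \<Sum>j<q. \<Sum>k<q. \<Sum>l<q.
    w (gen_a [^]\<^bsub>G\<^esub> i \<otimes>\<^bsub>G\<^esub> gen_b [^]\<^bsub>G\<^esub> j) (gen_a [^]\<^bsub>G\<^esub> k \<otimes>\<^bsub>G\<^esub> gen_b [^]\<^bsub>G\<^esub> l) * (e i j \<otimes>\<^sub>v e k l) c)" ..
qed

theorem quasitriangular_structures_B:
  fixes R :: "((int \<times> int) \<times> int) \<times> (int \<times> int) \<times> int \<Rightarrow> 'k"
  defines "\<eta> \<equiv> B_eta p m \<zeta> lam" and "am \<equiv> gen_a [^]\<^bsub>G\<^esub> m" and "bm \<equiv> gen_b [^]\<^bsub>G\<^esub> (m ^ lam)"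
    and "e \<equiv> (\<lambda>i j. bvec (gen_a [^]\<^bsub>G\<^esub> i \<otimes>\<^bsub>G\<^esub> gen_b [^]\<^bsub>G\<^esub> j, \<one>\<^bsub>F\<^esub>))"
  shows "quasitriangular H R \<longleftrightarrow> (\<exists>w. bicharacter G w \<and>
     w gen_a gen_a = w am am \<and>
     w gen_a gen_b = w am bm * \<eta> am bm gen_g \<and>
     w gen_b gen_a = w bm am * \<eta> bm am gen_g \<and>
     w gen_b gen_b = w bm bm \<and>
     R = (\<lambda>c. \<Sum>i<q. \<Sum>j<q. \<Sum>k<q. \<Sum>l<q.
       w (gen_a [^]\<^bsub>G\<^esub> i \<otimes>\<^bsub>G\<^esub> gen_b [^]\<^bsub>G\<^esub> j) (gen_a [^]\<^bsub>G\<^esub> k \<otimes>\<^bsub>G\<^esub> gen_b [^]\<^bsub>G\<^esub> l) *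
       (e i j \<otimes>\<^sub>v e k l) c))"
proof -
  have am: "am = (int m mod int q, 0)" "bm = (0, int (m ^ lam) mod int q)"
    by (simp_all add: am_def bm_def pow_G)
  show ?thesis
    unfolding quasitriangular_iff_bicharacter e_def R_of_eq_sum[symmetric] am \<eta>_def
    using invariance_iff_generators by blast
qed

end

section \<open>The main theorem\<close>

theorem theorem1p2:
  fixes p q :: nat
  assumes "prime p" "odd p" "prime q" "odd q" "p \<noteq> q"
  shows
    "(\<forall>t::nat. [p = 1] (mod q) \<and> [t ^ q = 1] (mod p) \<and> \<not> [t = 1] (mod p) \<longrightarrow>
       (let G = Zp_sd_Zq p q t; F = integer_mod_group q; H = (A0 p q t :: (_, 'k::{alg_closed_field, field_char_0}) hopf_data) in
        \<forall>\<beta>. linear_form (basis (H \<otimes>\<^sub>H H)) \<beta> \<longrightarrow>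
          (braiding_structure H \<beta> \<longleftrightarrow>
           (\<exists>\<mu>. \<mu> ^ q = 1 \<and>
             (\<forall>h\<in>carrier G. \<forall>k\<in>carrier G. \<forall>i<q. \<forall>j<q.
                \<beta> (bvec (h, gen_g [^]\<^bsub>F\<^esub> i) \<otimes>\<^sub>v bvec (k, gen_g [^]\<^bsub>F\<^esub> j)) =
                (if h = gen_b [^]\<^bsub>G\<^esub> j then 1 else 0) *
                (if k = gen_b [^]\<^bsub>G\<^esub> (- int i) then 1 else 0) * \<mu> ^ (i * j)))))) \<and>
     (\<forall>(m::nat) (\<zeta>::'k::{alg_closed_field, field_char_0}) (lams :: nat \<Rightarrow> nat) lam.
        [q = 1] (mod p) \<and> [m ^ p = 1] (mod q) \<and> \<not> [m = 1] (mod q) \<and>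
        primitive_root_of_unity q \<zeta> \<and>
        inj_on lams {1..(p - 1) div 2} \<and> lams ` {1..(p - 1) div 2} \<subseteq> {1..p - 2} \<and>
        (\<forall>i\<in>{1..(p - 1) div 2}. \<forall>j\<in>{1..(p - 1) div 2}.
           i \<noteq> j \<longrightarrow> \<not> [lams i * lams j = 1] (mod p)) \<and>
        lam \<in> {0} \<union> lams ` {1..(p - 1) div 2} \<longrightarrow>
       (let G = Zq_Zq q; H = B_alg p q m \<zeta> lam; \<eta> = B_eta p m \<zeta> lam;
            a = gen_a; b = gen_b; am = a [^]\<^bsub>G\<^esub> m; bm = b [^]\<^bsub>G\<^esub> (m ^ lam);
            e = (\<lambda>i j. bvec (a [^]\<^bsub>G\<^esub> i \<otimes>\<^bsub>G\<^esub> b [^]\<^bsub>G\<^esub> j, \<one>\<^bsub>integer_mod_group p\<^esub>)) in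
        \<forall>R. quasitriangular H R \<longleftrightarrow>
          (\<exists>w. bicharacter G w \<and>
             w a a = w am am \<and>
             w a b = w am bm * \<eta> am bm gen_g \<and>
             w b a = w bm am * \<eta> bm am gen_g \<and>
             w b b = w bm bm \<and>
             R = (\<lambda>c. \<Sum>i<q. \<Sum>j<q. \<Sum>k<q. \<Sum>l<q.
                    w (a [^]\<^bsub>G\<^esub> i \<otimes>\<^bsub>G\<^esub> b [^]\<^bsub>G\<^esub> j) (a [^]\<^bsub>G\<^esub> k \<otimes>\<^bsub>G\<^esub> b [^]\<^bsub>G\<^esub> l) *
                    (e i j \<otimes>\<^sub>v e k l) c))))"
proof (intro conjI allI impI, goal_cases)
  case (1 t)
  then interpret nonabelian_pq p q t "TYPE('k)"
    by unfold_locales (use assms in auto)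
  show ?case
    unfolding Let_def A0_eq using braiding_structures_A0 by blast
next
  case (2 m \<zeta> lams lam)
  \<comment> \<open>Both sources of lam, 0 and the chosen set, give this bound. Since p > 2 the
    natural subtraction is exact, and lam + 1 < p follows.\<close>
  then have "lam \<le> p - 2" by auto
  moreover have "p > 2"
    using prime_gt_1_nat[OF assms(1)] assms(2) by (cases "p = 2") auto
  ultimately have lam: "lam + 1 < p" by simp
  interpret B_lambda p q m lam \<zeta>
    by unfold_locales (use assms 2 lam in blast)+
  show ?case
    unfolding Let_def B_alg_eq by (rule allI) (rule quasitriangular_structures_B)
qed

end
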